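(* The following two statements are equivalent (so that, to prove or disprove (i), it is enough to consider (ii)): (i) For every field $K$ of characteristic zero, every commutative $K$-algebra $\mathcal{A}$, every $n\ge 1$, and every commuting subset $\mathcal{C}\subset\mathbb{D}_K[z]$ of differential operators of $\mathcal{A}[z]=\mathcal{A}[z_1,\dots,z_n]$, the image conjecture holds for $\mathcal{A}[z]$ and $\mathcal{C}$. (ii) For every field $K$ of characteristic zero, every commutative $K$-algebra $\mathcal{A}$, every $n\ge 1$, and every $q(z)\in\mathcal{A}[z]=\mathcal{A}[z_1,\dots,z_n]$, the image conjecture holds for $\mathcal{A}[z]$ and $\mathcal{C}=\{\partial_i-\partial_i(q(z))\mid 1\le i\le n\}$.
   Context: For a commutative algebra $\mathcal{A}$ over a field $K$ of characteristic zero, $z=(z_1,\dots,z_n)$ are commuting free variables and $\partial_i:=\partial/\partial z_i$ on $\mathcal{A}[z]$. $\mathbb{D}_K[z]$ denotes the set of differential operators of $\mathcal{A}[z]$ of the form $h(z)+\sum_{i=1}^n c_i\partial_i$ with $h(z)\in\mathcal{A}[z]$ (acting by multiplication) and leading coefficients $c_i\in K$. A subset $\mathcal{C}$ of differential operators is commuting if any two of its elements commute. Its image is $\operatorname{Im}\mathcal{C}:=\sum_{\Phi\in\mathcal{C}}\Phi(\mathcal{A}[z])$. The image conjecture holds for $\mathcal{A}[z]$ and $\mathcal{C}$ means: for any $f,g\in\mathcal{A}[z]$ with $f^m\in\operatorname{Im}\mathcal{C}$ for each $m\ge 1$, one has $f^mg\in\operatorname{Im}\mathcal{C}$ for all sufficiently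 large $m$. *)

theory Defs
  imports "HOL-Algebra.Algebra"
begin

definition char_zero :: "('k, 'm) ring_scheme \<Rightarrow> bool"
  where "char_zero K \<longleftrightarrow> (\<forall>k::nat. 0 < k \<longrightarrow> add_pow K k \<one>\<^bsub>K\<^esub> \<noteq> \<zero>\<^bsub>K\<^esub>)"

text \<open>
  The algebra \<open>A[z\<^sub>1, \<dots>, z\<^sub>n]\<close>.  As in \<^theory>\<open>HOL-Algebra.Indexed_Polynomials\<close>, a monomial is the
  multiset of its variables, the variable \<open>z\<^sub>i\<close> is represented by its index \<open>i \<in> {1..n}\<close>, and a
  polynomial maps each monomial to its coefficient.
\<close>
definition mpoly_algebra ::
    "('k, 'a, 'm) module_scheme \<Rightarrow> nat \<Rightarrow> ('k, nat multiset \<Rightarrow> 'a) module"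
  where "mpoly_algebra A n =
    \<lparr> carrier = ring.indexed_pset A {1..n} (carrier A),
      monoid.mult = (\<lambda>p q m. \<Oplus>\<^bsub>A\<^esub>a\<in>{a. a \<subseteq># m}. p a \<otimes>\<^bsub>A\<^esub> q (m - a)),
      monoid.one = ring.indexed_const A \<one>\<^bsub>A\<^esub>,
      ring.zero = ring.indexed_const A \<zero>\<^bsub>A\<^esub>,
      ring.add = ring.indexed_padd A,
      module.smult = (\<lambda>c p m. c \<odot>\<^bsub>A\<^esub> p m) \<rparr>"

text \<open>
  The library generates the set of polynomials inductively; it consists of the coefficient
  functions of finite support involving only the variables \<open>z\<^sub>1, \<dots>, z\<^sub>n\<close>.
\<close>
lemma (in ring) indexed_pset_iff:
  fixes p :: "'c multiset \<Rightarrow> 'a"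
  shows "p \<in> indexed_pset I (carrier R) \<longleftrightarrow>
    (\<forall>m. p m \<in> carrier R) \<and> finite {m. p m \<noteq> \<zero>} \<and> (\<forall>m. p m \<noteq> \<zero> \<longrightarrow> set_mset m \<subseteq> I)"
  (is "_ \<longleftrightarrow> ?Q p")
proof
  assume "p \<in> indexed_pset I (carrier R)"
  thus "?Q p"
  proof (induction rule: indexed_pset.induct)
    case (indexed_const k)
    have "{m. (indexed_const k :: 'c multiset \<Rightarrow> 'a) m \<noteq> \<zero>} \<subseteq> {{#}}"
      by (auto simp: indexed_const_def)
    with indexed_const show ?case
      by (auto simp: indexed_const_def intro: finite_subset)
  next
    case (indexed_padd P Q)
    have "{m. indexed_padd P Q m \<noteq> \<zero>} \<subseteq> {m. P m \<noteq> \<zero>} \<union> {m. Q m \<noteq> \<zero>}"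
      by (auto simp: indexed_padd_def)
    moreover have "set_mset m \<subseteq> I" if "indexed_padd P Q m \<noteq> \<zero>" for m
      using that indexed_padd calculation by blast
    ultimately show ?case
      using indexed_padd by (auto simp: indexed_padd_def intro: finite_subset[OF _ finite_UnI])
  next
    case (indexed_pmult P i)
    have "{m. indexed_pmult P i m \<noteq> \<zero>} \<subseteq> add_mset i ` {m. P m \<noteq> \<zero>}"
    proof
      fix m assume "m \<in> {m. indexed_pmult P i m \<noteq> \<zero>}"
      hence "i \<in># m" "P (m - {#i#}) \<noteq> \<zero>"
        by (auto simp: indexed_pmult_def split: if_splits)
      thus "m \<in> add_mset i ` {m. P m \<noteq> \<zero>}"
        by (intro image_eqI[of _ _ "m - {#i#}"]) auto
    qed
    moreover from this have "finite {m. indexed_pmult P i m \<noteq> \<zero>}"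
      using indexed_pmult by (auto intro: finite_subset)
    moreover have "set_mset m \<subseteq> I" if "indexed_pmult P i m \<noteq> \<zero>" for m
      using that calculation(1) indexed_pmult by fastforce
    ultimately show ?case
      using indexed_pmult indexed_pmult_in_carrier[of P i] by (simp add: carrier_coeff_def)
  qed
next
  have mon: "(\<lambda>m'. if m' = m then k else \<zero>) \<in> indexed_pset I (carrier R)"
    if "k \<in> carrier R" "set_mset m \<subseteq> I" for k and m :: "'c multiset"
    using that(2)
  proof (induction m)
    case empty
    show ?case using indexed_pset.indexed_const[OF that(1)] by (simp add: indexed_const_def)
  next
    case (add i m)
    have "indexed_pmult (\<lambda>m'. if m' = m then k else \<zero>) i
        = (\<lambda>m'. if m' = add_mset i m then k else \<zero>)"
      by (rule ext) (auto simp: indexed_pmult_def)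
    with indexed_pset.indexed_pmult[OF add.IH, of i] add.prems show ?case
      by simp
  qed
  assume Q: "?Q p"
  have "finite S \<Longrightarrow> S \<subseteq> {m. p m \<noteq> \<zero>} \<Longrightarrow>
      (\<lambda>m. if m \<in> S then p m else \<zero>) \<in> indexed_pset I (carrier R)" for S
  proof (induction S rule: finite_induct)
    case empty
    show ?case using indexed_pset.indexed_const[OF zero_closed] by (simp add: indexed_const_def)
  next
    case (insert m S)
    have "indexed_padd (\<lambda>m'. if m' = m then p m else \<zero>) (\<lambda>m'. if m' \<in> S then p m' else \<zero>)
        = (\<lambda>m'. if m' \<in> insert m S then p m' else \<zero>)"
      using insert Q by (intro ext) (auto simp: indexed_padd_def)
    with indexed_pset.indexed_padd[OF mon[of "p m" m] insert.IH] insert.prems show ?case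
      using Q by auto
  qed
  from this[of "{m. p m \<noteq> \<zero>}"]
  have "(\<lambda>m. if m \<in> {m. p m \<noteq> \<zero>} then p m else \<zero>) \<in> indexed_pset I (carrier R)"
    using Q by blast
  moreover have "(\<lambda>m. if m \<in> {m. p m \<noteq> \<zero>} then p m else \<zero>) = p"
    by auto
  ultimately show "p \<in> indexed_pset I (carrier R)"
    by (rule back_subst[where P = "\<lambda>p. p \<in> indexed_pset I (carrier R)"])
qed

text \<open>\<open>\<partial>\<^sub>i\<close>: the coefficient of \<open>z\<^sup>m\<close> in \<open>\<partial>\<^sub>i p\<close> is \<open>m\<^sub>i + 1\<close> times that of \<open>z\<^sub>i z\<^sup>m\<close> in \<open>p\<close>.\<close>
definition mpoly_deriv ::
    "('k, 'a, 'm) module_scheme \<Rightarrow> nat \<Rightarrow> (nat multiset \<Rightarrow> 'a) \<Rightarrow> (nat multiset \<Rightarrow> 'a)"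
  where "mpoly_deriv A i p = (\<lambda>m. add_pow A (Suc (count m i)) (p (add_mset i m)))"

text \<open>
  Operators are functions on the carrier of the polynomial algebra, made \<^const>\<open>undefined\<close> outside
  of it so that equality of functions is equality of operators.
\<close>
definition first_order_op ::
    "('k, 'a, 'm) module_scheme \<Rightarrow> nat \<Rightarrow> (nat multiset \<Rightarrow> 'a) \<Rightarrow> (nat \<Rightarrow> 'k)
      \<Rightarrow> (nat multiset \<Rightarrow> 'a) \<Rightarrow> (nat multiset \<Rightarrow> 'a)"
  where "first_order_op A n h c =
    (let P = mpoly_algebra A n in
      (\<lambda>p\<in>carrier P. (h \<otimes>\<^bsub>P\<^esub> p) \<oplus>\<^bsub>P\<^esub> (\<Oplus>\<^bsub>P\<^esub>i\<in>{1..n}. c i \<odot>\<^bsub>P\<^esub> mpoly_deriv A i p)))"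

definition diff_ops ::
    "('k, 'r) ring_scheme \<Rightarrow> ('k, 'a, 'm) module_scheme \<Rightarrow> nat
      \<Rightarrow> ((nat multiset \<Rightarrow> 'a) \<Rightarrow> (nat multiset \<Rightarrow> 'a)) set"
  where "diff_ops K A n =
    {first_order_op A n h c | h c. h \<in> carrier (mpoly_algebra A n) \<and> c \<in> {1..n} \<rightarrow> carrier K}"

definition grad_ops ::
    "('k, 'a, 'm) module_scheme \<Rightarrow> nat \<Rightarrow> (nat multiset \<Rightarrow> 'a)
      \<Rightarrow> ((nat multiset \<Rightarrow> 'a) \<Rightarrow> (nat multiset \<Rightarrow> 'a)) set"
  where "grad_ops A n q =
    (let P = mpoly_algebra A n in
      {(\<lambda>p\<in>carrier P. mpoly_deriv A i p \<ominus>\<^bsub>P\<^esub> (mpoly_deriv A i q \<otimes>\<^bsub>P\<^esub> p)) | i. i \<in> {1..n}})"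

definition commuting_ops :: "('b, 'm) ring_scheme \<Rightarrow> ('b \<Rightarrow> 'b) set \<Rightarrow> bool"
  where "commuting_ops R C \<longleftrightarrow>
    (\<forall>\<Phi>\<in>C. \<forall>\<Psi>\<in>C. \<forall>p\<in>carrier R. \<Phi> (\<Psi> p) = \<Psi> (\<Phi> p))"

text \<open>
  \<open>Im C\<close>: as \<open>C\<close> may be infinite, the sum of the images consists of all finite sums of values.
\<close>
definition ops_image :: "('b, 'm) ring_scheme \<Rightarrow> ('b \<Rightarrow> 'b) set \<Rightarrow> 'b set"
  where "ops_image R C =
    {(\<Oplus>\<^bsub>R\<^esub>\<Phi>\<in>F. \<Phi> (u \<Phi>)) | F u. finite F \<and> F \<subseteq> C \<and> u \<in> F \<rightarrow> carrier R}"

definition image_conjecture_holds :: "('b, 'm) ring_scheme \<Rightarrow> ('b \<Rightarrow> 'b) set \<Rightarrow> bool"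
  where "image_conjecture_holds R C \<longleftrightarrow>
    (\<forall>f\<in>carrier R. \<forall>g\<in>carrier R.
      (\<forall>m::nat. 1 \<le> m \<longrightarrow> f [^]\<^bsub>R\<^esub> m \<in> ops_image R C) \<longrightarrow>
      (\<exists>N::nat. \<forall>m\<ge>N. f [^]\<^bsub>R\<^esub> m \<otimes>\<^bsub>R\<^esub> g \<in> ops_image R C))"

end

theory Submission
  imports Defs
begin

text \<open>
  Gradient operators commute because partial derivatives do, so that the statement about
  commuting operators contains the one about gradient operators.

  Conversely, let \<open>C\<close> be a commuting set of operators on \<open>P = A[z]\<close>.  Gaussian elimination
  (\<open>dual_family_exists\<close>) selects operators \<open>\<Phi>\<^sub>j = h\<^sub>j + D\<^sub>j\<close> in \<open>C\<close>, for \<open>j = 1, \<dots>, r\<close>, whose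
  leading parts \<open>D\<^sub>j\<close> span those of \<open>C\<close>, together with linear forms \<open>x\<^sub>i\<close> such that
  \<open>D\<^sub>j x\<^sub>i\<close> is \<open>1\<close> for \<open>i = j\<close> and \<open>0\<close> otherwise.  Every \<open>\<Phi>\<close> in \<open>C\<close> is a linear combination of
  the \<open>\<Phi>\<^sub>j\<close> up to the multiplication by some \<open>k\<close>, and commutation says that \<open>D\<^sub>i h\<^sub>j = D\<^sub>j h\<^sub>i\<close>
  and \<open>D\<^sub>j k = 0\<close>.  Let \<open>J\<close> be the ideal generated by these \<open>k\<close>; the image of \<open>C\<close> is \<open>J\<close> plus the
  sum of the images of the \<open>\<Phi>\<^sub>j\<close>.

  A linear change of coordinates turning the \<open>D\<^sub>j\<close> into partial derivatives is replaced by the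
  Taylor expansion \<open>\<tau>\<close> from \<open>P\<close> to \<open>P[t\<^sub>1, \<dots>, t\<^sub>r]\<close> along the directions of the \<open>D\<^sub>j\<close>
  (\<open>straightening\<close>).  It carries \<open>D\<^sub>j\<close> to the derivative with respect to \<open>t\<^sub>j\<close>, and has a
  retraction \<open>\<rho>\<close> that carries the derivatives back.  By the Poincare lemma
  (\<open>mpoly_gradient_exists\<close>) the \<open>\<tau>(h\<^sub>j)\<close> are the partial derivatives of \<open>- G\<close> for some
  polynomial \<open>G\<close>, so that \<open>\<Phi>\<^sub>j\<close> is carried to a gradient operator.  On reducing coefficients
  modulo \<open>J\<close>, one obtains a homomorphism from \<open>P\<close> to \<open>(P/J)[t\<^sub>1, \<dots>, t\<^sub>r]\<close> for which the image of
  \<open>C\<close> is exactly the preimage of the image of the gradient operators of \<open>G\<close>.  The image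
  conjecture passes from the target to the source of such a homomorphism
  (\<open>image_conjecture_holds_pullback\<close>); for \<open>r = 0\<close> there is no operator left, and nothing to
  assume.

  The statement is about algebras on a fixed type.  The algebra \<open>P/J\<close> can be put on that type,
  because a nonzero algebra over a field of characteristic zero is infinite, and polynomials with
  coefficients in an infinite type embed into that type (\<open>mpoly_embedding\<close>).
\<close>

section \<open>The algebra of polynomials\<close>

lemma finite_submultisets: "finite {a. a \<subseteq># m}"
proof (induction m)
  case (add x m)
  have "{a. a \<subseteq># add_mset x m} \<subseteq> {a. a \<subseteq># m} \<union> add_mset x ` {a. a \<subseteq># m}"
  proof
    fix a assume "a \<in> {a. a \<subseteq># add_mset x m}"
    hence a: "a \<subseteq># add_mset x m" by simp
    show "a \<in> {a. a \<subseteq># m} \<union> add_mset x ` {a. a \<subseteq># m}"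
    proof (cases "x \<in># a")
      case True
      hence "a = add_mset x (a - {#x#})" by simp
      moreover have "a - {#x#} \<subseteq># m" using a by (simp add: subset_eq_diff_conv)
      ultimately show ?thesis by blast
    next
      case False
      with a have "a \<subseteq># m"
        by (metis add_mset_remove_trivial diff_single_trivial subset_eq_diff_conv add_mset_add_single)
      thus ?thesis by simp
    qed
  qed
  with add show ?case by (meson finite_Un finite_imageI finite_subset)
qed simp

text \<open>The constant polynomial \<open>k\<close>.\<close>
definition mpoly_const :: "('k, 'a, 'm) module_scheme \<Rightarrow> 'a \<Rightarrow> (nat multiset \<Rightarrow> 'a)"
  where "mpoly_const A k = (\<lambda>m. if m = {#} then k else \<zero>\<^bsub>A\<^esub>)"

text \<open>The polynomial \<open>z\<^sub>i\<close>; it lies in \<open>A[z\<^sub>1, \<dots>, z\<^sub>n]\<close> only for \<open>i \<in> {1..n}\<close>.\<close>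
definition mpoly_var :: "('k, 'a, 'm) module_scheme \<Rightarrow> nat \<Rightarrow> (nat multiset \<Rightarrow> 'a)"
  where "mpoly_var A i = (\<lambda>m. if m = {#i#} then \<one>\<^bsub>A\<^esub> else \<zero>\<^bsub>A\<^esub>)"

text \<open>The product of a polynomial with the variable \<open>z\<^sub>i\<close>.\<close>
definition mpoly_shift ::
    "('k, 'a, 'm) module_scheme \<Rightarrow> nat \<Rightarrow> (nat multiset \<Rightarrow> 'a) \<Rightarrow> (nat multiset \<Rightarrow> 'a)"
  where "mpoly_shift A i p = (\<lambda>m. if i \<in># m then p (m - {#i#}) else \<zero>\<^bsub>A\<^esub>)"

text \<open>The Cauchy product of two coefficient functions, whether or not their support is finite.\<close>
definition mpoly_conv ::
    "('k, 'a, 'm) module_scheme \<Rightarrow> (nat multiset \<Rightarrow> 'a) \<Rightarrow> (nat multiset \<Rightarrow> 'a) \<Rightarrow> (nat multiset \<Rightarrow> 'a)"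
  where "mpoly_conv A p q = (\<lambda>m. \<Oplus>\<^bsub>A\<^esub>a\<in>{a. a \<subseteq># m}. p a \<otimes>\<^bsub>A\<^esub> q (m - a))"

context algebra
begin

lemma mpoly_carrier_iff:
  "p \<in> carrier (mpoly_algebra M n) \<longleftrightarrow> (\<forall>m. p m \<in> carrier M) \<and> finite {m. p m \<noteq> \<zero>\<^bsub>M\<^esub>}
    \<and> (\<forall>m. p m \<noteq> \<zero>\<^bsub>M\<^esub> \<longrightarrow> set_mset m \<subseteq> {1..n})"
  by (simp add: mpoly_algebra_def indexed_pset_iff)

lemma mpoly_coeff_closed: "p \<in> carrier (mpoly_algebra M n) \<Longrightarrow> p m \<in> carrier M"
  by (simp add: mpoly_carrier_iff)

lemma mpoly_add: "p \<oplus>\<^bsub>mpoly_algebra M n\<^esub> q = (\<lambda>m. p m \<oplus>\<^bsub>M\<^esub> q m)"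
  by (simp add: mpoly_algebra_def indexed_padd_def)

lemma mpoly_zero: "\<zero>\<^bsub>mpoly_algebra M n\<^esub> = (\<lambda>m. \<zero>\<^bsub>M\<^esub>)"
  by (simp add: mpoly_algebra_def indexed_zero_def)

lemma mpoly_one: "\<one>\<^bsub>mpoly_algebra M n\<^esub> = mpoly_const M \<one>\<^bsub>M\<^esub>"
  by (simp add: mpoly_algebra_def indexed_const_def mpoly_const_def)

lemma mpoly_mult: "p \<otimes>\<^bsub>mpoly_algebra M n\<^esub> q = mpoly_conv M p q"
  by (simp add: mpoly_algebra_def mpoly_conv_def)

lemma mpoly_smult: "c \<odot>\<^bsub>mpoly_algebra M n\<^esub> p = (\<lambda>m. c \<odot>\<^bsub>M\<^esub> p m)"
  by (simp add: mpoly_algebra_def)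

lemma mpoly_const_closed: "k \<in> carrier M \<Longrightarrow> mpoly_const M k \<in> carrier (mpoly_algebra M n)"
  using indexed_pset.indexed_const[of k "carrier M" "{1..n}"]
  by (simp add: mpoly_algebra_def indexed_const_def mpoly_const_def)

lemma mpoly_add_closed:
  "p \<in> carrier (mpoly_algebra M n) \<Longrightarrow> q \<in> carrier (mpoly_algebra M n) \<Longrightarrow>
    p \<oplus>\<^bsub>mpoly_algebra M n\<^esub> q \<in> carrier (mpoly_algebra M n)"
  using indexed_pset.indexed_padd[of p "{1..n}" "carrier M" q]
  by (simp add: mpoly_algebra_def)

lemma mpoly_shift_closed:
  "p \<in> carrier (mpoly_algebra M n) \<Longrightarrow> i \<in> {1..n} \<Longrightarrow>
    mpoly_shift M i p \<in> carrier (mpoly_algebra M n)"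
  using indexed_pset.indexed_pmult[of p "{1..n}" "carrier M" i]
  by (simp add: mpoly_algebra_def mpoly_shift_def indexed_pmult_def)

lemma mpoly_induct_shift [consumes 1, case_names const add shift]:
  assumes "p \<in> carrier (mpoly_algebra M n)"
    and "\<And>k. k \<in> carrier M \<Longrightarrow> Q (mpoly_const M k)"
    and "\<And>p q. p \<in> carrier (mpoly_algebra M n) \<Longrightarrow> q \<in> carrier (mpoly_algebra M n) \<Longrightarrow>
      Q p \<Longrightarrow> Q q \<Longrightarrow> Q (p \<oplus>\<^bsub>mpoly_algebra M n\<^esub> q)"
    and "\<And>p i. p \<in> carrier (mpoly_algebra M n) \<Longrightarrow> i \<in> {1..n} \<Longrightarrow> Q p \<Longrightarrow> Q (mpoly_shift M i p)"
  shows "Q p"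
proof -
  have "p \<in> indexed_pset {1..n} (carrier M)" using assms(1) by (simp add: mpoly_algebra_def)
  thus ?thesis
  proof (induction rule: indexed_pset.induct)
    case (indexed_const k) thus ?case using assms(2)[of k]
      by (simp add: indexed_const_def mpoly_const_def)
  next
    case (indexed_padd P Q) thus ?case using assms(3)[of P Q] by (simp add: mpoly_algebra_def)
  next
    case (indexed_pmult P i) thus ?case using assms(4)[of P i]
      by (simp add: mpoly_algebra_def mpoly_shift_def indexed_pmult_def)
  qed
qed

lemma mpoly_conv_const:
  assumes "k \<in> carrier M" "\<And>m. q m \<in> carrier M"
  shows "mpoly_conv M (mpoly_const M k) q = (\<lambda>m. k \<otimes>\<^bsub>M\<^esub> q m)"
proof
  fix m
  have "mpoly_conv M (mpoly_const M k) q m =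
      (\<Oplus>\<^bsub>M\<^esub>a\<in>{a. a \<subseteq># m}. if {#} = a then k \<otimes>\<^bsub>M\<^esub> q (m - a) else \<zero>\<^bsub>M\<^esub>)"
    unfolding mpoly_conv_def using assms
    by (intro M.finsum_cong') (auto simp: mpoly_const_def)
  also have "\<dots> = k \<otimes>\<^bsub>M\<^esub> q (m - {#})"
    by (rule M.finsum_singleton) (use assms finite_submultisets in auto)
  finally show "mpoly_conv M (mpoly_const M k) q m = k \<otimes>\<^bsub>M\<^esub> q m" by simp
qed

lemma mpoly_conv_add_left:
  assumes "\<And>m. p m \<in> carrier M" "\<And>m. p' m \<in> carrier M" "\<And>m. q m \<in> carrier M"
  shows "mpoly_conv M (\<lambda>m. p m \<oplus>\<^bsub>M\<^esub> p' m) q = (\<lambda>m. mpoly_conv M p q m \<oplus>\<^bsub>M\<^esub> mpoly_conv M p' q m)"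
  unfolding mpoly_conv_def using assms
  by (simp add: l_distr M.finsum_addf)

lemma mpoly_conv_closed:
  "(\<And>m. p m \<in> carrier M) \<Longrightarrow> (\<And>m. q m \<in> carrier M) \<Longrightarrow> mpoly_conv M p q m \<in> carrier M"
  unfolding mpoly_conv_def by (intro M.finsum_closed) auto

lemma mpoly_conv_comm:
  assumes "\<And>m. p m \<in> carrier M" "\<And>m. q m \<in> carrier M"
  shows "mpoly_conv M p q = mpoly_conv M q p"
proof
  fix m :: "nat multiset"
  have im: "{a. a \<subseteq># m} = (\<lambda>a. m - a) ` {a. a \<subseteq># m}"
  proof (intro equalityI subsetI)
    fix a assume "a \<in> {a. a \<subseteq># m}"
    thus "a \<in> (\<lambda>a. m - a) ` {a. a \<subseteq># m}" by (intro image_eqI[of _ _ "m - a"]) (auto simp: subseteq_mset_def multiset_eq_iff)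
  qed auto
  have inj: "inj_on (\<lambda>a. m - a) {a. a \<subseteq># m}"
    by (rule inj_on_inverseI[of _ "\<lambda>a. m - a"]) (auto simp: subseteq_mset_def multiset_eq_iff)
  have "mpoly_conv M p q m = (\<Oplus>\<^bsub>M\<^esub>a\<in>(\<lambda>a. m - a) ` {a. a \<subseteq># m}. p a \<otimes>\<^bsub>M\<^esub> q (m - a))"
    unfolding mpoly_conv_def by (subst im) simp
  also have "\<dots> = (\<Oplus>\<^bsub>M\<^esub>a\<in>{a. a \<subseteq># m}. p (m - a) \<otimes>\<^bsub>M\<^esub> q (m - (m - a)))"
    by (rule M.finsum_reindex) (use inj assms in auto)
  also have "\<dots> = (\<Oplus>\<^bsub>M\<^esub>a\<in>{a. a \<subseteq># m}. q a \<otimes>\<^bsub>M\<^esub> p (m - a))"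
  proof (rule M.finsum_cong')
    fix a assume "a \<in> {a. a \<subseteq># m}"
    hence "m - (m - a) = a" by (auto simp: subseteq_mset_def multiset_eq_iff)
    thus "p (m - a) \<otimes>\<^bsub>M\<^esub> q (m - (m - a)) = q a \<otimes>\<^bsub>M\<^esub> p (m - a)"
      using assms by (simp add: m_comm)
  qed (use assms in auto)
  finally show "mpoly_conv M p q m = mpoly_conv M q p m" by (simp add: mpoly_conv_def)
qed

text \<open>
  The identity \<open>(z\<^sub>i p) q = z\<^sub>i (p q)\<close>.  With it the ring axioms, like most statements about
  polynomials below, reduce to the case of a constant by induction on the first factor.
\<close>
lemma mpoly_conv_shift:
  assumes "\<And>m. p m \<in> carrier M" "\<And>m. q m \<in> carrier M"
  shows "mpoly_conv M (mpoly_shift M i p) q = mpoly_shift M i (mpoly_conv M p q)"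
proof
  fix m
  show "mpoly_conv M (mpoly_shift M i p) q m = mpoly_shift M i (mpoly_conv M p q) m"
  proof (cases "i \<in># m")
    case False
    hence "i \<notin># a" if "a \<subseteq># m" for a using that by (meson mset_subset_eqD)
    hence "mpoly_conv M (mpoly_shift M i p) q m = (\<Oplus>\<^bsub>M\<^esub>a\<in>{a. a \<subseteq># m}. \<zero>\<^bsub>M\<^esub>)"
      unfolding mpoly_conv_def using assms
      by (intro M.finsum_cong') (auto simp: mpoly_shift_def)
    thus ?thesis using False by (simp add: mpoly_shift_def)
  next
    case True
    have "mpoly_conv M (mpoly_shift M i p) q m
        = (\<Oplus>\<^bsub>M\<^esub>a\<in>add_mset i ` {a. a \<subseteq># m - {#i#}}. mpoly_shift M i p a \<otimes>\<^bsub>M\<^esub> q (m - a))"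
      unfolding mpoly_conv_def
    proof (rule M.add.finprod_mono_neutral_cong_right)
      show "finite {a. a \<subseteq># m}" by (rule finite_submultisets)
      show "add_mset i ` {a. a \<subseteq># m - {#i#}} \<subseteq> {a. a \<subseteq># m}"
        using True by (auto simp: insert_subset_eq_iff)
      fix a assume "a \<in> {a. a \<subseteq># m} - add_mset i ` {a. a \<subseteq># m - {#i#}}"
      hence "i \<notin># a"
        by (metis (mono_tags, lifting) DiffE image_eqI insert_DiffM insert_subset_eq_iff mem_Collect_eq)
      thus "mpoly_shift M i p a \<otimes>\<^bsub>M\<^esub> q (m - a) = \<zero>\<^bsub>M\<^esub>"
        using assms by (simp add: mpoly_shift_def)
    qed (use assms in \<open>auto simp: mpoly_shift_def\<close>)
    also have "\<dots> = (\<Oplus>\<^bsub>M\<^esub>a\<in>{a. a \<subseteq># m - {#i#}}. mpoly_shift M i p (add_mset i a) \<otimes>\<^bsub>M\<^esub> q (m - add_mset i a))"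
      by (rule M.finsum_reindex) (use assms in \<open>auto simp: mpoly_shift_def inj_on_def\<close>)
    also have "\<dots> = (\<Oplus>\<^bsub>M\<^esub>a\<in>{a. a \<subseteq># m - {#i#}}. p a \<otimes>\<^bsub>M\<^esub> q (m - {#i#} - a))"
      by (simp add: mpoly_shift_def)
    finally show ?thesis using True by (simp add: mpoly_shift_def mpoly_conv_def)
  qed
qed

lemma mpoly_mult_closed:
  assumes "p \<in> carrier (mpoly_algebra M n)" "q \<in> carrier (mpoly_algebra M n)"
  shows "p \<otimes>\<^bsub>mpoly_algebra M n\<^esub> q \<in> carrier (mpoly_algebra M n)"
  unfolding mpoly_mult using assms(1)
proof (induction rule: mpoly_induct_shift)
  case (const k)
  have "{m. k \<otimes>\<^bsub>M\<^esub> q m \<noteq> \<zero>\<^bsub>M\<^esub>} \<subseteq> {m. q m \<noteq> \<zero>\<^bsub>M\<^esub>}" using const by auto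
  with const assms(2) show ?case
    by (auto simp: mpoly_conv_const mpoly_carrier_iff intro: finite_subset)
next
  case (add p p')
  thus ?case using assms(2) mpoly_add_closed[of _ n "mpoly_conv M p' q"]
    by (simp add: mpoly_add mpoly_conv_add_left mpoly_coeff_closed)
next
  case (shift p i)
  thus ?case using assms(2) by (simp add: mpoly_conv_shift mpoly_coeff_closed mpoly_shift_closed)
qed

lemma mpoly_conv_assoc:
  assumes "p \<in> carrier (mpoly_algebra M n)" "q \<in> carrier (mpoly_algebra M n)"
    "r \<in> carrier (mpoly_algebra M n)"
  shows "mpoly_conv M (mpoly_conv M p q) r = mpoly_conv M p (mpoly_conv M q r)"
  using assms(1)
proof (induction rule: mpoly_induct_shift)
  case (const k)
  hence "mpoly_conv M (\<lambda>m. k \<otimes>\<^bsub>M\<^esub> q m) r = (\<lambda>m. k \<otimes>\<^bsub>M\<^esub> mpoly_conv M q r m)"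
    unfolding mpoly_conv_def using assms(2,3)
    by (subst finsum_rdistr) (auto simp: mpoly_coeff_closed m_assoc finite_submultisets)
  with const assms(2,3) show ?case
    by (simp add: mpoly_conv_const mpoly_coeff_closed mpoly_conv_closed)
next
  case (add p p')
  thus ?case using assms(2,3)
    by (simp add: mpoly_add mpoly_conv_add_left mpoly_coeff_closed mpoly_conv_closed)
next
  case (shift p i)
  thus ?case using assms(2,3) by (simp add: mpoly_conv_shift mpoly_coeff_closed mpoly_conv_closed)
qed

lemma mpoly_smult_closed:
  assumes "c \<in> carrier R" "p \<in> carrier (mpoly_algebra M n)"
  shows "c \<odot>\<^bsub>mpoly_algebra M n\<^esub> p \<in> carrier (mpoly_algebra M n)"
proof -
  have "{m. c \<odot>\<^bsub>M\<^esub> p m \<noteq> \<zero>\<^bsub>M\<^esub>} \<subseteq> {m. p m \<noteq> \<zero>\<^bsub>M\<^esub>}" using assms by auto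
  with assms show ?thesis by (auto simp: mpoly_smult mpoly_carrier_iff intro: finite_subset)
qed

lemma mpoly_cring: "cring (mpoly_algebra M n)"
proof (rule cringI)
  let ?P = "mpoly_algebra M n"
  show "abelian_group ?P"
  proof (rule abelian_groupI)
    fix p assume p: "p \<in> carrier ?P"
    have "{m. \<ominus>\<^bsub>M\<^esub> p m \<noteq> \<zero>\<^bsub>M\<^esub>} \<subseteq> {m. p m \<noteq> \<zero>\<^bsub>M\<^esub>}" by auto
    hence "(\<lambda>m. \<ominus>\<^bsub>M\<^esub> p m) \<in> carrier ?P"
      using p by (auto simp: mpoly_carrier_iff intro: finite_subset)
    moreover have "(\<lambda>m. \<ominus>\<^bsub>M\<^esub> p m) \<oplus>\<^bsub>?P\<^esub> p = \<zero>\<^bsub>?P\<^esub>"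
      using p by (simp add: mpoly_add mpoly_zero mpoly_carrier_iff M.l_neg)
    ultimately show "\<exists>q\<in>carrier ?P. q \<oplus>\<^bsub>?P\<^esub> p = \<zero>\<^bsub>?P\<^esub>" by blast
    show "\<zero>\<^bsub>?P\<^esub> \<oplus>\<^bsub>?P\<^esub> p = p" using p by (simp add: mpoly_add mpoly_zero mpoly_carrier_iff)
  next
    show "\<zero>\<^bsub>?P\<^esub> \<in> carrier ?P" by (simp add: mpoly_zero mpoly_carrier_iff)
  qed (use mpoly_add_closed in \<open>auto simp: mpoly_add mpoly_coeff_closed M.a_ac\<close>)
  show "Group.comm_monoid ?P"
  proof (rule comm_monoidI)
    fix p assume "p \<in> carrier ?P"
    thus "\<one>\<^bsub>?P\<^esub> \<otimes>\<^bsub>?P\<^esub> p = p"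
      by (simp add: mpoly_one mpoly_mult mpoly_conv_const mpoly_coeff_closed)
  qed (use mpoly_mult_closed in \<open>auto simp: mpoly_one mpoly_const_closed mpoly_mult
      mpoly_conv_assoc mpoly_coeff_closed intro!: mpoly_conv_comm\<close>)
  show "(p \<oplus>\<^bsub>?P\<^esub> q) \<otimes>\<^bsub>?P\<^esub> r = p \<otimes>\<^bsub>?P\<^esub> r \<oplus>\<^bsub>?P\<^esub> q \<otimes>\<^bsub>?P\<^esub> r"
    if "p \<in> carrier ?P" "q \<in> carrier ?P" "r \<in> carrier ?P" for p q r
    using that by (simp add: mpoly_mult mpoly_add mpoly_conv_add_left mpoly_coeff_closed)
qed

theorem mpoly_algebra: "algebra R (mpoly_algebra M n)"
proof (rule algebraI)
  fix c p q assume a: "c \<in> carrier R" "p \<in> carrier (mpoly_algebra M n)" "q \<in> carrier (mpoly_algebra M n)"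
  show "c \<odot>\<^bsub>mpoly_algebra M n\<^esub> p \<otimes>\<^bsub>mpoly_algebra M n\<^esub> q = c \<odot>\<^bsub>mpoly_algebra M n\<^esub> (p \<otimes>\<^bsub>mpoly_algebra M n\<^esub> q)"
    using a by (simp add: mpoly_smult mpoly_mult mpoly_conv_def finite_submultisets
        finsum_smult_ldistr mpoly_coeff_closed smult_assoc2 Pi_def)
qed (use mpoly_smult_closed in \<open>auto simp: R_cring mpoly_cring mpoly_smult mpoly_add
    mpoly_coeff_closed smult_l_distr smult_r_distr smult_assoc1\<close>)

lemma mpoly_var_closed: "i \<in> {1..n} \<Longrightarrow> mpoly_var M i \<in> carrier (mpoly_algebra M n)"
  by (auto simp: mpoly_carrier_iff mpoly_var_def)

lemma mpoly_var_mult: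
  assumes "p \<in> carrier (mpoly_algebra M n)"
  shows "mpoly_var M i \<otimes>\<^bsub>mpoly_algebra M n\<^esub> p = mpoly_shift M i p"
proof -
  have "mpoly_var M i = mpoly_shift M i (mpoly_const M \<one>\<^bsub>M\<^esub>)"
    by (rule ext) (auto simp: mpoly_var_def mpoly_shift_def mpoly_const_def dest!: multi_member_split)
  thus ?thesis using assms
    by (simp add: mpoly_mult mpoly_conv_shift mpoly_conv_const mpoly_coeff_closed mpoly_const_def)
      (simp add: mpoly_conv_shift mpoly_conv_const[unfolded mpoly_const_def] mpoly_coeff_closed)
qed

lemma mpoly_const_mult:
  "k \<in> carrier M \<Longrightarrow> p \<in> carrier (mpoly_algebra M n) \<Longrightarrow>
    mpoly_const M k \<otimes>\<^bsub>mpoly_algebra M n\<^esub> p = (\<lambda>m. k \<otimes>\<^bsub>M\<^esub> p m)"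
  by (simp add: mpoly_mult mpoly_conv_const mpoly_coeff_closed)

lemma mpoly_induct [consumes 1, case_names const add var]:
  assumes "p \<in> carrier (mpoly_algebra M n)"
    and "\<And>k. k \<in> carrier M \<Longrightarrow> Q (mpoly_const M k)"
    and "\<And>p q. p \<in> carrier (mpoly_algebra M n) \<Longrightarrow> q \<in> carrier (mpoly_algebra M n) \<Longrightarrow>
      Q p \<Longrightarrow> Q q \<Longrightarrow> Q (p \<oplus>\<^bsub>mpoly_algebra M n\<^esub> q)"
    and "\<And>p i. p \<in> carrier (mpoly_algebra M n) \<Longrightarrow> i \<in> {1..n} \<Longrightarrow> Q p \<Longrightarrow>
      Q (mpoly_var M i \<otimes>\<^bsub>mpoly_algebra M n\<^esub> p)"
  shows "Q p"
  using assms(1)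
  by (induction rule: mpoly_induct_shift) (use assms(2-) mpoly_var_mult in auto)

lemma mpoly_const_ring_hom: "mpoly_const M \<in> ring_hom M (mpoly_algebra M n)"
  by (rule ring_hom_memI)
    (simp_all add: mpoly_const_closed mpoly_one mpoly_add mpoly_const_mult, auto simp: mpoly_const_def)

end

section \<open>Homomorphisms out of the algebra of polynomials\<close>

lemma (in algebra) mpoly_ring_hom_eq:
  assumes "cring S" "g \<in> ring_hom (mpoly_algebra M n) S" "h \<in> ring_hom (mpoly_algebra M n) S"
    and "\<And>k. k \<in> carrier M \<Longrightarrow> g (mpoly_const M k) = h (mpoly_const M k)"
    and "\<And>i. i \<in> {1..n} \<Longrightarrow> g (mpoly_var M i) = h (mpoly_var M i)"
    and "p \<in> carrier (mpoly_algebra M n)"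
  shows "g p = h p"
  using assms(6)
  by (induction rule: mpoly_induct)
    (use assms(4,5) mpoly_var_closed in
      \<open>simp_all add: ring_hom_add[OF assms(2)] ring_hom_add[OF assms(3)]
        ring_hom_mult[OF assms(2)] ring_hom_mult[OF assms(3)]\<close>)

lemma (in abelian_monoid) finsum_mem:
  assumes T: "T \<subseteq> carrier G" "\<zero> \<in> T" "\<And>a b. a \<in> T \<Longrightarrow> b \<in> T \<Longrightarrow> a \<oplus> b \<in> T"
    and f: "\<And>i. i \<in> I \<Longrightarrow> f i \<in> T"
  shows "(\<Oplus>i\<in>I. f i) \<in> T"
proof (cases "finite I")
  case True
  thus ?thesis using f
  proof (induction I)
    case (insert i I)
    hence "(\<Oplus>j\<in>insert i I. f j) = f i \<oplus> (\<Oplus>j\<in>I. f j)"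
      using T(1) by (intro finsum_insert) auto
    with insert T(3) show ?case by auto
  qed (simp add: T)
qed (simp add: T finsum_infinite)

text \<open>The product of the \<open>x\<^sub>i\<close> prescribed by the monomial \<open>m\<close>.\<close>
definition monom_eval :: "('s, 'm) ring_scheme \<Rightarrow> nat \<Rightarrow> (nat \<Rightarrow> 's) \<Rightarrow> nat multiset \<Rightarrow> 's"
  where "monom_eval S n x m = (\<Otimes>\<^bsub>S\<^esub>i\<in>{1..n}. x i [^]\<^bsub>S\<^esub> count m i)"

lemma (in cring) monom_eval_closed:
  "x \<in> {1..n} \<rightarrow> carrier R \<Longrightarrow> monom_eval R n x m \<in> carrier R"
  unfolding monom_eval_def by (intro finprod_closed) auto

lemma (in cring) monom_eval_empty: "monom_eval R n x {#} = \<one>"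
  by (simp add: monom_eval_def)

lemma (in cring) monom_eval_add_mset:
  assumes x: "x \<in> {1..n} \<rightarrow> carrier R" and i: "i \<in> {1..n}"
  shows "monom_eval R n x (add_mset i m) = x i \<otimes> monom_eval R n x m"
proof -
  have "monom_eval R n x (add_mset i m)
      = (\<Otimes>j\<in>{1..n}. (if i = j then x j else \<one>) \<otimes> x j [^] count m j)"
    unfolding monom_eval_def
  proof (rule finprod_cong')
    fix j assume "j \<in> {1..n}"
    with x have xj: "x j \<in> carrier R" by blast
    thus "x j [^] count (add_mset i m) j = (if i = j then x j else \<one>) \<otimes> x j [^] count m j"
      by (simp add: m_comm)
  qed (use x i in \<open>auto simp: Pi_iff\<close>)
  also have "\<dots> = (\<Otimes>j\<in>{1..n}. if i = j then x j else \<one>) \<otimes> monom_eval R n x m"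
    unfolding monom_eval_def using x by (intro finprod_multf) auto
  also have "(\<Otimes>j\<in>{1..n}. if i = j then x j else \<one>) = x i"
    by (rule finprod_singleton) (use i x in auto)
  finally show ?thesis .
qed

text \<open>
  The universal property of the algebra of polynomials.  The last clause records that values lie
  in every ideal that contains the images of all coefficients.
\<close>
theorem (in algebra) mpoly_ring_hom_exists:
  assumes "cring S" and \<phi>: "\<phi> \<in> ring_hom M S" and x: "x \<in> {1..n} \<rightarrow> carrier S"
  obtains h where "h \<in> ring_hom (mpoly_algebra M n) S"
    and "\<And>k. k \<in> carrier M \<Longrightarrow> h (mpoly_const M k) = \<phi> k"
    and "\<And>i. i \<in> {1..n} \<Longrightarrow> h (mpoly_var M i) = x i"
    and "\<And>p J. p \<in> carrier (mpoly_algebra M n) \<Longrightarrow> ideal J S \<Longrightarrow> (\<And>m. \<phi> (p m) \<in> J) \<Longrightarrow> h p \<in> J"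
proof -
  interpret S: cring S by fact
  interpret \<phi>: ring_hom_cring M S \<phi>
    by (intro ring_hom_cring.intro ring_hom_cring_axioms.intro \<phi> S.is_cring M_cring)
  let ?P = "mpoly_algebra M n"
  define supp where "supp p = {m. p m \<noteq> \<zero>\<^bsub>M\<^esub>}" for p :: "nat multiset \<Rightarrow> 'c"
  define h where "h p = (\<Oplus>\<^bsub>S\<^esub>m\<in>supp p. \<phi> (p m) \<otimes>\<^bsub>S\<^esub> monom_eval S n x m)" for p
  note mon = S.monom_eval_closed[OF x]
  have fin: "finite (supp p)" if "p \<in> carrier ?P" for p
    using that by (simp add: supp_def mpoly_carrier_iff)
  have on: "h p = (\<Oplus>\<^bsub>S\<^esub>m\<in>T. \<phi> (p m) \<otimes>\<^bsub>S\<^esub> monom_eval S n x m)"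
    if "p \<in> carrier ?P" "finite T" "supp p \<subseteq> T" for p T
    unfolding h_def using that mon
    by (intro S.add.finprod_mono_neutral_cong_left) (auto simp: supp_def mpoly_coeff_closed)
  have h_const: "h (mpoly_const M k) = \<phi> k" if k: "k \<in> carrier M" for k
  proof -
    have "h (mpoly_const M k) = (\<Oplus>\<^bsub>S\<^esub>m\<in>{{#}}. \<phi> (mpoly_const M k m) \<otimes>\<^bsub>S\<^esub> monom_eval S n x m)"
      by (rule on) (use mpoly_const_closed k in \<open>auto simp: supp_def mpoly_const_def\<close>)
    thus ?thesis using k by (simp add: mpoly_const_def S.monom_eval_empty)
  qed
  have h_closed: "h p \<in> carrier S" if "p \<in> carrier ?P" for p
    unfolding h_def using that mon by (intro S.finsum_closed) (auto simp: mpoly_coeff_closed)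
  have h_add: "h (p \<oplus>\<^bsub>?P\<^esub> q) = h p \<oplus>\<^bsub>S\<^esub> h q" if p: "p \<in> carrier ?P" and q: "q \<in> carrier ?P" for p q
  proof -
    let ?T = "supp p \<union> supp q"
    have "h (p \<oplus>\<^bsub>?P\<^esub> q) = (\<Oplus>\<^bsub>S\<^esub>m\<in>?T. \<phi> ((p \<oplus>\<^bsub>?P\<^esub> q) m) \<otimes>\<^bsub>S\<^esub> monom_eval S n x m)"
      by (rule on) (use p q fin mpoly_add_closed in \<open>auto simp: supp_def mpoly_add\<close>)
    also have "\<dots> = (\<Oplus>\<^bsub>S\<^esub>m\<in>?T. \<phi> (p m) \<otimes>\<^bsub>S\<^esub> monom_eval S n x m
        \<oplus>\<^bsub>S\<^esub> \<phi> (q m) \<otimes>\<^bsub>S\<^esub> monom_eval S n x m)"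
      using p q mon by (intro S.finsum_cong') (auto simp: mpoly_add mpoly_coeff_closed S.l_distr)
    also have "\<dots> = (\<Oplus>\<^bsub>S\<^esub>m\<in>?T. \<phi> (p m) \<otimes>\<^bsub>S\<^esub> monom_eval S n x m)
        \<oplus>\<^bsub>S\<^esub> (\<Oplus>\<^bsub>S\<^esub>m\<in>?T. \<phi> (q m) \<otimes>\<^bsub>S\<^esub> monom_eval S n x m)"
      using p q mon by (intro S.finsum_addf) (auto simp: mpoly_coeff_closed)
    also have "\<dots> = h p \<oplus>\<^bsub>S\<^esub> h q" using on[OF p, of ?T] on[OF q, of ?T] fin[OF p] fin[OF q] by simp
    finally show ?thesis .
  qed
  have h_shift: "h (mpoly_shift M i p) = x i \<otimes>\<^bsub>S\<^esub> h p" if p: "p \<in> carrier ?P" and i: "i \<in> {1..n}" for i p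
  proof -
    have xi: "x i \<in> carrier S" using x i by blast
    have "h (mpoly_shift M i p)
        = (\<Oplus>\<^bsub>S\<^esub>m\<in>add_mset i ` supp p. \<phi> (mpoly_shift M i p m) \<otimes>\<^bsub>S\<^esub> monom_eval S n x m)"
    proof (rule on)
      show "supp (mpoly_shift M i p) \<subseteq> add_mset i ` supp p"
      proof
        fix m assume "m \<in> supp (mpoly_shift M i p)"
        hence "i \<in># m" "m - {#i#} \<in> supp p" by (auto simp: supp_def mpoly_shift_def split: if_splits)
        thus "m \<in> add_mset i ` supp p" by (intro image_eqI[of _ _ "m - {#i#}"]) auto
      qed
    qed (use p i fin mpoly_shift_closed in auto)
    also have "\<dots> = (\<Oplus>\<^bsub>S\<^esub>m\<in>supp p. \<phi> (mpoly_shift M i p (add_mset i m)) \<otimes>\<^bsub>S\<^esub> monom_eval S n x (add_mset i m))"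
      using p i mon
      by (intro S.finsum_reindex) (auto simp: inj_on_def mpoly_shift_def mpoly_coeff_closed)
    also have "\<dots> = (\<Oplus>\<^bsub>S\<^esub>m\<in>supp p. x i \<otimes>\<^bsub>S\<^esub> (\<phi> (p m) \<otimes>\<^bsub>S\<^esub> monom_eval S n x m))"
      using p i mon xi
      by (intro S.finsum_cong')
        (auto simp: mpoly_shift_def mpoly_coeff_closed S.monom_eval_add_mset[OF x i] S.m_lcomm)
    also have "\<dots> = x i \<otimes>\<^bsub>S\<^esub> h p"
      unfolding h_def using p mon xi fin
      by (intro S.finsum_rdistr[symmetric]) (auto simp: mpoly_coeff_closed)
    finally show ?thesis .
  qed
  have h_scale: "h (mpoly_const M k \<otimes>\<^bsub>?P\<^esub> q) = \<phi> k \<otimes>\<^bsub>S\<^esub> h q" if k: "k \<in> carrier M" and q: "q \<in> carrier ?P" for k q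
  proof -
    have "h (mpoly_const M k \<otimes>\<^bsub>?P\<^esub> q)
        = (\<Oplus>\<^bsub>S\<^esub>m\<in>supp q. \<phi> ((mpoly_const M k \<otimes>\<^bsub>?P\<^esub> q) m) \<otimes>\<^bsub>S\<^esub> monom_eval S n x m)"
    proof (rule on)
      show "mpoly_const M k \<otimes>\<^bsub>?P\<^esub> q \<in> carrier ?P"
        using k q by (intro mpoly_mult_closed mpoly_const_closed)
      show "supp (mpoly_const M k \<otimes>\<^bsub>?P\<^esub> q) \<subseteq> supp q"
        using k q by (auto simp: supp_def mpoly_const_mult)
    qed (use q fin in auto)
    also have "\<dots> = (\<Oplus>\<^bsub>S\<^esub>m\<in>supp q. \<phi> k \<otimes>\<^bsub>S\<^esub> (\<phi> (q m) \<otimes>\<^bsub>S\<^esub> monom_eval S n x m))"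
      using k q mon
      by (intro S.finsum_cong') (auto simp: mpoly_const_mult mpoly_coeff_closed S.m_assoc)
    also have "\<dots> = \<phi> k \<otimes>\<^bsub>S\<^esub> h q"
      unfolding h_def using k q mon fin
      by (intro S.finsum_rdistr[symmetric]) (auto simp: mpoly_coeff_closed)
    finally show ?thesis .
  qed
  interpret P: cring ?P by (rule mpoly_cring)
  have h_mult: "h (p \<otimes>\<^bsub>?P\<^esub> q) = h p \<otimes>\<^bsub>S\<^esub> h q" if p: "p \<in> carrier ?P" and q: "q \<in> carrier ?P" for p q
    using p
  proof (induction rule: mpoly_induct)
    case (const k)
    thus ?case using q by (simp add: h_scale h_const)
  next
    case (add p p')
    thus ?case using q by (simp add: P.l_distr h_add h_closed S.l_distr)
  next
    case (var p i)
    moreover have "x i \<in> carrier S" using x var by blast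
    moreover have "h (mpoly_var M i \<otimes>\<^bsub>?P\<^esub> (p \<otimes>\<^bsub>?P\<^esub> q)) = x i \<otimes>\<^bsub>S\<^esub> h (p \<otimes>\<^bsub>?P\<^esub> q)"
      using var q by (subst mpoly_var_mult) (auto simp: h_shift)
    moreover have "h (mpoly_var M i \<otimes>\<^bsub>?P\<^esub> p) = x i \<otimes>\<^bsub>S\<^esub> h p"
      using var by (subst mpoly_var_mult) (auto simp: h_shift)
    ultimately show ?case using q by (simp add: P.m_assoc S.m_assoc h_closed mpoly_var_closed)
  qed
  have h_var: "h (mpoly_var M i) = x i" if i: "i \<in> {1..n}" for i
  proof -
    have xi: "x i \<in> carrier S" using x i by blast
    have "mpoly_var M i = mpoly_var M i \<otimes>\<^bsub>?P\<^esub> \<one>\<^bsub>?P\<^esub>" using i by (simp add: mpoly_var_closed)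
    also have "\<dots> = mpoly_shift M i \<one>\<^bsub>?P\<^esub>" by (rule mpoly_var_mult) simp
    finally show ?thesis
      using h_shift[OF P.one_closed i] xi by (simp add: mpoly_one h_const)
  qed
  show ?thesis
  proof (rule that[of h])
    show "h \<in> ring_hom ?P S"
      by (rule ring_hom_memI) (auto simp: h_closed h_mult h_add mpoly_one h_const)
    fix p J assume p: "p \<in> carrier ?P" and "ideal J S" and J: "\<And>m. \<phi> (p m) \<in> J"
    interpret J: ideal J S by fact
    show "h p \<in> J"
      unfolding h_def using J mon by (intro S.finsum_mem) (auto intro: J.I_r_closed J.a_Hcarr)
  qed (use h_const h_var in auto)
qed

text \<open>A homomorphism of coefficients acts on each coefficient of a polynomial.\<close>
lemma mpoly_map_ring_hom:
  assumes "algebra K A" "algebra K' B" and e: "e \<in> ring_hom A B"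
  shows "(\<lambda>p. e \<circ> p) \<in> ring_hom (mpoly_algebra A n) (mpoly_algebra B n)"
proof -
  interpret A: algebra K A by fact
  interpret B: algebra K' B by fact
  interpret e: ring_hom_cring A B e
    by (intro ring_hom_cring.intro ring_hom_cring_axioms.intro e A.M_cring B.M_cring)
  show ?thesis
  proof (rule ring_hom_memI)
    fix p assume p: "p \<in> carrier (mpoly_algebra A n)"
    have "{m. (e \<circ> p) m \<noteq> \<zero>\<^bsub>B\<^esub>} \<subseteq> {m. p m \<noteq> \<zero>\<^bsub>A\<^esub>}" by auto
    with p show "e \<circ> p \<in> carrier (mpoly_algebra B n)"
      by (auto simp: A.mpoly_carrier_iff B.mpoly_carrier_iff intro: finite_subset)
    fix q assume q: "q \<in> carrier (mpoly_algebra A n)"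
    show "e \<circ> (p \<oplus>\<^bsub>mpoly_algebra A n\<^esub> q) = (e \<circ> p) \<oplus>\<^bsub>mpoly_algebra B n\<^esub> (e \<circ> q)"
      using p q by (auto simp: A.mpoly_add B.mpoly_add A.mpoly_coeff_closed)
    show "e \<circ> (p \<otimes>\<^bsub>mpoly_algebra A n\<^esub> q) = (e \<circ> p) \<otimes>\<^bsub>mpoly_algebra B n\<^esub> (e \<circ> q)"
      using p q unfolding A.mpoly_mult B.mpoly_mult mpoly_conv_def
      by (auto simp: A.mpoly_coeff_closed Pi_def comp_def intro!: ext B.M.finsum_cong')
  next
    show "e \<circ> \<one>\<^bsub>mpoly_algebra A n\<^esub> = \<one>\<^bsub>mpoly_algebra B n\<^esub>"
      by (auto simp: A.mpoly_one B.mpoly_one mpoly_const_def)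
  qed
qed

section \<open>Derivations\<close>

text \<open>
  Additive maps with the Leibniz rule, considered on the carrier only.  They need not be linear
  over a field of scalars.
\<close>
definition derivation :: "('a, 'm) ring_scheme \<Rightarrow> ('a \<Rightarrow> 'a) \<Rightarrow> bool"
  where "derivation S D \<longleftrightarrow> D \<in> carrier S \<rightarrow> carrier S \<and>
    (\<forall>a\<in>carrier S. \<forall>b\<in>carrier S. D (a \<oplus>\<^bsub>S\<^esub> b) = D a \<oplus>\<^bsub>S\<^esub> D b \<and>
      D (a \<otimes>\<^bsub>S\<^esub> b) = D a \<otimes>\<^bsub>S\<^esub> b \<oplus>\<^bsub>S\<^esub> a \<otimes>\<^bsub>S\<^esub> D b)"

lemma derivation_closed: "derivation S D \<Longrightarrow> a \<in> carrier S \<Longrightarrow> D a \<in> carrier S"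
  by (auto simp: derivation_def)

lemma derivation_add:
  "derivation S D \<Longrightarrow> a \<in> carrier S \<Longrightarrow> b \<in> carrier S \<Longrightarrow> D (a \<oplus>\<^bsub>S\<^esub> b) = D a \<oplus>\<^bsub>S\<^esub> D b"
  by (auto simp: derivation_def)

lemma derivation_mult:
  "derivation S D \<Longrightarrow> a \<in> carrier S \<Longrightarrow> b \<in> carrier S \<Longrightarrow>
    D (a \<otimes>\<^bsub>S\<^esub> b) = D a \<otimes>\<^bsub>S\<^esub> b \<oplus>\<^bsub>S\<^esub> a \<otimes>\<^bsub>S\<^esub> D b"
  by (auto simp: derivation_def)

lemma (in abelian_group) additive_zero:
  assumes "D \<in> carrier G \<rightarrow> carrier G"
    "\<And>a b. a \<in> carrier G \<Longrightarrow> b \<in> carrier G \<Longrightarrow> D (a \<oplus> b) = D a \<oplus> D b"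
  shows "D \<zero> = \<zero>"
proof -
  have "D \<zero> \<in> carrier G" using assms(1) by blast
  moreover have "D \<zero> \<oplus> D \<zero> = D \<zero>" using assms(2)[of \<zero> \<zero>] by simp
  ultimately show ?thesis by (metis add.r_cancel_one')
qed

lemma (in cring) derivation_zero: "derivation R D \<Longrightarrow> D \<zero> = \<zero>"
  by (rule additive_zero) (auto simp: derivation_def)

lemma (in cring) derivation_one:
  assumes "derivation R D" shows "D \<one> = \<zero>"
proof -
  have "D \<one> \<in> carrier R" using assms by (auto intro: derivation_closed)
  moreover have "D \<one> = D \<one> \<oplus> D \<one>"
    using derivation_mult[OF assms one_closed one_closed] calculation by simp
  ultimately show ?thesis by (metis add.r_cancel_one')
qed

lemma (in cring) derivation_neg:
  assumes D: "derivation R D" and a: "a \<in> carrier R" shows "D (\<ominus> a) = \<ominus> D a"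
proof -
  have "D (\<ominus> a) \<oplus> D a = \<zero>"
    using derivation_add[OF D, of "\<ominus> a" a] a derivation_zero[OF D] by (simp add: l_neg)
  thus ?thesis using a derivation_closed[OF D]
    by (metis a_inv_closed minus_equality)
qed

lemma (in cring) derivation_minus:
  "derivation R D \<Longrightarrow> a \<in> carrier R \<Longrightarrow> b \<in> carrier R \<Longrightarrow> D (a \<ominus> b) = D a \<ominus> D b"
  by (simp add: minus_eq derivation_add derivation_neg)

lemma (in cring) derivation_finsum:
  assumes D: "derivation R D" and f: "f \<in> I \<rightarrow> carrier R"
  shows "D (\<Oplus>i\<in>I. f i) = (\<Oplus>i\<in>I. D (f i))"
proof (cases "finite I")
  case True
  thus ?thesis using f
    by (induction I) (auto simp: derivation_zero[OF D] derivation_add[OF D] derivation_closed[OF D] Pi_def)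
next
  case False
  thus ?thesis by (simp add: finsum_infinite derivation_zero[OF D])
qed

lemma (in algebra) mult_smult:
  assumes "c \<in> carrier R" "a \<in> carrier M" "b \<in> carrier M"
  shows "a \<otimes>\<^bsub>M\<^esub> (c \<odot>\<^bsub>M\<^esub> b) = c \<odot>\<^bsub>M\<^esub> (a \<otimes>\<^bsub>M\<^esub> b)"
  using assms smult_assoc2[of c b a] by (simp add: m_comm)

lemma (in algebra) derivation_linear_combination:
  assumes D: "\<And>i. i \<in> I \<Longrightarrow> derivation M (D i)" and c: "c \<in> I \<rightarrow> carrier R"
  shows "derivation M (\<lambda>a. \<Oplus>\<^bsub>M\<^esub>i\<in>I. c i \<odot>\<^bsub>M\<^esub> D i a)"
proof (cases "finite I")
  case False
  thus ?thesis by (simp add: M.finsum_infinite derivation_def)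
next
  case fin: True
  have cl: "c i \<in> carrier R" "a \<in> carrier M \<Longrightarrow> D i a \<in> carrier M" if "i \<in> I" for i a
    using c D[OF that] that by (auto simp: derivation_closed)
  show ?thesis unfolding derivation_def
  proof (intro conjI ballI)
    fix a b assume ab: "a \<in> carrier M" "b \<in> carrier M"
    have "(\<Oplus>\<^bsub>M\<^esub>i\<in>I. c i \<odot>\<^bsub>M\<^esub> D i (a \<oplus>\<^bsub>M\<^esub> b))
        = (\<Oplus>\<^bsub>M\<^esub>i\<in>I. c i \<odot>\<^bsub>M\<^esub> D i a \<oplus>\<^bsub>M\<^esub> c i \<odot>\<^bsub>M\<^esub> D i b)"
      using ab cl by (intro M.finsum_cong') (auto simp: derivation_add[OF D] smult_r_distr)
    thus "(\<Oplus>\<^bsub>M\<^esub>i\<in>I. c i \<odot>\<^bsub>M\<^esub> D i (a \<oplus>\<^bsub>M\<^esub> b))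
        = (\<Oplus>\<^bsub>M\<^esub>i\<in>I. c i \<odot>\<^bsub>M\<^esub> D i a) \<oplus>\<^bsub>M\<^esub> (\<Oplus>\<^bsub>M\<^esub>i\<in>I. c i \<odot>\<^bsub>M\<^esub> D i b)"
      using ab cl by (simp add: M.finsum_addf Pi_def)
    have "(\<Oplus>\<^bsub>M\<^esub>i\<in>I. c i \<odot>\<^bsub>M\<^esub> D i (a \<otimes>\<^bsub>M\<^esub> b))
        = (\<Oplus>\<^bsub>M\<^esub>i\<in>I. c i \<odot>\<^bsub>M\<^esub> D i a \<otimes>\<^bsub>M\<^esub> b \<oplus>\<^bsub>M\<^esub> a \<otimes>\<^bsub>M\<^esub> (c i \<odot>\<^bsub>M\<^esub> D i b))"
      using ab cl by (intro M.finsum_cong')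
        (auto simp: derivation_mult[OF D] smult_r_distr smult_assoc2 mult_smult)
    also have "\<dots> = (\<Oplus>\<^bsub>M\<^esub>i\<in>I. c i \<odot>\<^bsub>M\<^esub> D i a) \<otimes>\<^bsub>M\<^esub> b \<oplus>\<^bsub>M\<^esub> a \<otimes>\<^bsub>M\<^esub> (\<Oplus>\<^bsub>M\<^esub>i\<in>I. c i \<odot>\<^bsub>M\<^esub> D i b)"
      using ab cl fin by (simp add: finsum_ldistr finsum_rdistr M.finsum_addf Pi_def)
    finally show "(\<Oplus>\<^bsub>M\<^esub>i\<in>I. c i \<odot>\<^bsub>M\<^esub> D i (a \<otimes>\<^bsub>M\<^esub> b))
        = (\<Oplus>\<^bsub>M\<^esub>i\<in>I. c i \<odot>\<^bsub>M\<^esub> D i a) \<otimes>\<^bsub>M\<^esub> b \<oplus>\<^bsub>M\<^esub> a \<otimes>\<^bsub>M\<^esub> (\<Oplus>\<^bsub>M\<^esub>i\<in>I. c i \<odot>\<^bsub>M\<^esub> D i b)" .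
  qed (use cl in auto)
qed

text \<open>To intertwine two derivations, a homomorphism only has to do so on the generators.\<close>
lemma (in algebra) mpoly_derivation_intertwine:
  assumes "cring S" and h: "h \<in> ring_hom (mpoly_algebra M n) S"
    and \<Delta>: "derivation (mpoly_algebra M n) \<Delta>" and \<delta>: "derivation S \<delta>"
    and const: "\<And>k. k \<in> carrier M \<Longrightarrow> \<delta> (h (mpoly_const M k)) = h (\<Delta> (mpoly_const M k))"
    and var: "\<And>i. i \<in> {1..n} \<Longrightarrow> \<delta> (h (mpoly_var M i)) = h (\<Delta> (mpoly_var M i))"
    and p: "p \<in> carrier (mpoly_algebra M n)"
  shows "\<delta> (h p) = h (\<Delta> p)"
proof -
  interpret S: cring S by fact
  interpret P: cring "mpoly_algebra M n" by (rule mpoly_cring)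
  show ?thesis
    using p
    by (induction rule: mpoly_induct)
      (simp_all add: const var mpoly_var_closed ring_hom_add[OF h] ring_hom_mult[OF h]
        ring_hom_closed[OF h] derivation_add[OF \<delta>] derivation_mult[OF \<delta>] derivation_add[OF \<Delta>]
        derivation_mult[OF \<Delta>] derivation_closed[OF \<Delta>])
qed

context algebra
begin

lemma mpoly_deriv_const: "mpoly_deriv M i (mpoly_const M k) = \<zero>\<^bsub>mpoly_algebra M n\<^esub>"
  by (simp add: mpoly_deriv_def mpoly_const_def mpoly_zero)

lemma mpoly_deriv_add:
  assumes "p \<in> carrier (mpoly_algebra M n)" "q \<in> carrier (mpoly_algebra M n)"
  shows "mpoly_deriv M i (p \<oplus>\<^bsub>mpoly_algebra M n\<^esub> q)
    = mpoly_deriv M i p \<oplus>\<^bsub>mpoly_algebra M n\<^esub> mpoly_deriv M i q"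
  using assms unfolding mpoly_deriv_def mpoly_add
  by (simp add: M.add.nat_pow_distrib mpoly_coeff_closed del: M.add.nat_pow_Suc)

lemma mpoly_deriv_closed:
  assumes p: "p \<in> carrier (mpoly_algebra M n)"
  shows "mpoly_deriv M i p \<in> carrier (mpoly_algebra M n)"
proof -
  have nz: "p (add_mset i m) \<noteq> \<zero>\<^bsub>M\<^esub>" if "mpoly_deriv M i p m \<noteq> \<zero>\<^bsub>M\<^esub>" for m
    using that by (auto simp: mpoly_deriv_def)
  have "{m. mpoly_deriv M i p m \<noteq> \<zero>\<^bsub>M\<^esub>} \<subseteq> (\<lambda>m. m - {#i#}) ` {m. p m \<noteq> \<zero>\<^bsub>M\<^esub>}"
  proof
    fix m assume "m \<in> {m. mpoly_deriv M i p m \<noteq> \<zero>\<^bsub>M\<^esub>}"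
    thus "m \<in> (\<lambda>m. m - {#i#}) ` {m. p m \<noteq> \<zero>\<^bsub>M\<^esub>}"
      using nz by (intro image_eqI[of _ _ "add_mset i m"]) auto
  qed
  moreover have "set_mset m \<subseteq> {1..n}" if "mpoly_deriv M i p m \<noteq> \<zero>\<^bsub>M\<^esub>" for m
    using nz[OF that] p by (fastforce simp: mpoly_carrier_iff)
  moreover have "mpoly_deriv M i p m \<in> carrier M" for m
    using p by (simp add: mpoly_deriv_def mpoly_coeff_closed)
  ultimately show ?thesis using p by (auto simp: mpoly_carrier_iff intro: finite_subset)
qed

lemma mpoly_deriv_scale:
  assumes "k \<in> carrier M" "p \<in> carrier (mpoly_algebra M n)"
  shows "mpoly_deriv M i (\<lambda>m. k \<otimes>\<^bsub>M\<^esub> p m) = (\<lambda>m. k \<otimes>\<^bsub>M\<^esub> mpoly_deriv M i p m)"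
  using assms unfolding mpoly_deriv_def
  by (simp add: add_pow_rdistr mpoly_coeff_closed del: M.add.nat_pow_Suc)

lemma mpoly_deriv_shift:
  assumes "p \<in> carrier (mpoly_algebra M n)"
  shows "mpoly_deriv M j (mpoly_shift M i p)
    = (\<lambda>m. (if i = j then p m else \<zero>\<^bsub>M\<^esub>) \<oplus>\<^bsub>M\<^esub> mpoly_shift M i (mpoly_deriv M j p) m)"
proof
  fix m
  show "mpoly_deriv M j (mpoly_shift M i p) m
    = (if i = j then p m else \<zero>\<^bsub>M\<^esub>) \<oplus>\<^bsub>M\<^esub> mpoly_shift M i (mpoly_deriv M j p) m"
  proof (cases "i = j")
    case ij: True
    show ?thesis
    proof (cases "j \<in># m")
      case True
      then obtain m' where "m = add_mset j m'" by (blast dest: multi_member_split)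
      thus ?thesis using ij assms
        by (simp add: mpoly_deriv_def mpoly_shift_def mpoly_coeff_closed M.a_ac)
    next
      case False
      hence "count m j = 0" by (simp add: not_in_iff)
      thus ?thesis using ij assms False
        by (simp add: mpoly_deriv_def mpoly_shift_def mpoly_coeff_closed)
    qed
  next
    case False
    show ?thesis using False assms
      by (auto simp: mpoly_deriv_def mpoly_shift_def mpoly_coeff_closed add_mset_diff_bothsides
          simp del: M.add.nat_pow_Suc)
  qed
qed

lemma mpoly_deriv_var:
  assumes "i \<in> {1..n}"
  shows "mpoly_deriv M j (mpoly_var M i)
    = (if i = j then \<one>\<^bsub>mpoly_algebra M n\<^esub> else \<zero>\<^bsub>mpoly_algebra M n\<^esub>)"
  by (auto simp: mpoly_deriv_def mpoly_var_def mpoly_one mpoly_zero mpoly_const_def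
      add_eq_conv_ex intro!: ext)

lemma mpoly_deriv_smult:
  assumes "c \<in> carrier R" "p \<in> carrier (mpoly_algebra M n)"
  shows "mpoly_deriv M i (c \<odot>\<^bsub>mpoly_algebra M n\<^esub> p) = c \<odot>\<^bsub>mpoly_algebra M n\<^esub> mpoly_deriv M i p"
proof -
  have "add_pow M k (c \<odot>\<^bsub>M\<^esub> a) = c \<odot>\<^bsub>M\<^esub> add_pow M k a" if "a \<in> carrier M" for k :: nat and a
    using that assms(1) by (induction k) (auto simp: smult_r_distr)
  thus ?thesis using assms unfolding mpoly_deriv_def mpoly_smult
    by (simp add: mpoly_coeff_closed del: M.add.nat_pow_Suc)
qed

lemma mpoly_derivation: "derivation (mpoly_algebra M n) (mpoly_deriv M j)"
proof -
  let ?P = "mpoly_algebra M n" and ?D = "mpoly_deriv M j"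
  interpret P: cring ?P by (rule mpoly_cring)
  have sh: "?D (mpoly_var M i \<otimes>\<^bsub>?P\<^esub> p)
      = (if i = j then p else \<zero>\<^bsub>?P\<^esub>) \<oplus>\<^bsub>?P\<^esub> mpoly_var M i \<otimes>\<^bsub>?P\<^esub> ?D p" if "p \<in> carrier ?P" for i p
    using that by (simp add: mpoly_var_mult mpoly_deriv_closed mpoly_deriv_shift mpoly_add mpoly_zero)
  have "?D (p \<otimes>\<^bsub>?P\<^esub> q) = ?D p \<otimes>\<^bsub>?P\<^esub> q \<oplus>\<^bsub>?P\<^esub> p \<otimes>\<^bsub>?P\<^esub> ?D q"
    if p: "p \<in> carrier ?P" and q: "q \<in> carrier ?P" for p q
    using p
  proof (induction rule: mpoly_induct)
    case (const k)
    have "?D (mpoly_const M k \<otimes>\<^bsub>?P\<^esub> q) = mpoly_const M k \<otimes>\<^bsub>?P\<^esub> ?D q"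
      using const q mpoly_deriv_scale[of k q n] by (simp add: mpoly_const_mult mpoly_deriv_closed)
    thus ?case
      using const q by (simp add: mpoly_deriv_const[where n = n] mpoly_const_closed mpoly_deriv_closed)
  next
    case (add p p')
    have "a \<oplus>\<^bsub>?P\<^esub> b \<oplus>\<^bsub>?P\<^esub> (c \<oplus>\<^bsub>?P\<^esub> d) = a \<oplus>\<^bsub>?P\<^esub> c \<oplus>\<^bsub>?P\<^esub> (b \<oplus>\<^bsub>?P\<^esub> d)"
      if "a \<in> carrier ?P" "b \<in> carrier ?P" "c \<in> carrier ?P" "d \<in> carrier ?P" for a b c d
      using that by (simp add: P.a_ac)
    thus ?case using add q by (simp add: P.l_distr mpoly_deriv_add mpoly_deriv_closed)
  next
    case (var p i)
    let ?z = "mpoly_var M i" and ?d = "if i = j then p else \<zero>\<^bsub>?P\<^esub>"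
    have z: "?z \<in> carrier ?P" and d: "?d \<in> carrier ?P" and Dp: "?D p \<in> carrier ?P" "?D q \<in> carrier ?P"
      using var q by (auto simp: mpoly_var_closed mpoly_deriv_closed)
    have "?D (?z \<otimes>\<^bsub>?P\<^esub> p \<otimes>\<^bsub>?P\<^esub> q) = ?D (?z \<otimes>\<^bsub>?P\<^esub> (p \<otimes>\<^bsub>?P\<^esub> q))"
      using z var q by (simp add: P.m_assoc)
    also have "\<dots> = ?d \<otimes>\<^bsub>?P\<^esub> q \<oplus>\<^bsub>?P\<^esub> ?z \<otimes>\<^bsub>?P\<^esub> (?D p \<otimes>\<^bsub>?P\<^esub> q \<oplus>\<^bsub>?P\<^esub> p \<otimes>\<^bsub>?P\<^esub> ?D q)"
      using var q by (simp add: sh)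
    also have "\<dots> = (?d \<oplus>\<^bsub>?P\<^esub> ?z \<otimes>\<^bsub>?P\<^esub> ?D p) \<otimes>\<^bsub>?P\<^esub> q \<oplus>\<^bsub>?P\<^esub> ?z \<otimes>\<^bsub>?P\<^esub> p \<otimes>\<^bsub>?P\<^esub> ?D q"
      using z d Dp var(1) q by algebra
    finally show ?case using var by (simp add: sh)
  qed
  thus ?thesis using mpoly_deriv_closed mpoly_deriv_add by (auto simp: derivation_def)
qed

lemma mpoly_deriv_commute:
  assumes "p \<in> carrier (mpoly_algebra M n)"
  shows "mpoly_deriv M i (mpoly_deriv M j p) = mpoly_deriv M j (mpoly_deriv M i p)"
  using assms unfolding mpoly_deriv_def
  by (cases "i = j")
    (simp_all add: M.add.nat_pow_pow mpoly_coeff_closed add_mset_commute mult.commute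
      del: M.add.nat_pow_Suc)

end

section \<open>Images of sets of operators\<close>

context abelian_group
begin

lemma ops_image_zero: "\<zero> \<in> ops_image G C"
  unfolding ops_image_def
  by (rule CollectI, rule exI[of _ "{}"], rule exI[of _ "\<lambda>\<Phi>. \<zero>"]) simp

lemma ops_image_value:
  assumes "\<Phi> \<in> C" "u \<in> carrier G" "\<Phi> u \<in> carrier G"
  shows "\<Phi> u \<in> ops_image G C"
  unfolding ops_image_def using assms
  by (intro CollectI exI[of _ "{\<Phi>}"] exI[of _ "\<lambda>\<Phi>. u"]) simp

lemma ops_image_subset:
  assumes C: "\<And>\<Phi> u. \<Phi> \<in> C \<Longrightarrow> u \<in> carrier G \<Longrightarrow> \<Phi> u \<in> T"
    and T: "T \<subseteq> carrier G" "\<zero> \<in> T" "\<And>a b. a \<in> T \<Longrightarrow> b \<in> T \<Longrightarrow> a \<oplus> b \<in> T"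
  shows "ops_image G C \<subseteq> T"
proof
  fix x assume "x \<in> ops_image G C"
  then obtain F u where F: "F \<subseteq> C" "u \<in> F \<rightarrow> carrier G" and x: "x = (\<Oplus>\<Phi>\<in>F. \<Phi> (u \<Phi>))"
    by (auto simp: ops_image_def)
  have v: "\<Phi> (u \<Phi>) \<in> T" if "\<Phi> \<in> F" for \<Phi> using F that by (intro C) auto
  show "x \<in> T" unfolding x by (rule finsum_mem[OF T(1,2)]) (simp_all add: T(3) v)
qed

lemma ops_image_add:
  assumes C: "\<And>\<Phi> u. \<Phi> \<in> C \<Longrightarrow> u \<in> carrier G \<Longrightarrow> \<Phi> u \<in> carrier G"
    and add: "\<And>\<Phi> u v. \<Phi> \<in> C \<Longrightarrow> u \<in> carrier G \<Longrightarrow> v \<in> carrier G \<Longrightarrow> \<Phi> (u \<oplus> v) = \<Phi> u \<oplus> \<Phi> v"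
    and a: "a \<in> ops_image G C" and b: "b \<in> ops_image G C"
  shows "a \<oplus> b \<in> ops_image G C"
proof -
  obtain F u where F: "finite F" "F \<subseteq> C" "u \<in> F \<rightarrow> carrier G" "a = (\<Oplus>\<Phi>\<in>F. \<Phi> (u \<Phi>))"
    using a by (auto simp: ops_image_def)
  obtain F' u' where F': "finite F'" "F' \<subseteq> C" "u' \<in> F' \<rightarrow> carrier G" "b = (\<Oplus>\<Phi>\<in>F'. \<Phi> (u' \<Phi>))"
    using b by (auto simp: ops_image_def)
  define v where "v \<Phi> = (if \<Phi> \<in> F then u \<Phi> else \<zero>)" for \<Phi>
  define v' where "v' \<Phi> = (if \<Phi> \<in> F' then u' \<Phi> else \<zero>)" for \<Phi>
  have v: "v \<Phi> \<in> carrier G" "v' \<Phi> \<in> carrier G" for \<Phi>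
    using F(3) F'(3) by (auto simp: v_def v'_def)
  have z: "\<Phi> \<zero> = \<zero>" if "\<Phi> \<in> C" for \<Phi>
    using C add that by (intro additive_zero) auto
  have "a = (\<Oplus>\<Phi>\<in>F \<union> F'. \<Phi> (v \<Phi>))"
    unfolding F(4)
    by (rule add.finprod_mono_neutral_cong_left) (use F F' v C z in \<open>auto simp: v_def Pi_iff\<close>)
  moreover have "b = (\<Oplus>\<Phi>\<in>F \<union> F'. \<Phi> (v' \<Phi>))"
    unfolding F'(4)
    by (rule add.finprod_mono_neutral_cong_left) (use F F' v C z in \<open>auto simp: v'_def Pi_iff\<close>)
  ultimately have "a \<oplus> b = (\<Oplus>\<Phi>\<in>F \<union> F'. \<Phi> (v \<Phi>) \<oplus> \<Phi> (v' \<Phi>))"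
    using F F' v C by (subst finsum_addf) (auto simp: Pi_iff subset_iff)
  also have "\<dots> = (\<Oplus>\<Phi>\<in>F \<union> F'. \<Phi> (v \<Phi> \<oplus> v' \<Phi>))"
    using F F' v C add by (intro finsum_cong') (auto simp: Pi_iff subset_iff)
  finally show ?thesis
    unfolding ops_image_def using F F' v
    by (intro CollectI exI[of _ "F \<union> F'"] exI[of _ "\<lambda>\<Phi>. v \<Phi> \<oplus> v' \<Phi>"]) auto
qed

end

text \<open>Without operators the image is zero, so that the hypothesis on \<open>f\<close> forces \<open>f = 0\<close>.\<close>
lemma (in ring) image_conjecture_holds_empty: "image_conjecture_holds R {}"
  unfolding image_conjecture_holds_def
proof (intro ballI impI)
  fix f g
  assume fg: "f \<in> carrier R" "g \<in> carrier R" and "\<forall>m::nat. 1 \<le> m \<longrightarrow> f [^] m \<in> ops_image R {}"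
  hence "f [^] (1::nat) \<in> ops_image R {}" by blast
  hence "f = \<zero>" using fg by (auto simp: ops_image_def)
  hence "f [^] m \<otimes> g \<in> ops_image R {}" if "1 \<le> m" for m :: nat
    using fg that ops_image_zero by (simp add: nat_pow_zero)
  thus "\<exists>N::nat. \<forall>m\<ge>N. f [^] m \<otimes> g \<in> ops_image R {}" by blast
qed

text \<open>
  The image conjecture passes from the target to the source of a homomorphism for which the
  image on the source is the preimage of the image on the target.
\<close>
lemma image_conjecture_holds_pullback:
  assumes "ring P" "ring Q" and h: "h \<in> ring_hom P Q"
    and iff: "\<And>p. p \<in> carrier P \<Longrightarrow> p \<in> ops_image P C \<longleftrightarrow> h p \<in> ops_image Q C'"
    and Q: "image_conjecture_holds Q C'"
  shows "image_conjecture_holds P C"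
  unfolding image_conjecture_holds_def
proof (intro ballI impI)
  interpret h: ring_hom_ring P Q h
    using assms by (intro ring_hom_ringI2)
  fix f g
  assume fg: "f \<in> carrier P" "g \<in> carrier P"
    and f: "\<forall>m::nat. 1 \<le> m \<longrightarrow> f [^]\<^bsub>P\<^esub> m \<in> ops_image P C"
  have "\<forall>m::nat. 1 \<le> m \<longrightarrow> h f [^]\<^bsub>Q\<^esub> m \<in> ops_image Q C'"
    using f fg by (simp add: iff h.hom_nat_pow)
  then obtain N where "\<forall>m\<ge>N. h f [^]\<^bsub>Q\<^esub> (m::nat) \<otimes>\<^bsub>Q\<^esub> h g \<in> ops_image Q C'"
    using Q fg unfolding image_conjecture_holds_def by (meson h.hom_closed)
  hence "\<forall>m\<ge>N. f [^]\<^bsub>P\<^esub> m \<otimes>\<^bsub>P\<^esub> g \<in> ops_image P C"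
    using fg by (simp add: iff h.hom_nat_pow)
  thus "\<exists>N::nat. \<forall>m\<ge>N. f [^]\<^bsub>P\<^esub> m \<otimes>\<^bsub>P\<^esub> g \<in> ops_image P C" by blast
qed

section \<open>Quotient algebras on a prescribed type\<close>

text \<open>
  The algebra structure carried over to the range of a map \<open>e\<close>; it is meant for maps whose fibres
  are the cosets of an ideal, so that it is a model of the quotient by that ideal.
\<close>
definition image_algebra ::
    "('a \<Rightarrow> 'b) \<Rightarrow> ('k, 'a, 'm) module_scheme \<Rightarrow> ('k, 'b) module"
  where "image_algebra e A =
    \<lparr> carrier = e ` carrier A,
      monoid.mult = (\<lambda>x y. e (inv_into (carrier A) e x \<otimes>\<^bsub>A\<^esub> inv_into (carrier A) e y)),
      monoid.one = e \<one>\<^bsub>A\<^esub>,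
      ring.zero = e \<zero>\<^bsub>A\<^esub>,
      ring.add = (\<lambda>x y. e (inv_into (carrier A) e x \<oplus>\<^bsub>A\<^esub> inv_into (carrier A) e y)),
      module.smult = (\<lambda>c x. e (c \<odot>\<^bsub>A\<^esub> inv_into (carrier A) e x)) \<rparr>"

text \<open>A map \<open>e\<close> whose fibres are the cosets of the ideal \<open>J\<close>.\<close>
locale algebra_quotient = algebra + ideal J M for J +
  fixes e :: "'c \<Rightarrow> 'e"
  assumes fibres: "a \<in> carrier M \<Longrightarrow> b \<in> carrier M \<Longrightarrow> e a = e b \<longleftrightarrow> a \<ominus>\<^bsub>M\<^esub> b \<in> J"
begin

lemma representative:
  assumes "a \<in> carrier M"
  obtains j where "inv_into (carrier M) e (e a) = a \<oplus>\<^bsub>M\<^esub> j" "j \<in> J" "j \<in> carrier M"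
proof -
  let ?s = "inv_into (carrier M) e (e a)"
  have s: "?s \<in> carrier M" "e ?s = e a"
    using assms by (auto simp: f_inv_into_f inv_into_into)
  hence j: "?s \<ominus>\<^bsub>M\<^esub> a \<in> J" using assms fibres by blast
  moreover have "?s = a \<oplus>\<^bsub>M\<^esub> (?s \<ominus>\<^bsub>M\<^esub> a)" using s assms by algebra
  ultimately show ?thesis using that s assms by (metis M.minus_closed)
qed

lemma e_eqI: "a \<in> carrier M \<Longrightarrow> b = a \<oplus>\<^bsub>M\<^esub> j \<Longrightarrow> j \<in> J \<Longrightarrow> e b = e a"
proof -
  assume a: "a \<in> carrier M" and b: "b = a \<oplus>\<^bsub>M\<^esub> j" and j: "j \<in> J"
  have jc: "j \<in> carrier M" using j by (rule a_Hcarr)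
  hence "b \<ominus>\<^bsub>M\<^esub> a = j" using a unfolding b by algebra
  thus "e b = e a" using a b j jc fibres by simp
qed

lemma image_add:
  assumes a: "a \<in> carrier M" and b: "b \<in> carrier M"
  shows "e a \<oplus>\<^bsub>image_algebra e M\<^esub> e b = e (a \<oplus>\<^bsub>M\<^esub> b)"
proof -
  obtain i where i: "inv_into (carrier M) e (e a) = a \<oplus>\<^bsub>M\<^esub> i" "i \<in> J" "i \<in> carrier M"
    using representative[OF a] .
  obtain j where j: "inv_into (carrier M) e (e b) = b \<oplus>\<^bsub>M\<^esub> j" "j \<in> J" "j \<in> carrier M"
    using representative[OF b] .
  have "a \<oplus>\<^bsub>M\<^esub> i \<oplus>\<^bsub>M\<^esub> (b \<oplus>\<^bsub>M\<^esub> j) = a \<oplus>\<^bsub>M\<^esub> b \<oplus>\<^bsub>M\<^esub> (i \<oplus>\<^bsub>M\<^esub> j)"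
    using a b i(3) j(3) by algebra
  moreover have "i \<oplus>\<^bsub>M\<^esub> j \<in> J" using i j by simp
  ultimately show ?thesis using a b i j by (auto simp: image_algebra_def intro: e_eqI)
qed

lemma image_mult:
  assumes a: "a \<in> carrier M" and b: "b \<in> carrier M"
  shows "e a \<otimes>\<^bsub>image_algebra e M\<^esub> e b = e (a \<otimes>\<^bsub>M\<^esub> b)"
proof -
  obtain i where i: "inv_into (carrier M) e (e a) = a \<oplus>\<^bsub>M\<^esub> i" "i \<in> J" "i \<in> carrier M"
    using representative[OF a] .
  obtain j where j: "inv_into (carrier M) e (e b) = b \<oplus>\<^bsub>M\<^esub> j" "j \<in> J" "j \<in> carrier M"
    using representative[OF b] .
  have "(a \<oplus>\<^bsub>M\<^esub> i) \<otimes>\<^bsub>M\<^esub> (b \<oplus>\<^bsub>M\<^esub> j) = a \<otimes>\<^bsub>M\<^esub> b \<oplus>\<^bsub>M\<^esub> (a \<otimes>\<^bsub>M\<^esub> j \<oplus>\<^bsub>M\<^esub> i \<otimes>\<^bsub>M\<^esub> (b \<oplus>\<^bsub>M\<^esub> j))"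
    using a b i(3) j(3) by algebra
  moreover have "a \<otimes>\<^bsub>M\<^esub> j \<oplus>\<^bsub>M\<^esub> i \<otimes>\<^bsub>M\<^esub> (b \<oplus>\<^bsub>M\<^esub> j) \<in> J"
    using a b i j by (intro a_closed I_l_closed I_r_closed) auto
  ultimately show ?thesis using a b i j by (auto simp: image_algebra_def intro: e_eqI)
qed

lemma image_smult:
  assumes c: "c \<in> carrier R" and a: "a \<in> carrier M"
  shows "c \<odot>\<^bsub>image_algebra e M\<^esub> e a = e (c \<odot>\<^bsub>M\<^esub> a)"
proof -
  obtain i where i: "inv_into (carrier M) e (e a) = a \<oplus>\<^bsub>M\<^esub> i" "i \<in> J" "i \<in> carrier M"
    using representative[OF a] .
  have "c \<odot>\<^bsub>M\<^esub> i = (c \<odot>\<^bsub>M\<^esub> \<one>\<^bsub>M\<^esub>) \<otimes>\<^bsub>M\<^esub> i" using c i by (simp add: smult_assoc2)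
  hence "c \<odot>\<^bsub>M\<^esub> i \<in> J" using c i by (auto intro: I_l_closed)
  thus ?thesis using a c i
    by (auto simp: image_algebra_def smult_r_distr intro: e_eqI)
qed

lemma image_carrier: "carrier (image_algebra e M) = e ` carrier M"
  and image_zero: "\<zero>\<^bsub>image_algebra e M\<^esub> = e \<zero>\<^bsub>M\<^esub>"
  and image_one: "\<one>\<^bsub>image_algebra e M\<^esub> = e \<one>\<^bsub>M\<^esub>"
  by (simp_all add: image_algebra_def)

theorem image_algebra: "algebra R (image_algebra e M)"
proof (rule algebraI)
  let ?D = "image_algebra e M"
  show "cring ?D"
  proof (rule cringI)
    show "abelian_group ?D"
    proof (rule abelian_groupI)
      fix x assume "x \<in> carrier ?D"
      then obtain a where a: "a \<in> carrier M" "x = e a" by (auto simp: image_carrier)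
      have "e (\<ominus>\<^bsub>M\<^esub> a) \<oplus>\<^bsub>?D\<^esub> x = \<zero>\<^bsub>?D\<^esub>" using a by (simp add: image_add image_zero M.l_neg)
      thus "\<exists>y\<in>carrier ?D. y \<oplus>\<^bsub>?D\<^esub> x = \<zero>\<^bsub>?D\<^esub>" using a by (auto simp: image_carrier)
    qed (auto simp: image_carrier image_add image_zero M.a_ac)
    show "Group.comm_monoid ?D"
      by (rule comm_monoidI) (auto simp: image_carrier image_mult image_one m_ac)
  qed (auto simp: image_carrier image_mult image_add l_distr)
qed (auto simp: R_cring image_carrier image_smult image_add image_mult smult_l_distr smult_r_distr
    smult_assoc1 smult_assoc2)

lemma image_ring_hom: "e \<in> ring_hom M (image_algebra e M)"
  by (rule ring_hom_memI) (auto simp: image_carrier image_mult image_add image_one)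

end

section \<open>Algebras over a field of characteristic zero\<close>

text \<open>
  Over such a field positive integers can be divided by in every algebra.
\<close>
locale char_zero_algebra = algebra +
  assumes field: "field R" and char_zero: "char_zero R"
begin

lemma mpoly_char_zero_algebra: "char_zero_algebra R (mpoly_algebra M n)"
  using mpoly_algebra field char_zero by (intro char_zero_algebra.intro char_zero_algebra_axioms.intro)

lemma add_pow_eq_smult:
  "a \<in> carrier M \<Longrightarrow> add_pow M (k::nat) a = add_pow R k \<one>\<^bsub>R\<^esub> \<odot>\<^bsub>M\<^esub> a"
  by (induction k) (simp_all add: smult_l_distr)

lemma add_pow_one_unit:
  assumes "0 < (k::nat)"
  shows "inv\<^bsub>R\<^esub> (add_pow R k \<one>\<^bsub>R\<^esub>) \<in> carrier R"
    and "inv\<^bsub>R\<^esub> (add_pow R k \<one>\<^bsub>R\<^esub>) \<otimes>\<^bsub>R\<^esub> add_pow R k \<one>\<^bsub>R\<^esub> = \<one>\<^bsub>R\<^esub>"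
    and "add_pow R k \<one>\<^bsub>R\<^esub> \<otimes>\<^bsub>R\<^esub> inv\<^bsub>R\<^esub> (add_pow R k \<one>\<^bsub>R\<^esub>) = \<one>\<^bsub>R\<^esub>"
proof -
  have "add_pow R k \<one>\<^bsub>R\<^esub> \<in> Units R"
    using assms char_zero by (simp add: char_zero_def field.field_Units[OF field])
  thus "inv\<^bsub>R\<^esub> (add_pow R k \<one>\<^bsub>R\<^esub>) \<in> carrier R"
    "inv\<^bsub>R\<^esub> (add_pow R k \<one>\<^bsub>R\<^esub>) \<otimes>\<^bsub>R\<^esub> add_pow R k \<one>\<^bsub>R\<^esub> = \<one>\<^bsub>R\<^esub>"
    "add_pow R k \<one>\<^bsub>R\<^esub> \<otimes>\<^bsub>R\<^esub> inv\<^bsub>R\<^esub> (add_pow R k \<one>\<^bsub>R\<^esub>) = \<one>\<^bsub>R\<^esub>"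
    by simp_all
qed

text \<open>The quotient of \<open>a\<close> by the positive integer \<open>k\<close>.\<close>
definition nat_quot :: "nat \<Rightarrow> 'c \<Rightarrow> 'c"
  where "nat_quot k a = inv\<^bsub>R\<^esub> (add_pow R k \<one>\<^bsub>R\<^esub>) \<odot>\<^bsub>M\<^esub> a"

lemma nat_quot_closed: "0 < k \<Longrightarrow> a \<in> carrier M \<Longrightarrow> nat_quot k a \<in> carrier M"
  by (simp add: nat_quot_def add_pow_one_unit)

lemma nat_quot_add_pow: "0 < k \<Longrightarrow> a \<in> carrier M \<Longrightarrow> nat_quot k (add_pow M k a) = a"
  by (simp add: nat_quot_def add_pow_eq_smult add_pow_one_unit flip: smult_assoc1)

lemma add_pow_nat_quot: "0 < k \<Longrightarrow> a \<in> carrier M \<Longrightarrow> add_pow M k (nat_quot k a) = a"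
  by (simp add: nat_quot_def add_pow_eq_smult add_pow_one_unit flip: smult_assoc1)

lemma add_pow_cancel:
  "0 < (k::nat) \<Longrightarrow> a \<in> carrier M \<Longrightarrow> b \<in> carrier M \<Longrightarrow> add_pow M k a = add_pow M k b \<Longrightarrow> a = b"
  by (drule arg_cong[where f = "nat_quot k"]) (simp add: nat_quot_add_pow)

text \<open>In characteristic zero only the constants have vanishing gradient.\<close>
lemma mpoly_constant:
  assumes p: "p \<in> carrier (mpoly_algebra M n)"
    and D: "\<And>i. i \<in> {1..n} \<Longrightarrow> mpoly_deriv M i p = \<zero>\<^bsub>mpoly_algebra M n\<^esub>"
  shows "p = mpoly_const M (p {#})"
proof
  fix m
  show "p m = mpoly_const M (p {#}) m"
  proof (cases "m = {#} \<or> \<not> set_mset m \<subseteq> {1..n}")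
    case True
    thus ?thesis using p by (auto simp: mpoly_const_def mpoly_carrier_iff)
  next
    case False
    then obtain i m' where m: "m = add_mset i m'" by (metis multiset_cases)
    with False have "i \<in> {1..n}" by auto
    hence "mpoly_deriv M i p m' = \<zero>\<^bsub>M\<^esub>" by (simp add: D mpoly_zero)
    hence "add_pow M (Suc (count m' i)) (p m) = add_pow M (Suc (count m' i)) \<zero>\<^bsub>M\<^esub>"
      by (simp add: mpoly_deriv_def m del: M.add.nat_pow_Suc)
    from add_pow_cancel[OF zero_less_Suc mpoly_coeff_closed[OF p] M.zero_closed this]
    have "p m = \<zero>\<^bsub>M\<^esub>" .
    with m show ?thesis by (simp add: mpoly_const_def)
  qed
qed

text \<open>
  The Poincare lemma: a closed family of polynomials is a gradient.  The equation
  \<open>\<partial>\<^sub>j G = H\<^sub>j\<close> determines the coefficient of \<open>G\<close> at every monomial that involves \<open>z\<^sub>j\<close>.  The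
  coefficient is defined by the least such \<open>j\<close>, and closedness makes the other choices agree.
\<close>
theorem mpoly_gradient_exists:
  assumes H: "\<And>i. i \<in> {1..n} \<Longrightarrow> H i \<in> carrier (mpoly_algebra M n)"
    and closed: "\<And>i j. i \<in> {1..n} \<Longrightarrow> j \<in> {1..n} \<Longrightarrow> mpoly_deriv M i (H j) = mpoly_deriv M j (H i)"
  obtains G where "G \<in> carrier (mpoly_algebra M n)"
    and "\<And>i. i \<in> {1..n} \<Longrightarrow> mpoly_deriv M i G = H i"
proof -
  define v where "v m = Min (set_mset m)" for m :: "nat multiset"
  define G where "G m = (if m \<noteq> {#} \<and> set_mset m \<subseteq> {1..n}
    then nat_quot (count m (v m)) (H (v m) (m - {#v m#})) else \<zero>\<^bsub>M\<^esub>)" for m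
  have v: "v m \<in># m" if "m \<noteq> {#}" for m
    unfolding v_def using that by (intro Min_in) auto
  have Hc: "H i m \<in> carrier M" if "i \<in> {1..n}" for i m
    using H[OF that] by (rule mpoly_coeff_closed)
  have Gc: "G m \<in> carrier M" for m
    using v[of m] Hc by (auto simp: G_def subset_iff intro!: nat_quot_closed)
  have supp: "m \<in> (\<Union>i\<in>{1..n}. add_mset i ` {m. H i m \<noteq> \<zero>\<^bsub>M\<^esub>})" if "G m \<noteq> \<zero>\<^bsub>M\<^esub>" for m
  proof -
    have m: "m \<noteq> {#}" "set_mset m \<subseteq> {1..n}" using that by (auto simp: G_def split: if_splits)
    have vm: "v m \<in># m" using v m by blast
    hence "v m \<in> {1..n}" using m by blast
    moreover have "H (v m) (m - {#v m#}) \<noteq> \<zero>\<^bsub>M\<^esub>"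
    proof
      assume "H (v m) (m - {#v m#}) = \<zero>\<^bsub>M\<^esub>"
      hence "G m = \<zero>\<^bsub>M\<^esub>" using vm by (auto simp: G_def nat_quot_def add_pow_one_unit)
      with that show False by blast
    qed
    ultimately show ?thesis
      using vm by (intro UN_I[of "v m"] image_eqI[of _ _ "m - {#v m#}"]) auto
  qed
  have G: "G \<in> carrier (mpoly_algebra M n)"
    unfolding mpoly_carrier_iff
  proof (intro conjI allI impI)
    have "finite (\<Union>i\<in>{1..n}. add_mset i ` {m. H i m \<noteq> \<zero>\<^bsub>M\<^esub>})"
      using H by (auto simp: mpoly_carrier_iff)
    thus "finite {m. G m \<noteq> \<zero>\<^bsub>M\<^esub>}" by (rule rev_finite_subset) (use supp in blast)
  qed (use Gc in \<open>auto simp: G_def split: if_splits\<close>)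
  have DG_eq: "mpoly_deriv M i G m = H i m" if i: "i \<in> {1..n}" for i m
  proof (cases "set_mset m \<subseteq> {1..n}")
    case False
    moreover from this have "H i m = \<zero>\<^bsub>M\<^esub>" using H[OF i] unfolding mpoly_carrier_iff by blast
    ultimately show ?thesis by (simp add: mpoly_deriv_def G_def)
  next
    case True
    define m' where "m' = add_mset i m"
    define j where "j = v m'"
    have m': "m' \<noteq> {#}" "set_mset m' \<subseteq> {1..n}" using True i by (auto simp: m'_def)
    have j: "j \<in># m'" "j \<in> {1..n}" using v[OF m'(1)] m'(2) by (auto simp: j_def)
    have Gj: "add_pow M (count m' j) (G m') = H j (m' - {#j#})"
      using m' j Hc by (simp add: G_def add_pow_nat_quot flip: j_def)
    have DG: "mpoly_deriv M i G m = add_pow M (count m' i) (G m')"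
      by (simp add: mpoly_deriv_def m'_def del: M.add.nat_pow_Suc)
    show ?thesis
    proof (cases "i = j")
      case True
      thus ?thesis using Gj DG by (simp add: m'_def)
    next
      case False
      then obtain m'' where m'': "m = add_mset j m''"
        using j by (auto simp: m'_def dest: multi_member_split)
      \<comment> \<open>Both sides of \<open>\<partial>\<^sub>i H\<^sub>j = \<partial>\<^sub>j H\<^sub>i\<close> are compared at the monomial \<open>m''\<close>.\<close>
      have "add_pow M (count m' j) (add_pow M (count m' i) (G m'))
          = add_pow M (count m' i) (H j (m' - {#j#}))"
        using Gc Gj by (simp add: M.add.nat_pow_pow mult.commute flip: Gj)
      also have "m' - {#j#} = add_mset i m''"
        using False by (simp add: m'_def m'' add_mset_commute)
      also have "add_pow M (count m' i) (H j (add_mset i m'')) = mpoly_deriv M i (H j) m''"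
        using False by (simp add: mpoly_deriv_def m'_def m'' del: M.add.nat_pow_Suc)
      also have "\<dots> = mpoly_deriv M j (H i) m''" using closed i j by simp
      also have "\<dots> = add_pow M (count m' j) (H i m)"
        using False by (simp add: mpoly_deriv_def m'_def m'' del: M.add.nat_pow_Suc)
      finally have eq: "add_pow M (count m' j) (add_pow M (count m' i) (G m'))
        = add_pow M (count m' j) (H i m)" .
      have "0 < count m' j" using j(1) by simp
      from add_pow_cancel[OF this M.add.nat_pow_closed[OF Gc] Hc[OF i] eq]
      show ?thesis by (simp only: DG)
    qed
  qed
  show ?thesis
  proof (rule that[OF G])
    fix i assume i: "i \<in> {1..n}"
    show "mpoly_deriv M i G = H i" by (rule ext) (rule DG_eq[OF i])
  qed
qed

end

text \<open>
  A function of finite support is given by its graph above the support, a finite subset of a set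
  that has the cardinality of the infinite type \<open>'a\<close>; finite subsets of an infinite set are as
  numerous as its elements.
\<close>
lemma finite_support_embedding:
  assumes "infinite (UNIV :: 'a set)"
  shows "\<exists>\<iota> :: (nat multiset \<Rightarrow> 'a) \<Rightarrow> 'a. inj_on \<iota> {p. finite {m. p m \<noteq> z}}"
proof -
  let ?A = "UNIV :: 'a set" and ?N = "UNIV :: nat multiset set" and ?X = "UNIV :: (nat multiset \<times> 'a) set"
  have "inj (to_nat \<circ> (sorted_list_of_multiset :: nat multiset \<Rightarrow> nat list))"
    by (intro inj_compose inj_to_nat) (metis injI mset_sorted_list_of_multiset)
  hence "|?N| \<le>o |UNIV :: nat set|" by (auto simp: card_of_ordLeq[symmetric])
  also have "|UNIV :: nat set| \<le>o |?A|" using assms by (simp add: infinite_iff_card_of_nat)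
  finally have "|?N| \<le>o |?A|" .
  hence "|?N \<times> ?A| =o |?A|" using assms by (intro card_of_Times_infinite[THEN conjunct2]) auto
  hence X: "|?X| =o |?A|" by simp
  have "infinite ?X" using assms by (simp add: finite_prod)
  hence "|Fpow ?X| =o |?A|" using card_of_Fpow_infinite X ordIso_transitive by blast
  hence "|Fpow ?X| \<le>o |?A|" by (rule ordIso_imp_ordLeq)
  then obtain f :: "(nat multiset \<times> 'a) set \<Rightarrow> 'a" where f: "inj_on f (Fpow ?X)"
    by (auto simp: card_of_ordLeq[symmetric])
  define gr where "gr p = {(m, p m) | m. p m \<noteq> z}" for p :: "nat multiset \<Rightarrow> 'a"
  have "inj_on gr UNIV"
  proof (rule injI)
    fix p q assume eq: "gr p = gr q"
    have mem: "(m, a) \<in> gr p \<longleftrightarrow> a = p m \<and> a \<noteq> z" for m a and p by (auto simp: gr_def)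
    show "p = q"
    proof
      fix m show "p m = q m" using mem[of m "p m" p] mem[of m "q m" q] mem[of m "p m" q] mem[of m "q m" p] eq
        by metis
    qed
  qed
  moreover have "gr ` {p. finite {m. p m \<noteq> z}} \<subseteq> Fpow ?X"
    by (auto simp: Fpow_def gr_def)
  ultimately have "inj_on (f \<circ> gr) {p. finite {m. p m \<noteq> z}}"
    using f by (intro comp_inj_on) (auto intro: inj_on_subset)
  thus ?thesis by blast
qed

text \<open>
  Polynomials are not more numerous than the elements of the type of their coefficients.  That
  type is infinite, as it contains the multiples of \<open>1\<close>, unless the algebra is zero.
\<close>
lemma (in char_zero_algebra) mpoly_embedding:
  "\<exists>\<iota> :: (nat multiset \<Rightarrow> 'c) \<Rightarrow> 'c. inj_on \<iota> (carrier (mpoly_algebra M n))"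
proof (cases "\<one>\<^bsub>M\<^esub> = \<zero>\<^bsub>M\<^esub>")
  case True
  hence "a = \<zero>\<^bsub>M\<^esub>" if "a \<in> carrier M" for a using that one_zeroD by blast
  hence "carrier (mpoly_algebra M n) \<subseteq> {\<lambda>m. \<zero>\<^bsub>M\<^esub>}" by (auto simp: mpoly_carrier_iff)
  thus ?thesis by (intro exI[of _ "\<lambda>p. undefined"] inj_onI) blast
next
  case False
  have "inj (\<lambda>k::nat. add_pow M k \<one>\<^bsub>M\<^esub>)"
  proof (rule linorder_injI)
    fix k l :: nat assume "k < l"
    then obtain d where d: "l = d + k" "0 < d" by (metis add.commute less_imp_add_positive)
    show "add_pow M k \<one>\<^bsub>M\<^esub> \<noteq> add_pow M l \<one>\<^bsub>M\<^esub>"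
    proof
      assume "add_pow M k \<one>\<^bsub>M\<^esub> = add_pow M l \<one>\<^bsub>M\<^esub>"
      also have "\<dots> = add_pow M d \<one>\<^bsub>M\<^esub> \<oplus>\<^bsub>M\<^esub> add_pow M k \<one>\<^bsub>M\<^esub>"
        unfolding d by (simp add: M.add.nat_pow_mult)
      finally have "add_pow M d \<one>\<^bsub>M\<^esub> = add_pow M d \<zero>\<^bsub>M\<^esub>"
        by (simp add: M.add.r_cancel_one')
      with d False add_pow_cancel[of d "\<one>\<^bsub>M\<^esub>" "\<zero>\<^bsub>M\<^esub>"] show False by simp
    qed
  qed
  hence "infinite (UNIV :: 'c set)"
    using finite_imageD[of "\<lambda>k::nat. add_pow M k \<one>\<^bsub>M\<^esub>" UNIV] by (meson finite_subset infinite_UNIV_nat subset_UNIV)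
  from finite_support_embedding[OF this, of "\<zero>\<^bsub>M\<^esub>"]
  obtain \<iota> :: "(nat multiset \<Rightarrow> 'c) \<Rightarrow> 'c"
    where \<iota>: "inj_on \<iota> {p. finite {m. p m \<noteq> \<zero>\<^bsub>M\<^esub>}}" ..
  have "carrier (mpoly_algebra M n) \<subseteq> {p. finite {m. p m \<noteq> \<zero>\<^bsub>M\<^esub>}}"
    by (auto simp: mpoly_carrier_iff)
  with \<iota> have "inj_on \<iota> (carrier (mpoly_algebra M n))" by (rule inj_on_subset)
  thus ?thesis
    by (rule exI[where P = "\<lambda>\<iota>. inj_on \<iota> (carrier (mpoly_algebra M n))"])
qed

section \<open>Dual families of vectors\<close>

text \<open>The pairing of a vector \<open>v\<close> and a linear form \<open>x\<close>, both given by coordinates in \<open>I\<close>.\<close>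
definition dot :: "('a, 'm) ring_scheme \<Rightarrow> 'i set \<Rightarrow> ('i \<Rightarrow> 'a) \<Rightarrow> ('i \<Rightarrow> 'a) \<Rightarrow> 'a"
  where "dot R I v x = (\<Oplus>\<^bsub>R\<^esub>i\<in>I. v i \<otimes>\<^bsub>R\<^esub> x i)"

context cring
begin

lemma dot_closed: "v \<in> I \<rightarrow> carrier R \<Longrightarrow> x \<in> I \<rightarrow> carrier R \<Longrightarrow> dot R I v x \<in> carrier R"
  unfolding dot_def by (intro finsum_closed) auto

lemma dot_cong:
  assumes "v \<in> I \<rightarrow> carrier R" "x \<in> I \<rightarrow> carrier R" "\<And>i. i \<in> I \<Longrightarrow> y i = x i"
  shows "dot R I v y = dot R I v x"
  unfolding dot_def using assms by (intro finsum_cong') auto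

lemma dot_lin:
  assumes "finite I" "v \<in> I \<rightarrow> carrier R" "x \<in> I \<rightarrow> carrier R" "y \<in> I \<rightarrow> carrier R" "a \<in> carrier R"
  shows "dot R I v (\<lambda>i. x i \<ominus> a \<otimes> y i) = dot R I v x \<ominus> a \<otimes> dot R I v y"
  using assms
proof (induction I)
  case empty thus ?case by (simp add: dot_def minus_eq)
next
  case (insert k I)
  have cl: "v k \<in> carrier R" "x k \<in> carrier R" "y k \<in> carrier R" "dot R I v x \<in> carrier R" "dot R I v y \<in> carrier R"
    using insert.prems by (auto simp: Pi_iff intro!: dot_closed)
  have ins: "dot R (insert k I) v z = v k \<otimes> z k \<oplus> dot R I v z" if "z \<in> insert k I \<rightarrow> carrier R" for z
    unfolding dot_def using insert.prems insert.hyps that by (subst finsum_insert) auto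
  have "dot R (insert k I) v (\<lambda>i. x i \<ominus> a \<otimes> y i)
      = v k \<otimes> (x k \<ominus> a \<otimes> y k) \<oplus> (dot R I v x \<ominus> a \<otimes> dot R I v y)"
    using insert by (subst ins) (auto simp: Pi_iff)
  also have "\<dots> = v k \<otimes> x k \<oplus> dot R I v x \<ominus> a \<otimes> (v k \<otimes> y k \<oplus> dot R I v y)"
    using cl insert.prems(4) by algebra
  finally show ?case using insert.prems by (simp add: ins)
qed

lemma dot_scale:
  assumes "finite I" "v \<in> I \<rightarrow> carrier R" "x \<in> I \<rightarrow> carrier R" "a \<in> carrier R"
  shows "dot R I v (\<lambda>i. a \<otimes> x i) = a \<otimes> dot R I v x"
proof -
  have "dot R I v (\<lambda>i. a \<otimes> x i) = (\<Oplus>i\<in>I. a \<otimes> (v i \<otimes> x i))"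
    unfolding dot_def using assms by (intro finsum_cong') (auto simp: Pi_iff m_lcomm)
  also have "\<dots> = a \<otimes> dot R I v x"
    unfolding dot_def using assms by (intro finsum_rdistr[symmetric]) auto
  finally show ?thesis .
qed

lemma dot_unit:
  assumes "finite I" "v \<in> I \<rightarrow> carrier R" "k \<in> I"
  shows "dot R I v (\<lambda>i. if i = k then \<one> else \<zero>) = v k"
proof -
  have "dot R I v (\<lambda>i. if i = k then \<one> else \<zero>) = (\<Oplus>i\<in>I. if k = i then v i else \<zero>)"
    unfolding dot_def using assms by (intro finsum_cong') (auto simp: Pi_iff)
  also have "\<dots> = v k" using assms by (intro finsum_singleton) auto
  finally show ?thesis .
qed

lemma dot_swap:
  assumes I: "finite I" "v \<in> I \<rightarrow> carrier R" and J: "finite J" "a \<in> J \<rightarrow> carrier R"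
    and Y: "\<And>j. j \<in> J \<Longrightarrow> Y j \<in> I \<rightarrow> carrier R"
  shows "dot R I v (\<lambda>i. dot R J a (\<lambda>j. Y j i)) = dot R J a (\<lambda>j. dot R I v (Y j))"
  using J Y
proof (induction J)
  case empty
  have "dot R I v (\<lambda>i. \<zero>) = \<zero>" unfolding dot_def using I by (intro add.finprod_one_eqI) (auto simp: Pi_iff)
  thus ?case by (simp add: dot_def)
next
  case (insert k J)
  have ins: "dot R (insert k J) a z = a k \<otimes> z k \<oplus> dot R J a z" if "z \<in> insert k J \<rightarrow> carrier R" for z
    unfolding dot_def using insert.prems insert.hyps that by (subst finsum_insert) auto
  have aJ: "a \<in> J \<rightarrow> carrier R" "a k \<in> carrier R" and Yk: "Y k \<in> I \<rightarrow> carrier R"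
    using insert.prems by auto
  have Yc: "Y j i \<in> carrier R" if "i \<in> I" "j \<in> insert k J" for i j
    using insert.prems that by blast
  have dJ: "dot R J a (\<lambda>j. Y j i) \<in> carrier R" if "i \<in> I" for i
    using that aJ Yc by (intro dot_closed) auto
  have "dot R I v (\<lambda>i. dot R (insert k J) a (\<lambda>j. Y j i))
      = (\<Oplus>i\<in>I. v i \<otimes> (a k \<otimes> Y k i) \<oplus> v i \<otimes> dot R J a (\<lambda>j. Y j i))"
    unfolding dot_def[of R I]
  proof (rule finsum_cong')
    fix i assume i: "i \<in> I"
    have vi: "v i \<in> carrier R" using I i by blast
    show "v i \<otimes> dot R (insert k J) a (\<lambda>j. Y j i)
        = v i \<otimes> (a k \<otimes> Y k i) \<oplus> v i \<otimes> dot R J a (\<lambda>j. Y j i)"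
      using i aJ Yc dJ vi by (subst ins) (auto simp: r_distr)
  qed (use I Yc dJ aJ in \<open>auto simp: Pi_iff\<close>)
  also have "\<dots> = dot R I v (\<lambda>i. a k \<otimes> Y k i) \<oplus> dot R I v (\<lambda>i. dot R J a (\<lambda>j. Y j i))"
    unfolding dot_def[of R I] using I aJ Yc dJ by (intro finsum_addf) (auto simp: Pi_iff)
  also have "\<dots> = a k \<otimes> dot R I v (Y k) \<oplus> dot R J a (\<lambda>j. dot R I v (Y j))"
    using insert.IH[OF aJ(1)] insert.prems I aJ Yk by (simp add: dot_scale)
  also have "\<dots> = dot R (insert k J) a (\<lambda>j. dot R I v (Y j))"
    using I insert.prems by (intro ins[symmetric] Pi_I dot_closed) auto
  finally show ?case .
qed

end

text \<open>
  Gaussian elimination in terms of dual families: among the vectors \<open>c t\<close> with \<open>t\<close> in \<open>S\<close> there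
  are finitely many, indexed by \<open>s\<close>, with a dual family \<open>Y\<close> of linear forms, such that the
  expansion of every \<open>c t\<close> along them, with the coefficients read off by \<open>Y\<close>, is exact.  The
  induction is on the number of coordinates at which the expansion is known to be exact.
\<close>
theorem (in field) dual_family_exists:
  fixes c :: "'s \<Rightarrow> nat \<Rightarrow> 'a"
  assumes c: "\<And>t. t \<in> S \<Longrightarrow> c t \<in> {1..n} \<rightarrow> carrier R"
  obtains r :: nat and s Y where "s \<in> {1..r} \<rightarrow> S"
    and "\<And>j. j \<in> {1..r} \<Longrightarrow> Y j \<in> {1..n} \<rightarrow> carrier R"
    and "\<And>i j. i \<in> {1..r} \<Longrightarrow> j \<in> {1..r} \<Longrightarrow>
      dot R {1..n} (c (s i)) (Y j) = (if j = i then \<one> else \<zero>)"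
    and "\<And>t k. t \<in> S \<Longrightarrow> k \<in> {1..n} \<Longrightarrow>
      c t k = dot R {1..r} (\<lambda>j. c (s j) k) (\<lambda>j. dot R {1..n} (c t) (Y j))"
proof -
  define dual where "dual r s Y \<longleftrightarrow> s \<in> {1..r} \<rightarrow> S \<and> (\<forall>j\<in>{1..r}. Y j \<in> {1..n} \<rightarrow> carrier R) \<and>
    (\<forall>i\<in>{1..r}. \<forall>j\<in>{1..r}. dot R {1..n} (c (s i)) (Y j) = (if j = i then \<one> else \<zero>))"
    for r :: nat and s and Y :: "nat \<Rightarrow> nat \<Rightarrow> 'a"
  define expand where "expand r s Y t k = dot R {1..r} (\<lambda>j. c (s j) k) (\<lambda>j. dot R {1..n} (c t) (Y j))"
    for r :: nat and s and Y :: "nat \<Rightarrow> nat \<Rightarrow> 'a" and t k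
  have "l \<le> n \<Longrightarrow> \<exists>r s Y. dual r s Y \<and> (\<forall>t\<in>S. \<forall>k\<in>{1..l}. c t k = expand r s Y t k)" for l
  proof (induction l)
    case 0
    have "dual 0 (\<lambda>j. undefined) (\<lambda>j i. \<zero>)" by (simp add: dual_def)
    thus ?case by auto
  next
    case (Suc l)
    let ?L = "Suc l"
    obtain r s Y where d: "dual r s Y" and ex: "\<And>t k. t \<in> S \<Longrightarrow> k \<in> {1..l} \<Longrightarrow> c t k = expand r s Y t k"
      using Suc.IH Suc.prems by auto
    have L: "?L \<in> {1..n}" using Suc.prems by simp
    show ?case
    proof (cases "\<forall>t\<in>S. c t ?L = expand r s Y t ?L")
      case True
      with ex have "\<forall>t\<in>S. \<forall>k\<in>{1..?L}. c t k = expand r s Y t k" by (auto simp: le_Suc_eq)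
      with d show ?thesis by blast
    next
      case False
      then obtain u where u: "u \<in> S" "c u ?L \<noteq> expand r s Y u ?L" by blast
      define \<Lambda> where "\<Lambda> t = (\<lambda>j. dot R {1..n} (c t) (Y j))" for t
      have ck: "c t k \<in> carrier R" if "t \<in> S" "k \<in> {1..n}" for t k using c that by blast
      have s: "s j \<in> S" and Yc: "Y j \<in> {1..n} \<rightarrow> carrier R" if "j \<in> {1..r}" for j
        using d that by (auto simp: dual_def)
      have Yci: "Y j i \<in> carrier R" if "j \<in> {1..r}" "i \<in> {1..n}" for i j
        using Yc[OF that(1)] that(2) by blast
      have csk: "(\<lambda>j. c (s j) k) \<in> {1..r} \<rightarrow> carrier R" if "k \<in> {1..n}" for k
        using ck s that by blast
      have \<Lambda>c: "\<Lambda> t \<in> {1..r} \<rightarrow> carrier R" if "t \<in> S" for t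
        by (rule Pi_I) (simp only: \<Lambda>_def dot_closed[OF c[OF that] Yc])
      have expand: "expand r s Y t k = dot R {1..r} (\<lambda>j. c (s j) k) (\<Lambda> t)" for t k
        by (simp add: expand_def \<Lambda>_def)
      have exc: "expand r s Y t k \<in> carrier R" if "t \<in> S" "k \<in> {1..n}" for t k
        unfolding expand using csk \<Lambda>c that by (intro dot_closed) auto
      define res where "res t k = c t k \<ominus> expand r s Y t k" for t k
      have resc: "res t k \<in> carrier R" if "t \<in> S" "k \<in> {1..n}" for t k
        unfolding res_def using ck exc that by simp
      \<comment> \<open>The residual of \<open>u\<close> at the coordinate \<open>Suc l\<close> serves as the pivot.\<close>
      define w where "w = res u ?L"
      have w: "w \<in> carrier R" "w \<noteq> \<zero>"
        using resc[OF u(1) L] u(2) ck[OF u(1) L] exc[OF u(1) L]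
        by (auto simp: w_def res_def r_right_minus_eq)
      hence wi: "inv w \<in> carrier R" "inv w \<otimes> w = \<one>"
        using field_Units by auto
      \<comment> \<open>The linear form \<open>y\<close> reads off this coordinate of a residual and divides it by the pivot.
        It vanishes on the vectors chosen so far, and takes the value \<open>1\<close> on \<open>c u\<close>.\<close>
      define y where "y i = inv w \<otimes> ((if i = ?L then \<one> else \<zero>)
        \<ominus> \<one> \<otimes> dot R {1..r} (\<lambda>j. c (s j) ?L) (\<lambda>j. Y j i))" for i
      have dY: "dot R {1..r} (\<lambda>j. c (s j) ?L) (\<lambda>j. Y j i) \<in> carrier R" if "i \<in> {1..n}" for i
        using that by (intro dot_closed csk[OF L] Pi_I Yci)
      have yc: "y \<in> {1..n} \<rightarrow> carrier R" unfolding y_def using dY wi by auto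
      define \<beta> where "\<beta> t = dot R {1..n} (c t) y" for t
      have \<beta>: "\<beta> t = inv w \<otimes> res t ?L" if t: "t \<in> S" for t
      proof -
        have "\<beta> t = inv w \<otimes> dot R {1..n} (c t) (\<lambda>i. (if i = ?L then \<one> else \<zero>)
            \<ominus> \<one> \<otimes> dot R {1..r} (\<lambda>j. c (s j) ?L) (\<lambda>j. Y j i))"
          unfolding \<beta>_def y_def using c[OF t] wi dY by (intro dot_scale) auto
        also have "dot R {1..n} (c t) (\<lambda>i. (if i = ?L then \<one> else \<zero>)
            \<ominus> \<one> \<otimes> dot R {1..r} (\<lambda>j. c (s j) ?L) (\<lambda>j. Y j i))
          = dot R {1..n} (c t) (\<lambda>i. if i = ?L then \<one> else \<zero>) \<ominus>
            \<one> \<otimes> dot R {1..n} (c t) (\<lambda>i. dot R {1..r} (\<lambda>j. c (s j) ?L) (\<lambda>j. Y j i))"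
          using c[OF t] dY by (intro dot_lin) auto
        also have "dot R {1..n} (c t) (\<lambda>i. dot R {1..r} (\<lambda>j. c (s j) ?L) (\<lambda>j. Y j i))
            = expand r s Y t ?L"
          unfolding expand_def using c[OF t] csk[OF L] Yc by (intro dot_swap) auto
        also have "dot R {1..n} (c t) (\<lambda>i. if i = ?L then \<one> else \<zero>) = c t ?L"
          using c[OF t] L by (intro dot_unit) auto
        finally show ?thesis using exc[OF t L] by (simp add: res_def)
      qed
      have \<beta>c: "\<beta> t \<in> carrier R" if "t \<in> S" for t
        using \<beta>[OF that] wi resc[OF that L] by simp
      have exact: "expand r s Y (s i) k = c (s i) k" if "i \<in> {1..r}" "k \<in> {1..n}" for i k
      proof -
        have "expand r s Y (s i) k = dot R {1..r} (\<lambda>j. c (s j) k) (\<lambda>j. if j = i then \<one> else \<zero>)"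
          unfolding expand_def using d that csk[of k] by (intro dot_cong) (auto simp: dual_def)
        also have "\<dots> = c (s i) k" using csk that by (intro dot_unit) auto
        finally show ?thesis .
      qed
      have \<beta>s: "\<beta> (s i) = \<zero>" if "i \<in> {1..r}" for i
        using \<beta>[OF s[OF that]] exact[OF that L] ck[OF s[OF that] L] wi
        by (simp add: res_def minus_eq r_neg)
      have \<beta>u: "\<beta> u = \<one>" using \<beta>[OF u(1)] wi by (simp add: w_def)
      define s' where "s' j = (if j \<in> {1..r} then s j else u)" for j
      \<comment> \<open>The old linear forms are corrected by multiples of \<open>y\<close> so as to vanish on \<open>c u\<close>.\<close>
      define Y' where "Y' j = (if j \<in> {1..r} then (\<lambda>i. Y j i \<ominus> \<Lambda> u j \<otimes> y i) else y)" for j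
      have \<Lambda>': "dot R {1..n} (c t) (Y' j) = (if j \<in> {1..r} then \<Lambda> t j \<ominus> \<Lambda> u j \<otimes> \<beta> t else \<beta> t)"
        if t: "t \<in> S" for t j
      proof (cases "j \<in> {1..r}")
        case True
        hence "\<Lambda> u j \<in> carrier R" using \<Lambda>c[OF u(1)] by blast
        hence "dot R {1..n} (c t) (\<lambda>i. Y j i \<ominus> \<Lambda> u j \<otimes> y i) = \<Lambda> t j \<ominus> \<Lambda> u j \<otimes> \<beta> t"
          unfolding \<Lambda>_def \<beta>_def using c[OF t] Yc[OF True] yc by (intro dot_lin) auto
        thus ?thesis using True by (simp add: Y'_def)
      next
        case False
        thus ?thesis by (simp only: Y'_def if_False \<beta>_def)
      qed
      have in_Suc: "j \<in> {1..Suc r} \<longleftrightarrow> j = Suc r \<or> j \<in> {1..r}" for j by auto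
      have "dual (Suc r) s' Y'"
        unfolding dual_def
      proof (intro conjI ballI Pi_I)
        fix i j assume i: "i \<in> {1..Suc r}" and j: "j \<in> {1..Suc r}"
        have s'i: "s' i \<in> S" using s u by (simp add: s'_def)
        have \<Lambda>s: "\<Lambda> (s i) j = (if j = i then \<one> else \<zero>)" if "i \<in> {1..r}" "j \<in> {1..r}" for i
          using d that by (simp add: dual_def \<Lambda>_def)
        show "dot R {1..n} (c (s' i)) (Y' j) = (if j = i then \<one> else \<zero>)"
        proof (cases "i \<in> {1..r}")
          case True
          hence "s' i = s i" "\<beta> (s' i) = \<zero>" using \<beta>s by (auto simp: s'_def)
          moreover have "\<Lambda> u j \<in> carrier R" if "j \<in> {1..r}" using \<Lambda>c[OF u(1)] that by blast
          ultimately show ?thesis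
            unfolding \<Lambda>'[OF s'i] using True \<Lambda>s[OF True] j by (auto simp: in_Suc minus_eq)
        next
          case False
          hence "i = Suc r" "s' i = u" using i by (auto simp: s'_def)
          moreover have "\<Lambda> u j \<in> carrier R" if "j \<in> {1..r}" using \<Lambda>c[OF u(1)] that by blast
          ultimately show ?thesis
            unfolding \<Lambda>'[OF s'i] using j \<beta>u by (auto simp: in_Suc minus_eq r_neg)
        qed
      next
        fix i assume "i \<in> {1..Suc r}"
        thus "s' i \<in> S" using s u by (simp add: s'_def)
      next
        fix j i assume "j \<in> {1..Suc r}" and i: "i \<in> {1..n}"
        have "\<Lambda> u j \<in> carrier R" "Y j i \<in> carrier R" if "j \<in> {1..r}"
          using \<Lambda>c[OF u(1)] Yc[OF that] that i by blast+
        moreover have "y i \<in> carrier R" using yc i by blast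
        ultimately show "Y' j i \<in> carrier R" by (simp add: Y'_def)
      qed
      moreover have "c t k = expand (Suc r) s' Y' t k" if t: "t \<in> S" and k: "k \<in> {1..?L}" for t k
      proof -
        have kn: "k \<in> {1..n}" using k L by auto
        let ?f = "\<lambda>j. c (s' j) k \<otimes> dot R {1..n} (c t) (Y' j)"
        have fc: "?f \<in> {1..Suc r} \<rightarrow> carrier R"
        proof
          fix j
          have "s' j \<in> S" using s u by (simp add: s'_def)
          hence "c (s' j) k \<in> carrier R" using ck kn by blast
          moreover have "\<Lambda> t j \<in> carrier R" "\<Lambda> u j \<in> carrier R" if "j \<in> {1..r}"
            using \<Lambda>c[OF t] \<Lambda>c[OF u(1)] that by blast+
          ultimately show "?f j \<in> carrier R" unfolding \<Lambda>'[OF t] using \<beta>c[OF t] by simp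
        qed
        have ins: "{1..Suc r} = insert (Suc r) {1..r}" by auto
        have "expand (Suc r) s' Y' t k = ?f (Suc r) \<oplus> (\<Oplus>j\<in>{1..r}. ?f j)"
          unfolding expand_def ins dot_def[of R "insert (Suc r) {1..r}"] using fc[unfolded ins]
          by (intro finsum_insert) auto
        also have "?f (Suc r) = c u k \<otimes> \<beta> t" unfolding \<Lambda>'[OF t] by (simp add: s'_def)
        also have "(\<Oplus>j\<in>{1..r}. ?f j) = dot R {1..r} (\<lambda>j. c (s j) k) (\<lambda>j. \<Lambda> t j \<ominus> \<beta> t \<otimes> \<Lambda> u j)"
          unfolding dot_def[of R "{1..r}"]
        proof (rule finsum_cong')
          fix j assume j: "j \<in> {1..r}"
          have "\<Lambda> u j \<in> carrier R" using \<Lambda>c[OF u(1)] j by blast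
          thus "?f j = c (s j) k \<otimes> (\<Lambda> t j \<ominus> \<beta> t \<otimes> \<Lambda> u j)"
            unfolding \<Lambda>'[OF t] using j \<beta>c[OF t] by (simp add: s'_def m_comm)
        next
          show "(\<lambda>j. c (s j) k \<otimes> (\<Lambda> t j \<ominus> \<beta> t \<otimes> \<Lambda> u j)) \<in> {1..r} \<rightarrow> carrier R"
            using csk[OF kn] \<Lambda>c[OF t] \<Lambda>c[OF u(1)] \<beta>c[OF t] by (auto simp: Pi_iff)
        qed simp
        also have "\<dots> = expand r s Y t k \<ominus> \<beta> t \<otimes> expand r s Y u k"
          unfolding expand using csk[OF kn] \<Lambda>c[OF t] \<Lambda>c[OF u(1)] \<beta>c[OF t]
          by (intro dot_lin) auto
        also have "c u k \<otimes> \<beta> t \<oplus> (expand r s Y t k \<ominus> \<beta> t \<otimes> expand r s Y u k)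
            = expand r s Y t k \<oplus> \<beta> t \<otimes> res u k"
          unfolding res_def using ck[OF u(1) kn] exc[OF t kn] exc[OF u(1) kn] \<beta>c[OF t] by algebra
        also have "\<beta> t \<otimes> res u k = res t k"
        proof (cases "k = ?L")
          case True
          have "\<beta> t \<otimes> w = res t ?L"
            using \<beta>[OF t] wi w resc[OF t L] by (simp add: m_assoc m_comm[of "res t ?L"])
              (simp add: wi flip: m_assoc)
          thus ?thesis using True by (simp add: w_def)
        next
          case False
          hence "k \<in> {1..l}" using k by auto
          hence "res u k = \<zero>" "res t k = \<zero>"
            using ex[OF u(1)] ex[OF t] exc[OF t kn] exc[OF u(1) kn]
            by (auto simp: res_def minus_eq r_neg)
          thus ?thesis using \<beta>c[OF t] by simp
        qed
        also have "expand r s Y t k \<oplus> res t k = c t k"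
          unfolding res_def using ck[OF t kn] exc[OF t kn] by algebra
        finally show ?thesis by simp
      qed
      ultimately show ?thesis by blast
    qed
  qed
  from this[of n] obtain r s Y where "dual r s Y" "\<And>t k. t \<in> S \<Longrightarrow> k \<in> {1..n} \<Longrightarrow> c t k = expand r s Y t k"
    by auto
  thus ?thesis using that[of s r Y] by (auto simp: dual_def expand_def)
qed

section \<open>Straightening commuting directional derivatives\<close>

text \<open>The derivative \<open>c\<^sub>1\<partial>\<^sub>1 + \<dots> + c\<^sub>n\<partial>\<^sub>n\<close> in the direction of \<open>c\<close>.\<close>
definition dir_deriv ::
    "('k, 'a, 'm) module_scheme \<Rightarrow> nat \<Rightarrow> (nat \<Rightarrow> 'k) \<Rightarrow> (nat multiset \<Rightarrow> 'a) \<Rightarrow> (nat multiset \<Rightarrow> 'a)"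
  where "dir_deriv A n c p =
    (\<Oplus>\<^bsub>mpoly_algebra A n\<^esub>i\<in>{1..n}. c i \<odot>\<^bsub>mpoly_algebra A n\<^esub> mpoly_deriv A i p)"

lemma (in module) finsum_smult_rdistr:
  "finite I \<Longrightarrow> f \<in> I \<rightarrow> carrier R \<Longrightarrow> x \<in> carrier M \<Longrightarrow>
    (\<Oplus>\<^bsub>R\<^esub>i\<in>I. f i) \<odot>\<^bsub>M\<^esub> x = (\<Oplus>\<^bsub>M\<^esub>i\<in>I. f i \<odot>\<^bsub>M\<^esub> x)"
  by (induction I rule: finite_induct) (auto simp: smult_l_distr Pi_iff)

lemma (in algebra) smult_one_mult:
  "c \<in> carrier R \<Longrightarrow> x \<in> carrier M \<Longrightarrow> c \<odot>\<^bsub>M\<^esub> x = (c \<odot>\<^bsub>M\<^esub> \<one>\<^bsub>M\<^esub>) \<otimes>\<^bsub>M\<^esub> x"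
  by (simp add: smult_assoc2)

context algebra
begin

lemma dir_deriv_derivation:
  assumes "c \<in> {1..n} \<rightarrow> carrier R"
  shows "derivation (mpoly_algebra M n) (dir_deriv M n c)"
proof -
  interpret P: algebra R "mpoly_algebra M n" by (rule mpoly_algebra)
  have "derivation (mpoly_algebra M n) (\<lambda>p. \<Oplus>\<^bsub>mpoly_algebra M n\<^esub>i\<in>{1..n}.
      c i \<odot>\<^bsub>mpoly_algebra M n\<^esub> mpoly_deriv M i p)"
    using assms by (intro P.derivation_linear_combination mpoly_derivation)
  thus ?thesis by (simp add: dir_deriv_def[abs_def])
qed

lemma dir_deriv_const:
  assumes "c \<in> {1..n} \<rightarrow> carrier R" "k \<in> carrier M"
  shows "dir_deriv M n c (mpoly_const M k) = \<zero>\<^bsub>mpoly_algebra M n\<^esub>"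
proof -
  interpret P: algebra R "mpoly_algebra M n" by (rule mpoly_algebra)
  show ?thesis
    unfolding dir_deriv_def mpoly_deriv_const[where n = n]
    using assms by (intro P.add.finprod_one_eqI) (auto simp: Pi_iff)
qed

lemma dir_deriv_var:
  assumes c: "c \<in> {1..n} \<rightarrow> carrier R" and i: "i \<in> {1..n}"
  shows "dir_deriv M n c (mpoly_var M i) = c i \<odot>\<^bsub>mpoly_algebra M n\<^esub> \<one>\<^bsub>mpoly_algebra M n\<^esub>"
proof -
  interpret P: algebra R "mpoly_algebra M n" by (rule mpoly_algebra)
  have "dir_deriv M n c (mpoly_var M i) = (\<Oplus>\<^bsub>mpoly_algebra M n\<^esub>j\<in>{1..n}.
      if i = j then c j \<odot>\<^bsub>mpoly_algebra M n\<^esub> \<one>\<^bsub>mpoly_algebra M n\<^esub> else \<zero>\<^bsub>mpoly_algebra M n\<^esub>)"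
    unfolding dir_deriv_def mpoly_deriv_var[OF i]
    using c by (intro P.M.finsum_cong') (auto simp: Pi_iff)
  also have "\<dots> = c i \<odot>\<^bsub>mpoly_algebra M n\<^esub> \<one>\<^bsub>mpoly_algebra M n\<^esub>"
    using c i by (intro P.M.finsum_singleton) (auto simp: Pi_iff)
  finally show ?thesis .
qed

lemma dir_deriv_smult:
  assumes c: "c \<in> {1..n} \<rightarrow> carrier R" and a: "a \<in> carrier R" and p: "p \<in> carrier (mpoly_algebra M n)"
  shows "dir_deriv M n c (a \<odot>\<^bsub>mpoly_algebra M n\<^esub> p) = a \<odot>\<^bsub>mpoly_algebra M n\<^esub> dir_deriv M n c p"
proof -
  interpret P: algebra R "mpoly_algebra M n" by (rule mpoly_algebra)
  have Dp: "mpoly_deriv M i p \<in> carrier (mpoly_algebra M n)" for i using p by (rule mpoly_deriv_closed)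
  have ci: "c i \<in> carrier R" if "i \<in> {1..n}" for i using c that by blast
  have "dir_deriv M n c (a \<odot>\<^bsub>mpoly_algebra M n\<^esub> p) = (\<Oplus>\<^bsub>mpoly_algebra M n\<^esub>i\<in>{1..n}.
      a \<odot>\<^bsub>mpoly_algebra M n\<^esub> (c i \<odot>\<^bsub>mpoly_algebra M n\<^esub> mpoly_deriv M i p))"
    unfolding dir_deriv_def mpoly_deriv_smult[OF a p]
    using a ci Dp by (intro P.M.finsum_cong') (auto simp: R.m_comm simp flip: P.smult_assoc1)
  also have "\<dots> = a \<odot>\<^bsub>mpoly_algebra M n\<^esub> dir_deriv M n c p"
    unfolding dir_deriv_def using a ci Dp by (intro P.finsum_smult_ldistr[symmetric]) auto
  finally show ?thesis .
qed

text \<open>Directional derivatives depend linearly on the direction.\<close>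
lemma dir_deriv_dot:
  assumes c: "c \<in> {1..n} \<rightarrow> carrier R" and b: "\<And>j. j \<in> J \<Longrightarrow> b j \<in> {1..n} \<rightarrow> carrier R"
    and a: "a \<in> J \<rightarrow> carrier R" and J: "finite J"
    and eq: "\<And>i. i \<in> {1..n} \<Longrightarrow> c i = dot R J (\<lambda>j. b j i) a"
    and p: "p \<in> carrier (mpoly_algebra M n)"
  shows "dir_deriv M n c p
    = (\<Oplus>\<^bsub>mpoly_algebra M n\<^esub>j\<in>J. a j \<odot>\<^bsub>mpoly_algebra M n\<^esub> dir_deriv M n (b j) p)"
proof -
  let ?P = "mpoly_algebra M n"
  interpret P: algebra R ?P by (rule mpoly_algebra)
  have bi: "b j i \<in> carrier R" if "j \<in> J" "i \<in> {1..n}" for i j using b[OF that(1)] that(2) by blast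
  have aj: "a j \<in> carrier R" if "j \<in> J" for j using a that by blast
  have der: "derivation ?P (\<lambda>p. \<Oplus>\<^bsub>?P\<^esub>j\<in>J. a j \<odot>\<^bsub>?P\<^esub> dir_deriv M n (b j) p)"
    using b a by (intro P.derivation_linear_combination dir_deriv_derivation)
  have const: "dir_deriv M n c (mpoly_const M k)
      = (\<Oplus>\<^bsub>?P\<^esub>j\<in>J. a j \<odot>\<^bsub>?P\<^esub> dir_deriv M n (b j) (mpoly_const M k))" if k: "k \<in> carrier M" for k
  proof -
    have "(\<Oplus>\<^bsub>?P\<^esub>j\<in>J. a j \<odot>\<^bsub>?P\<^esub> dir_deriv M n (b j) (mpoly_const M k)) = \<zero>\<^bsub>?P\<^esub>"
      using b aj k by (intro P.add.finprod_one_eqI) (auto simp: dir_deriv_const)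
    thus ?thesis using c k by (simp only: dir_deriv_const)
  qed
  have var: "dir_deriv M n c (mpoly_var M i)
      = (\<Oplus>\<^bsub>?P\<^esub>j\<in>J. a j \<odot>\<^bsub>?P\<^esub> dir_deriv M n (b j) (mpoly_var M i))" if i: "i \<in> {1..n}" for i
  proof -
    have "dir_deriv M n c (mpoly_var M i) = (\<Oplus>\<^bsub>?P\<^esub>j\<in>J. (b j i \<otimes>\<^bsub>R\<^esub> a j) \<odot>\<^bsub>?P\<^esub> \<one>\<^bsub>?P\<^esub>)"
      unfolding dir_deriv_var[OF c i] eq[OF i] dot_def
      using J aj bi i by (intro P.finsum_smult_rdistr) auto
    also have "\<dots> = (\<Oplus>\<^bsub>?P\<^esub>j\<in>J. a j \<odot>\<^bsub>?P\<^esub> dir_deriv M n (b j) (mpoly_var M i))"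
    proof (rule P.M.finsum_cong')
      fix j assume j: "j \<in> J"
      show "(b j i \<otimes>\<^bsub>R\<^esub> a j) \<odot>\<^bsub>?P\<^esub> \<one>\<^bsub>?P\<^esub> = a j \<odot>\<^bsub>?P\<^esub> dir_deriv M n (b j) (mpoly_var M i)"
        unfolding dir_deriv_var[OF b[OF j] i] R.m_comm[OF bi[OF j i] aj[OF j]]
        using aj[OF j] bi[OF j i] by (intro P.smult_assoc1) auto
    next
      show "(\<lambda>j. a j \<odot>\<^bsub>?P\<^esub> dir_deriv M n (b j) (mpoly_var M i)) \<in> J \<rightarrow> carrier ?P"
        by (intro Pi_I P.smult_closed aj derivation_closed[OF dir_deriv_derivation[OF b]]
            mpoly_var_closed i)
    qed simp
    finally show ?thesis .
  qed
  have "dir_deriv M n c (id p) = id (\<Oplus>\<^bsub>?P\<^esub>j\<in>J. a j \<odot>\<^bsub>?P\<^esub> dir_deriv M n (b j) p)"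
    by (rule mpoly_derivation_intertwine[OF mpoly_cring id_ring_hom der dir_deriv_derivation[OF c] _ _ p])
      (simp_all only: id_apply const var)
  thus ?thesis by simp
qed

lemma mpoly_constant_term_ring_hom: "(\<lambda>p. p {#}) \<in> ring_hom (mpoly_algebra M n) M"
proof (rule ring_hom_memI)
  have "{a. a \<subseteq># ({#} :: nat multiset)} = {{#}}" by auto
  moreover fix p q assume "p \<in> carrier (mpoly_algebra M n)" "q \<in> carrier (mpoly_algebra M n)"
  ultimately show "(p \<otimes>\<^bsub>mpoly_algebra M n\<^esub> q) {#} = p {#} \<otimes>\<^bsub>M\<^esub> q {#}"
    by (simp add: mpoly_mult mpoly_conv_def mpoly_coeff_closed)
qed (auto simp: mpoly_coeff_closed mpoly_add mpoly_one mpoly_const_def)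

end

text \<open>
  Directions \<open>c\<^sub>1, \<dots>, c\<^sub>r\<close> with coordinate functions \<open>x\<^sub>1, \<dots>, x\<^sub>r\<close>: the derivative of \<open>x\<^sub>i\<close> in
  the direction of \<open>c\<^sub>j\<close> is \<open>1\<close> if \<open>i = j\<close>, and \<open>0\<close> otherwise.
\<close>
locale slices = char_zero_algebra +
  fixes n r :: nat and c :: "nat \<Rightarrow> nat \<Rightarrow> 'a" and x :: "nat \<Rightarrow> nat multiset \<Rightarrow> 'c"
  assumes directions: "j \<in> {1..r} \<Longrightarrow> c j \<in> {1..n} \<rightarrow> carrier R"
    and slices_closed: "j \<in> {1..r} \<Longrightarrow> x j \<in> carrier (mpoly_algebra M n)"
    and slices: "i \<in> {1..r} \<Longrightarrow> j \<in> {1..r} \<Longrightarrow> dir_deriv M n (c j) (x i)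
      = (if i = j then \<one>\<^bsub>mpoly_algebra M n\<^esub> else \<zero>\<^bsub>mpoly_algebra M n\<^esub>)"
begin

text \<open>The given algebra of polynomials in \<open>z\<^sub>1, \<dots>, z\<^sub>n\<close>.\<close>
definition P where "P = mpoly_algebra M n"

text \<open>Polynomials in new variables \<open>t\<^sub>1, \<dots>, t\<^sub>r\<close> whose coefficients are polynomials in the \<open>z\<^sub>i\<close>.\<close>
definition Q where "Q = mpoly_algebra P r"

text \<open>
  The homomorphism \<open>\<tau>\<close> is the Taylor expansion \<open>p \<mapsto> p(z + t\<^sub>1c\<^sub>1 + \<dots> + t\<^sub>rc\<^sub>r)\<close>, which turns the
  directional derivatives into the partial derivatives with respect to the new variables \<open>t\<^sub>j\<close>,
  and \<open>\<rho>\<close> is the retraction of \<open>\<tau>\<close> that substitutes \<open>x\<^sub>j\<close> for \<open>t\<^sub>j\<close> and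
  \<open>z - x\<^sub>1c\<^sub>1 - \<dots> - x\<^sub>rc\<^sub>r\<close> for \<open>z\<close>.  The directional derivatives of
  \<open>z - x\<^sub>1c\<^sub>1 - \<dots> - x\<^sub>rc\<^sub>r\<close> vanish, which is why \<open>\<rho>\<close> intertwines the derivatives as well.  As \<open>\<tau>\<close> turns a polynomial
  with vanishing directional derivatives into one with vanishing gradient in the \<open>t\<^sub>j\<close>, it maps
  such a polynomial to a constant.
\<close>
theorem straightening:
  obtains \<tau> \<rho> where "\<tau> \<in> ring_hom P Q" and "\<rho> \<in> ring_hom Q P"
    and "\<And>p. p \<in> carrier P \<Longrightarrow> \<rho> (\<tau> p) = p"
    and "\<And>j p. j \<in> {1..r} \<Longrightarrow> p \<in> carrier P \<Longrightarrow> mpoly_deriv P j (\<tau> p) = \<tau> (dir_deriv M n (c j) p)"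
    and "\<And>j F. j \<in> {1..r} \<Longrightarrow> F \<in> carrier Q \<Longrightarrow> dir_deriv M n (c j) (\<rho> F) = \<rho> (mpoly_deriv P j F)"
    and "\<And>h. h \<in> carrier P \<Longrightarrow> (\<And>j. j \<in> {1..r} \<Longrightarrow> dir_deriv M n (c j) h = \<zero>\<^bsub>P\<^esub>) \<Longrightarrow>
      \<tau> h = mpoly_const P h"
    and "\<And>F J. F \<in> carrier Q \<Longrightarrow> ideal J P \<Longrightarrow> (\<And>m. \<rho> (mpoly_const P (F m)) \<in> J) \<Longrightarrow> \<rho> F \<in> J"
proof -
  interpret P: char_zero_algebra R P unfolding P_def by (rule mpoly_char_zero_algebra)
  interpret Q: char_zero_algebra R Q unfolding Q_def by (rule P.mpoly_char_zero_algebra)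
  note P = P_def[symmetric] and Q = Q_def[symmetric]
  have cji: "c j i \<in> carrier R" if "j \<in> {1..r}" "i \<in> {1..n}" for i j
    using directions[OF that(1)] that(2) by blast
  have x: "x j \<in> carrier P" if "j \<in> {1..r}" for j using slices_closed[OF that] by (simp add: P)
  have z: "mpoly_var M i \<in> carrier P" if "i \<in> {1..n}" for i using mpoly_var_closed[OF that] by (simp add: P)
  have t: "mpoly_var P j \<in> carrier Q" if "j \<in> {1..r}" for j using P.mpoly_var_closed[OF that] by (simp add: Q)
  have constP: "mpoly_const M \<in> ring_hom M P" using mpoly_const_ring_hom by (simp add: P_def)
  have constQ: "mpoly_const P \<in> ring_hom P Q" using P.mpoly_const_ring_hom by (simp add: Q_def)
  have derP: "derivation P (dir_deriv M n (c j))" if "j \<in> {1..r}" for j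
    using dir_deriv_derivation[OF directions[OF that]] by (simp add: P)
  have derQ: "derivation Q (mpoly_deriv P j)" for j
    using P.mpoly_derivation by (simp add: Q_def)
  define y where "y i = (\<Oplus>\<^bsub>P\<^esub>j\<in>{1..r}. c j i \<odot>\<^bsub>P\<^esub> x j)" for i
  have y: "y i \<in> carrier P" if "i \<in> {1..n}" for i
    unfolding y_def using x cji that by (intro P.M.finsum_closed) auto
  have Dy: "dir_deriv M n (c j) (y i) = c j i \<odot>\<^bsub>P\<^esub> \<one>\<^bsub>P\<^esub>" if j: "j \<in> {1..r}" and i: "i \<in> {1..n}" for i j
  proof -
    have "dir_deriv M n (c j) (y i) = (\<Oplus>\<^bsub>P\<^esub>k\<in>{1..r}. dir_deriv M n (c j) (c k i \<odot>\<^bsub>P\<^esub> x k))"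
      unfolding y_def using x cji i by (intro P.derivation_finsum derP j) auto
    also have "\<dots> = (\<Oplus>\<^bsub>P\<^esub>k\<in>{1..r}. if j = k then c k i \<odot>\<^bsub>P\<^esub> \<one>\<^bsub>P\<^esub> else \<zero>\<^bsub>P\<^esub>)"
    proof (rule P.M.finsum_cong')
      fix k assume k: "k \<in> {1..r}"
      show "dir_deriv M n (c j) (c k i \<odot>\<^bsub>P\<^esub> x k) = (if j = k then c k i \<odot>\<^bsub>P\<^esub> \<one>\<^bsub>P\<^esub> else \<zero>\<^bsub>P\<^esub>)"
        using dir_deriv_smult[OF directions[OF j] cji[OF k i] slices_closed[OF k]] slices[OF k j]
          cji[OF k i] by (simp add: P)
    qed (use cji i in auto)
    also have "\<dots> = c j i \<odot>\<^bsub>P\<^esub> \<one>\<^bsub>P\<^esub>"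
      using j cji i by (intro P.M.finsum_singleton) auto
    finally show ?thesis .
  qed
  \<comment> \<open>The substitution of \<open>z - x\<^sub>1c\<^sub>1 - \<dots> - x\<^sub>rc\<^sub>r\<close> for \<open>z\<close>.\<close>
  obtain E where E: "E \<in> ring_hom P P"
    and E_const: "\<And>k. k \<in> carrier M \<Longrightarrow> E (mpoly_const M k) = mpoly_const M k"
    and E_var: "\<And>i. i \<in> {1..n} \<Longrightarrow> E (mpoly_var M i) = mpoly_var M i \<ominus>\<^bsub>P\<^esub> y i"
  proof (rule mpoly_ring_hom_exists[OF P.M_cring constP, of "\<lambda>i. mpoly_var M i \<ominus>\<^bsub>P\<^esub> y i" n, unfolded P])
    show "(\<lambda>i. mpoly_var M i \<ominus>\<^bsub>P\<^esub> y i) \<in> {1..n} \<rightarrow> carrier P" using z y by auto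
  qed (blast intro: that)
  obtain \<rho> where \<rho>: "\<rho> \<in> ring_hom Q P"
    and \<rho>_const: "\<And>p. p \<in> carrier P \<Longrightarrow> \<rho> (mpoly_const P p) = E p"
    and \<rho>_var: "\<And>j. j \<in> {1..r} \<Longrightarrow> \<rho> (mpoly_var P j) = x j"
    and \<rho>_ideal: "\<And>F J. F \<in> carrier Q \<Longrightarrow> ideal J P \<Longrightarrow> (\<And>m. E (F m) \<in> J) \<Longrightarrow> \<rho> F \<in> J"
  proof (rule P.mpoly_ring_hom_exists[OF P.M_cring E, of x r, unfolded Q])
    show "x \<in> {1..r} \<rightarrow> carrier P" using x by auto
  qed (blast intro: that)
  define y' where "y' i = (\<Oplus>\<^bsub>Q\<^esub>j\<in>{1..r}. c j i \<odot>\<^bsub>Q\<^esub> mpoly_var P j)" for i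
  have y': "y' i \<in> carrier Q" if "i \<in> {1..n}" for i
    unfolding y'_def using t cji that by (intro Q.M.finsum_closed) auto
  have cc: "mpoly_const P p \<in> carrier Q" if "p \<in> carrier P" for p
    using ring_hom_closed[OF constQ that] .
  obtain \<tau> where \<tau>: "\<tau> \<in> ring_hom P Q"
    and \<tau>_const: "\<And>k. k \<in> carrier M \<Longrightarrow> \<tau> (mpoly_const M k) = mpoly_const P (mpoly_const M k)"
    and \<tau>_var: "\<And>i. i \<in> {1..n} \<Longrightarrow> \<tau> (mpoly_var M i) = mpoly_const P (mpoly_var M i) \<oplus>\<^bsub>Q\<^esub> y' i"
  proof (rule mpoly_ring_hom_exists[OF Q.M_cring ring_hom_trans[OF constP constQ],
      of "\<lambda>i. mpoly_const P (mpoly_var M i) \<oplus>\<^bsub>Q\<^esub> y' i" n, unfolded P])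
    show "(\<lambda>i. mpoly_const P (mpoly_var M i) \<oplus>\<^bsub>Q\<^esub> y' i) \<in> {1..n} \<rightarrow> carrier Q"
      using z cc y' by auto
  qed (auto intro: that)
  have constM: "mpoly_const M k \<in> carrier P" if "k \<in> carrier M" for k
    using ring_hom_closed[OF constP that] .
  have D_const: "dir_deriv M n (c j) (mpoly_const M k) = \<zero>\<^bsub>P\<^esub>" if "j \<in> {1..r}" "k \<in> carrier M" for j k
    using dir_deriv_const[OF directions[OF that(1)] that(2)] by (simp add: P)
  have D_var: "dir_deriv M n (c j) (mpoly_var M i) = c j i \<odot>\<^bsub>P\<^esub> \<one>\<^bsub>P\<^esub>" if "j \<in> {1..r}" "i \<in> {1..n}" for i j
    using dir_deriv_var[OF directions[OF that(1)] that(2)] by (simp add: P)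
  have dt_const: "mpoly_deriv P j (mpoly_const P p) = \<zero>\<^bsub>Q\<^esub>" for j p
    using P.mpoly_deriv_const[where n = r] by (simp add: Q)
  have dt_var: "mpoly_deriv P j (mpoly_var P i) = (if i = j then \<one>\<^bsub>Q\<^esub> else \<zero>\<^bsub>Q\<^esub>)" if "i \<in> {1..r}" for i j
    using P.mpoly_deriv_var[OF that] by (simp add: Q)
  have scalarQ: "a \<odot>\<^bsub>Q\<^esub> \<one>\<^bsub>Q\<^esub> = mpoly_const P (a \<odot>\<^bsub>P\<^esub> \<one>\<^bsub>P\<^esub>)" if "a \<in> carrier R" for a
    using that unfolding Q_def P.mpoly_smult P.mpoly_one by (auto simp: mpoly_const_def)
  have scalarP: "a \<odot>\<^bsub>P\<^esub> \<one>\<^bsub>P\<^esub> = mpoly_const M (a \<odot>\<^bsub>M\<^esub> \<one>\<^bsub>M\<^esub>)" if "a \<in> carrier R" for a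
    using that unfolding P_def mpoly_smult mpoly_one by (auto simp: mpoly_const_def)
  have \<tau>_scalar: "\<tau> (a \<odot>\<^bsub>P\<^esub> \<one>\<^bsub>P\<^esub>) = a \<odot>\<^bsub>Q\<^esub> \<one>\<^bsub>Q\<^esub>" if "a \<in> carrier R" for a
    using that by (simp add: scalarQ scalarP \<tau>_const)
  have E_scalar: "E (a \<odot>\<^bsub>P\<^esub> \<one>\<^bsub>P\<^esub>) = a \<odot>\<^bsub>P\<^esub> \<one>\<^bsub>P\<^esub>" if "a \<in> carrier R" for a
    using that by (simp add: scalarP E_const)
  have dt_y': "mpoly_deriv P j (y' i) = c j i \<odot>\<^bsub>Q\<^esub> \<one>\<^bsub>Q\<^esub>" if j: "j \<in> {1..r}" and i: "i \<in> {1..n}" for i j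
  proof -
    have "mpoly_deriv P j (y' i) = (\<Oplus>\<^bsub>Q\<^esub>k\<in>{1..r}. mpoly_deriv P j (c k i \<odot>\<^bsub>Q\<^esub> mpoly_var P k))"
      unfolding y'_def using t cji i by (intro Q.derivation_finsum derQ) auto
    also have "\<dots> = (\<Oplus>\<^bsub>Q\<^esub>k\<in>{1..r}. if j = k then c k i \<odot>\<^bsub>Q\<^esub> \<one>\<^bsub>Q\<^esub> else \<zero>\<^bsub>Q\<^esub>)"
    proof (rule Q.M.finsum_cong')
      fix k assume k: "k \<in> {1..r}"
      show "mpoly_deriv P j (c k i \<odot>\<^bsub>Q\<^esub> mpoly_var P k) = (if j = k then c k i \<odot>\<^bsub>Q\<^esub> \<one>\<^bsub>Q\<^esub> else \<zero>\<^bsub>Q\<^esub>)"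
        using P.mpoly_deriv_smult[OF cji[OF k i] P.mpoly_var_closed[OF k]] dt_var[OF k]
          cji[OF k i] by (simp add: Q)
    qed (use cji i in auto)
    also have "\<dots> = c j i \<odot>\<^bsub>Q\<^esub> \<one>\<^bsub>Q\<^esub>"
      using j cji i by (intro Q.M.finsum_singleton) auto
    finally show ?thesis .
  qed
  have \<tau>_D: "mpoly_deriv P j (\<tau> p) = \<tau> (dir_deriv M n (c j) p)" if j: "j \<in> {1..r}" and p: "p \<in> carrier P" for j p
  proof (rule mpoly_derivation_intertwine[OF Q.M_cring _ _ derQ _ _ p[unfolded P_def], unfolded P,
        OF \<tau> derP[OF j]])
    fix k assume k: "k \<in> carrier M"
    show "mpoly_deriv P j (\<tau> (mpoly_const M k)) = \<tau> (dir_deriv M n (c j) (mpoly_const M k))"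
      using k ring_hom_zero[OF \<tau> P.ring_axioms Q.ring_axioms]
      by (simp only: \<tau>_const D_const[OF j] dt_const)
  next
    fix i assume i: "i \<in> {1..n}"
    have "mpoly_deriv P j (\<tau> (mpoly_var M i)) = \<zero>\<^bsub>Q\<^esub> \<oplus>\<^bsub>Q\<^esub> c j i \<odot>\<^bsub>Q\<^esub> \<one>\<^bsub>Q\<^esub>"
      unfolding \<tau>_var[OF i] using i z cc y' j by (simp only: derivation_add[OF derQ] dt_const dt_y')
    thus "mpoly_deriv P j (\<tau> (mpoly_var M i)) = \<tau> (dir_deriv M n (c j) (mpoly_var M i))"
      using cji[OF j i] by (simp add: D_var[OF j i] \<tau>_scalar)
  qed
  have \<rho>_scalar: "\<rho> (a \<odot>\<^bsub>Q\<^esub> q) = a \<odot>\<^bsub>P\<^esub> \<rho> q" if a: "a \<in> carrier R" and q: "q \<in> carrier Q" for a q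
  proof -
    have "\<rho> (a \<odot>\<^bsub>Q\<^esub> q) = \<rho> (a \<odot>\<^bsub>Q\<^esub> \<one>\<^bsub>Q\<^esub>) \<otimes>\<^bsub>P\<^esub> \<rho> q"
      unfolding Q.smult_one_mult[OF a q] using a q by (intro ring_hom_mult[OF \<rho>]) auto
    also have "\<rho> (a \<odot>\<^bsub>Q\<^esub> \<one>\<^bsub>Q\<^esub>) = a \<odot>\<^bsub>P\<^esub> \<one>\<^bsub>P\<^esub>"
      using a by (simp add: scalarQ \<rho>_const E_scalar)
    finally show ?thesis using P.smult_one_mult[OF a ring_hom_closed[OF \<rho> q]] by simp
  qed
  interpret \<rho>: ring_hom_cring Q P \<rho>
    by (intro ring_hom_cring.intro ring_hom_cring_axioms.intro \<rho> Q.M_cring P.M_cring)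
  have \<rho>_y': "\<rho> (y' i) = y i" if i: "i \<in> {1..n}" for i
  proof -
    have "\<rho> (y' i) = (\<Oplus>\<^bsub>P\<^esub>j\<in>{1..r}. \<rho> (c j i \<odot>\<^bsub>Q\<^esub> mpoly_var P j))"
      unfolding y'_def using t cji i by (subst \<rho>.hom_finsum) (auto simp: comp_def)
    also have "\<dots> = y i"
      unfolding y_def
    proof (rule P.M.finsum_cong')
      fix j assume j: "j \<in> {1..r}"
      show "\<rho> (c j i \<odot>\<^bsub>Q\<^esub> mpoly_var P j) = c j i \<odot>\<^bsub>P\<^esub> x j"
        using \<rho>_scalar[OF cji[OF j i] t[OF j]] \<rho>_var[OF j] by simp
    qed (use cji i x in auto)
    finally show ?thesis .
  qed
  have retract: "\<rho> (\<tau> p) = p" if p: "p \<in> carrier P" for p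
  proof -
    have "(\<rho> \<circ> \<tau>) p = id p"
    proof (rule mpoly_ring_hom_eq[OF P.M_cring _ _ _ _ p[unfolded P_def], unfolded P,
          OF ring_hom_trans[OF \<tau> \<rho>] id_ring_hom])
      fix k assume "k \<in> carrier M"
      thus "(\<rho> \<circ> \<tau>) (mpoly_const M k) = id (mpoly_const M k)"
        by (simp add: \<tau>_const \<rho>_const constM E_const)
    next
      fix i assume i: "i \<in> {1..n}"
      have "\<rho> (\<tau> (mpoly_var M i)) = (mpoly_var M i \<ominus>\<^bsub>P\<^esub> y i) \<oplus>\<^bsub>P\<^esub> y i"
        unfolding \<tau>_var[OF i]
        using \<rho>.hom_add[OF cc[OF z[OF i]] y'[OF i]] by (simp only: \<rho>_const[OF z[OF i]] E_var[OF i] \<rho>_y'[OF i])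
      also have "\<dots> = mpoly_var M i" using z[OF i] y[OF i] by algebra
      finally show "(\<rho> \<circ> \<tau>) (mpoly_var M i) = id (mpoly_var M i)" by simp
    qed
    thus ?thesis by simp
  qed
  have D_E: "dir_deriv M n (c j) (E p) = \<zero>\<^bsub>P\<^esub>" if j: "j \<in> {1..r}" and p: "p \<in> carrier P" for j p
  proof -
    have null: "derivation P (\<lambda>p. \<zero>\<^bsub>P\<^esub>)" by (simp add: derivation_def)
    have E0: "E \<zero>\<^bsub>P\<^esub> = \<zero>\<^bsub>P\<^esub>" by (rule ring_hom_zero[OF E P.ring_axioms P.ring_axioms])
    have "dir_deriv M n (c j) (E p) = E \<zero>\<^bsub>P\<^esub>"
    proof (rule mpoly_derivation_intertwine[OF P.M_cring _ _ derP[OF j] _ _ p[unfolded P_def], unfolded P,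
          OF E null])
      fix k assume "k \<in> carrier M"
      thus "dir_deriv M n (c j) (E (mpoly_const M k)) = E \<zero>\<^bsub>P\<^esub>"
        by (simp only: E_const D_const[OF j] E0)
    next
      fix i assume i: "i \<in> {1..n}"
      have "dir_deriv M n (c j) (E (mpoly_var M i)) = c j i \<odot>\<^bsub>P\<^esub> \<one>\<^bsub>P\<^esub> \<ominus>\<^bsub>P\<^esub> c j i \<odot>\<^bsub>P\<^esub> \<one>\<^bsub>P\<^esub>"
        unfolding E_var[OF i] P.derivation_minus[OF derP[OF j] z[OF i] y[OF i]] D_var[OF j i] Dy[OF j i] ..
      also have "\<dots> = E \<zero>\<^bsub>P\<^esub>" using cji[OF j i] by (simp add: E0 P.minus_eq P.M.r_neg)
      finally show "dir_deriv M n (c j) (E (mpoly_var M i)) = E \<zero>\<^bsub>P\<^esub>" .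
    qed
    thus ?thesis by (simp only: E0)
  qed
  have \<rho>_D: "dir_deriv M n (c j) (\<rho> F) = \<rho> (mpoly_deriv P j F)" if j: "j \<in> {1..r}" and F: "F \<in> carrier Q" for j F
  proof (rule P.mpoly_derivation_intertwine[OF P.M_cring _ _ derP[OF j] _ _ F[unfolded Q_def], unfolded Q,
        OF \<rho> derQ])
    fix p assume p: "p \<in> carrier P"
    show "dir_deriv M n (c j) (\<rho> (mpoly_const P p)) = \<rho> (mpoly_deriv P j (mpoly_const P p))"
      unfolding \<rho>_const[OF p] dt_const D_E[OF j p] by simp
  next
    fix i assume i: "i \<in> {1..r}"
    show "dir_deriv M n (c j) (\<rho> (mpoly_var P i)) = \<rho> (mpoly_deriv P j (mpoly_var P i))"
      unfolding \<rho>_var[OF i] dt_var[OF i] using slices[OF i j] by (simp add: P)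
  qed
  have ct: "(\<lambda>F. F {#}) \<in> ring_hom Q P" unfolding Q_def by (rule P.mpoly_constant_term_ring_hom)
  have Q_add: "(F \<oplus>\<^bsub>Q\<^esub> G) m = F m \<oplus>\<^bsub>P\<^esub> G m" for F G m by (simp add: Q_def P.mpoly_add)
  have y'_0: "y' i {#} = \<zero>\<^bsub>P\<^esub>" if i: "i \<in> {1..n}" for i
  proof -
    interpret ct: ring_hom_cring Q P "\<lambda>F. F {#}"
      by (intro ring_hom_cring.intro ring_hom_cring_axioms.intro ct Q.M_cring P.M_cring)
    have "y' i {#} = (\<Oplus>\<^bsub>P\<^esub>j\<in>{1..r}. (c j i \<odot>\<^bsub>Q\<^esub> mpoly_var P j) {#})"
      unfolding y'_def using t cji i by (subst ct.hom_finsum) (auto simp: comp_def)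
    also have "\<dots> = \<zero>\<^bsub>P\<^esub>"
    proof (rule P.add.finprod_one_eqI)
      fix j assume "j \<in> {1..r}"
      thus "(c j i \<odot>\<^bsub>Q\<^esub> mpoly_var P j) {#} = \<zero>\<^bsub>P\<^esub>"
        using cji i by (simp add: Q_def P.mpoly_smult mpoly_var_def)
    qed
    finally show ?thesis .
  qed
  have \<tau>_0: "\<tau> p {#} = p" if p: "p \<in> carrier P" for p
  proof -
    have "((\<lambda>F. F {#}) \<circ> \<tau>) p = id p"
    proof (rule mpoly_ring_hom_eq[OF P.M_cring _ _ _ _ p[unfolded P_def], unfolded P,
          OF ring_hom_trans[OF \<tau> ct] id_ring_hom])
      fix k assume "k \<in> carrier M"
      thus "((\<lambda>F. F {#}) \<circ> \<tau>) (mpoly_const M k) = id (mpoly_const M k)"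
        by (simp add: \<tau>_const mpoly_const_def[of P])
    next
      fix i assume i: "i \<in> {1..n}"
      show "((\<lambda>F. F {#}) \<circ> \<tau>) (mpoly_var M i) = id (mpoly_var M i)"
        using z[OF i] by (simp add: \<tau>_var[OF i] Q_add y'_0[OF i] mpoly_const_def[of P])
    qed
    thus ?thesis by simp
  qed
  have \<tau>_constant: "\<tau> h = mpoly_const P h"
    if h: "h \<in> carrier P" and D: "\<And>j. j \<in> {1..r} \<Longrightarrow> dir_deriv M n (c j) h = \<zero>\<^bsub>P\<^esub>" for h
  proof -
    have "mpoly_deriv P j (\<tau> h) = \<zero>\<^bsub>Q\<^esub>" if j: "j \<in> {1..r}" for j
      unfolding \<tau>_D[OF j h] D[OF j] by (rule ring_hom_zero[OF \<tau> P.ring_axioms Q.ring_axioms])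
    hence "\<tau> h = mpoly_const P (\<tau> h {#})"
      using ring_hom_closed[OF \<tau> h] unfolding Q_def by (intro P.mpoly_constant) auto
    thus ?thesis using \<tau>_0[OF h] by simp
  qed
  have ideal: "\<rho> F \<in> J"
    if F: "F \<in> carrier Q" and J: "ideal J P" and m: "\<And>m. \<rho> (mpoly_const P (F m)) \<in> J" for F J
  proof (rule \<rho>_ideal[OF F J])
    fix m
    have "F m \<in> carrier P" using F unfolding Q_def by (rule P.mpoly_coeff_closed)
    thus "E (F m) \<in> J" using m[of m] by (simp add: \<rho>_const)
  qed
  show ?thesis by (rule that[OF \<tau> \<rho> retract \<tau>_D \<rho>_D \<tau>_constant ideal])
qed

end

section \<open>Gradient operators\<close>

lemma first_order_op_apply:
  "p \<in> carrier (mpoly_algebra A n) \<Longrightarrow> first_order_op A n h c p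
    = h \<otimes>\<^bsub>mpoly_algebra A n\<^esub> p \<oplus>\<^bsub>mpoly_algebra A n\<^esub> dir_deriv A n c p"
  by (simp add: first_order_op_def dir_deriv_def Let_def)

context algebra
begin

lemma grad_ops_subset_diff_ops:
  assumes q: "q \<in> carrier (mpoly_algebra M n)"
  shows "grad_ops M n q \<subseteq> diff_ops R M n"
proof
  let ?P = "mpoly_algebra M n"
  interpret P: algebra R ?P by (rule mpoly_algebra)
  fix \<Phi> assume "\<Phi> \<in> grad_ops M n q"
  then obtain i where i: "i \<in> {1..n}"
    and \<Phi>: "\<Phi> = (\<lambda>p\<in>carrier ?P. mpoly_deriv M i p \<ominus>\<^bsub>?P\<^esub> (mpoly_deriv M i q \<otimes>\<^bsub>?P\<^esub> p))"
    unfolding grad_ops_def Let_def by blast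
  define c where "c j = (if i = j then \<one>\<^bsub>R\<^esub> else \<zero>\<^bsub>R\<^esub>)" for j
  have c: "c \<in> {1..n} \<rightarrow> carrier R" by (simp add: c_def)
  have Dq: "mpoly_deriv M i q \<in> carrier ?P" using q by (rule mpoly_deriv_closed)
  have "first_order_op M n (\<ominus>\<^bsub>?P\<^esub> mpoly_deriv M i q) c = \<Phi>"
  proof
    fix p
    show "first_order_op M n (\<ominus>\<^bsub>?P\<^esub> mpoly_deriv M i q) c p = \<Phi> p"
    proof (cases "p \<in> carrier ?P")
      case p: True
      have Dp: "mpoly_deriv M j p \<in> carrier ?P" for j using p by (rule mpoly_deriv_closed)
      have "dir_deriv M n c p = (\<Oplus>\<^bsub>?P\<^esub>j\<in>{1..n}. if i = j then mpoly_deriv M j p else \<zero>\<^bsub>?P\<^esub>)"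
        unfolding dir_deriv_def using Dp by (intro P.M.finsum_cong') (auto simp: c_def)
      also have "\<dots> = mpoly_deriv M i p" using i Dp by (intro P.M.finsum_singleton) auto
      finally have "first_order_op M n (\<ominus>\<^bsub>?P\<^esub> mpoly_deriv M i q) c p
          = (\<ominus>\<^bsub>?P\<^esub> mpoly_deriv M i q) \<otimes>\<^bsub>?P\<^esub> p \<oplus>\<^bsub>?P\<^esub> mpoly_deriv M i p"
        by (simp only: first_order_op_apply[OF p])
      also have "\<dots> = mpoly_deriv M i p \<ominus>\<^bsub>?P\<^esub> (mpoly_deriv M i q \<otimes>\<^bsub>?P\<^esub> p)"
        using Dq Dp[of i] p by algebra
      finally show ?thesis using p by (simp add: \<Phi>)
    qed (simp add: \<Phi> first_order_op_def Let_def)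
  qed
  thus "\<Phi> \<in> diff_ops R M n" using c Dq unfolding diff_ops_def by (blast intro: P.M.a_inv_closed)
qed

lemma grad_ops_commute:
  assumes q: "q \<in> carrier (mpoly_algebra M n)"
  shows "commuting_ops (mpoly_algebra M n) (grad_ops M n q)"
proof -
  let ?P = "mpoly_algebra M n" and ?D = "mpoly_deriv M"
  interpret P: algebra R ?P by (rule mpoly_algebra)
  note D = mpoly_deriv_closed and der = mpoly_derivation
  have "(?D i (?D j p \<ominus>\<^bsub>?P\<^esub> ?D j q \<otimes>\<^bsub>?P\<^esub> p)) \<ominus>\<^bsub>?P\<^esub> ?D i q \<otimes>\<^bsub>?P\<^esub> (?D j p \<ominus>\<^bsub>?P\<^esub> ?D j q \<otimes>\<^bsub>?P\<^esub> p)
      = (?D j (?D i p \<ominus>\<^bsub>?P\<^esub> ?D i q \<otimes>\<^bsub>?P\<^esub> p)) \<ominus>\<^bsub>?P\<^esub> ?D j q \<otimes>\<^bsub>?P\<^esub> (?D i p \<ominus>\<^bsub>?P\<^esub> ?D i q \<otimes>\<^bsub>?P\<^esub> p)"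
    if p: "p \<in> carrier ?P" for i j p
  proof -
    define dip djp diq djq dijp dijq where "dip = ?D i p" and "djp = ?D j p" and "diq = ?D i q"
      and "djq = ?D j q" and "dijp = ?D i (?D j p)" and "dijq = ?D i (?D j q)"
    note d = this
    have cl: "dip \<in> carrier ?P" "djp \<in> carrier ?P" "diq \<in> carrier ?P" "djq \<in> carrier ?P"
      "dijp \<in> carrier ?P" "dijq \<in> carrier ?P"
      using p q by (auto simp: d intro!: D)
    have "?D i (djp \<ominus>\<^bsub>?P\<^esub> djq \<otimes>\<^bsub>?P\<^esub> p) = dijp \<ominus>\<^bsub>?P\<^esub> (dijq \<otimes>\<^bsub>?P\<^esub> p \<oplus>\<^bsub>?P\<^esub> djq \<otimes>\<^bsub>?P\<^esub> dip)"
      using cl p by (simp add: P.derivation_minus[OF der] derivation_mult[OF der] d)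
    moreover have "?D j (dip \<ominus>\<^bsub>?P\<^esub> diq \<otimes>\<^bsub>?P\<^esub> p) = dijp \<ominus>\<^bsub>?P\<^esub> (dijq \<otimes>\<^bsub>?P\<^esub> p \<oplus>\<^bsub>?P\<^esub> diq \<otimes>\<^bsub>?P\<^esub> djp)"
      using cl p mpoly_deriv_commute[OF p, of i j] mpoly_deriv_commute[OF q, of i j]
      by (simp add: P.derivation_minus[OF der] derivation_mult[OF der] d)
    moreover have "dijp \<ominus>\<^bsub>?P\<^esub> (dijq \<otimes>\<^bsub>?P\<^esub> p \<oplus>\<^bsub>?P\<^esub> djq \<otimes>\<^bsub>?P\<^esub> dip) \<ominus>\<^bsub>?P\<^esub> diq \<otimes>\<^bsub>?P\<^esub> (djp \<ominus>\<^bsub>?P\<^esub> djq \<otimes>\<^bsub>?P\<^esub> p)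
        = dijp \<ominus>\<^bsub>?P\<^esub> (dijq \<otimes>\<^bsub>?P\<^esub> p \<oplus>\<^bsub>?P\<^esub> diq \<otimes>\<^bsub>?P\<^esub> djp) \<ominus>\<^bsub>?P\<^esub> djq \<otimes>\<^bsub>?P\<^esub> (dip \<ominus>\<^bsub>?P\<^esub> diq \<otimes>\<^bsub>?P\<^esub> p)"
      using cl p by algebra
    ultimately show ?thesis unfolding d by simp
  qed
  moreover have "?D i p \<ominus>\<^bsub>?P\<^esub> ?D i q \<otimes>\<^bsub>?P\<^esub> p \<in> carrier ?P" if "p \<in> carrier ?P" for i p
    using that q by (intro P.minus_closed P.m_closed D)
  ultimately show ?thesis
    unfolding commuting_ops_def grad_ops_def Let_def by (auto simp del: P.minus_eq)
qed

end

lemma mpoly_deriv_map: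
  assumes "algebra K A" "algebra K' B" and e: "e \<in> ring_hom A B" and p: "p \<in> carrier (mpoly_algebra A n)"
  shows "mpoly_deriv B i (e \<circ> p) = e \<circ> mpoly_deriv A i p"
proof -
  interpret A: algebra K A by fact
  interpret B: algebra K' B by fact
  interpret e: ring_hom_cring A B e
    by (intro ring_hom_cring.intro ring_hom_cring_axioms.intro e A.M_cring B.M_cring)
  have "add_pow B k (e a) = e (add_pow A k a)" if "a \<in> carrier A" for k :: nat and a
    using that by (induction k) auto
  thus ?thesis using A.mpoly_coeff_closed[OF p]
    by (auto simp: mpoly_deriv_def simp del: A.M.add.nat_pow_Suc B.M.add.nat_pow_Suc)
qed

section \<open>Reduction to gradient operators\<close>

text \<open>
  The quotient of an algebra by an ideal has a model on every type into which the algebra embeds.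
\<close>
lemma (in ring) coset_labels_exist:
  fixes \<iota> :: "'a \<Rightarrow> 'e"
  assumes J: "ideal J R" and \<iota>: "inj_on \<iota> (carrier R)"
  shows "\<exists>e :: 'a \<Rightarrow> 'e. \<forall>a\<in>carrier R. \<forall>b\<in>carrier R. e a = e b \<longleftrightarrow> a \<ominus> b \<in> J"
proof -
  interpret J: ideal J R by fact
  define rep where "rep a = (SOME b. b \<in> carrier R \<and> a \<ominus> b \<in> J)" for a
  have rep: "rep a \<in> carrier R \<and> a \<ominus> rep a \<in> J" if "a \<in> carrier R" for a
    unfolding rep_def by (rule someI[of _ a]) (use that in \<open>simp add: minus_eq r_neg\<close>)
  have sub: "a \<ominus> b \<in> J" if "a \<in> carrier R" "b \<in> carrier R" "d \<in> carrier R" "a \<ominus> d \<in> J" "b \<ominus> d \<in> J" for a b d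
  proof -
    have "a \<ominus> b = (a \<ominus> d) \<oplus> (\<ominus> (b \<ominus> d))" using that(1-3) by algebra
    thus ?thesis using that(4,5) by simp
  qed
  have sub': "b \<ominus> d \<in> J" if "a \<in> carrier R" "b \<in> carrier R" "d \<in> carrier R" "a \<ominus> d \<in> J" "a \<ominus> b \<in> J" for a b d
  proof -
    have "b \<ominus> d = (a \<ominus> d) \<oplus> (\<ominus> (a \<ominus> b))" using that(1-3) by algebra
    thus ?thesis using that(4,5) by simp
  qed
  have "\<iota> (rep a) = \<iota> (rep b) \<longleftrightarrow> a \<ominus> b \<in> J" if a: "a \<in> carrier R" and b: "b \<in> carrier R" for a b
  proof
    assume "\<iota> (rep a) = \<iota> (rep b)"
    hence "rep a = rep b" using \<iota> rep[OF a] rep[OF b] by (auto dest: inj_onD)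
    thus "a \<ominus> b \<in> J" using sub[OF a b, of "rep a"] rep[OF a] rep[OF b] by simp
  next
    assume ab: "a \<ominus> b \<in> J"
    have "d \<in> carrier R \<and> a \<ominus> d \<in> J \<longleftrightarrow> d \<in> carrier R \<and> b \<ominus> d \<in> J" for d
    proof -
      have "b \<ominus> d \<in> J" if "d \<in> carrier R" "a \<ominus> d \<in> J" using sub'[OF a b that ab] .
      moreover have "a \<ominus> d \<in> J" if "d \<in> carrier R" "b \<ominus> d \<in> J"
      proof -
        have "a \<ominus> d = (a \<ominus> b) \<oplus> (b \<ominus> d)" using a b that(1) by algebra
        thus ?thesis using ab that(2) by simp
      qed
      ultimately show ?thesis by blast
    qed
    thus "\<iota> (rep a) = \<iota> (rep b)" by (simp add: rep_def)
  qed
  thus ?thesis by (intro exI[of _ "\<lambda>a. \<iota> (rep a)"]) blast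
qed

text \<open>
  The main step.  Here \<open>D\<close> ranges over the algebras on the same type as the given one, so that
  the quotient to which the hypothesis is applied has to be labelled by elements of that type.
\<close>
theorem (in char_zero_algebra) image_conjecture_reduction:
  assumes C: "C \<subseteq> diff_ops R M n" and commute: "commuting_ops (mpoly_algebra M n) C"
    and hyp: "\<And>(D :: ('a, 'c) module) r q. algebra R D \<Longrightarrow> 1 \<le> r \<Longrightarrow>
      q \<in> carrier (mpoly_algebra D r) \<Longrightarrow>
      image_conjecture_holds (mpoly_algebra D r) (grad_ops D r q)"
  shows "image_conjecture_holds (mpoly_algebra M n) C"
proof -
  define P where "P = mpoly_algebra M n"
  interpret K: field R by (rule field)
  interpret P: char_zero_algebra R P unfolding P_def by (rule mpoly_char_zero_algebra)
  have "\<forall>\<Phi>\<in>C. \<exists>hc. fst hc \<in> carrier P \<and> snd hc \<in> {1..n} \<rightarrow> carrier R \<and> \<Phi> = first_order_op M n (fst hc) (snd hc)"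
  proof
    fix \<Phi> assume "\<Phi> \<in> C"
    then obtain h c where "h \<in> carrier P" "c \<in> {1..n} \<rightarrow> carrier R" "\<Phi> = first_order_op M n h c"
      using C unfolding diff_ops_def P_def by blast
    thus "\<exists>hc. fst hc \<in> carrier P \<and> snd hc \<in> {1..n} \<rightarrow> carrier R \<and> \<Phi> = first_order_op M n (fst hc) (snd hc)"
      by (intro exI[of _ "(h, c)"]) simp
  qed
  then obtain hc where hc: "\<forall>\<Phi>\<in>C. fst (hc \<Phi>) \<in> carrier P \<and> snd (hc \<Phi>) \<in> {1..n} \<rightarrow> carrier R
      \<and> \<Phi> = first_order_op M n (fst (hc \<Phi>)) (snd (hc \<Phi>))"
    by (rule bchoice[THEN exE])
  define h c where "h \<Phi> = fst (hc \<Phi>)" and "c \<Phi> = snd (hc \<Phi>)" for \<Phi>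
  have h: "h \<Phi> \<in> carrier P" and c: "c \<Phi> \<in> {1..n} \<rightarrow> carrier R"
    and \<Phi>_eq: "\<Phi> = first_order_op M n (h \<Phi>) (c \<Phi>)" if "\<Phi> \<in> C" for \<Phi>
    using hc that by (auto simp: h_def c_def)
  have der: "derivation P (dir_deriv M n (c \<Phi>))" if "\<Phi> \<in> C" for \<Phi>
    unfolding P_def by (rule dir_deriv_derivation[OF c[OF that]])
  have op_apply: "\<Phi> u = h \<Phi> \<otimes>\<^bsub>P\<^esub> u \<oplus>\<^bsub>P\<^esub> dir_deriv M n (c \<Phi>) u" if "\<Phi> \<in> C" "u \<in> carrier P" for \<Phi> u
    using first_order_op_apply[of u M n "h \<Phi>" "c \<Phi>"] that(2) \<Phi>_eq[OF that(1)] by (simp add: P_def)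
  have op_closed: "\<Phi> u \<in> carrier P" if "\<Phi> \<in> C" "u \<in> carrier P" for \<Phi> u
    using op_apply[OF that] h[OF that(1)] derivation_closed[OF der[OF that(1)] that(2)] that(2) by simp
  have op_add: "\<Phi> (u \<oplus>\<^bsub>P\<^esub> v) = \<Phi> u \<oplus>\<^bsub>P\<^esub> \<Phi> v" if \<Phi>: "\<Phi> \<in> C" and u: "u \<in> carrier P" and v: "v \<in> carrier P" for \<Phi> u v
  proof -
    note Du = derivation_closed[OF der[OF \<Phi>] u] and Dv = derivation_closed[OF der[OF \<Phi>] v]
    have "\<Phi> (u \<oplus>\<^bsub>P\<^esub> v) = h \<Phi> \<otimes>\<^bsub>P\<^esub> (u \<oplus>\<^bsub>P\<^esub> v) \<oplus>\<^bsub>P\<^esub> (dir_deriv M n (c \<Phi>) u \<oplus>\<^bsub>P\<^esub> dir_deriv M n (c \<Phi>) v)"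
      using op_apply[OF \<Phi>, of "u \<oplus>\<^bsub>P\<^esub> v"] u v by (simp add: derivation_add[OF der[OF \<Phi>] u v])
    also have "\<dots> = (h \<Phi> \<otimes>\<^bsub>P\<^esub> u \<oplus>\<^bsub>P\<^esub> dir_deriv M n (c \<Phi>) u) \<oplus>\<^bsub>P\<^esub> (h \<Phi> \<otimes>\<^bsub>P\<^esub> v \<oplus>\<^bsub>P\<^esub> dir_deriv M n (c \<Phi>) v)"
      using h[OF \<Phi>] u v Du Dv by algebra
    finally show ?thesis using op_apply[OF \<Phi> u] op_apply[OF \<Phi> v] by simp
  qed
  have op_smult: "\<Phi> (a \<odot>\<^bsub>P\<^esub> u) = a \<odot>\<^bsub>P\<^esub> \<Phi> u" if \<Phi>: "\<Phi> \<in> C" and a: "a \<in> carrier R" and u: "u \<in> carrier P" for \<Phi> a u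
  proof -
    have "dir_deriv M n (c \<Phi>) (a \<odot>\<^bsub>P\<^esub> u) = a \<odot>\<^bsub>P\<^esub> dir_deriv M n (c \<Phi>) u"
      unfolding P_def by (rule dir_deriv_smult[OF c[OF \<Phi>] a u[unfolded P_def]])
    thus ?thesis using op_apply[OF \<Phi>, of "a \<odot>\<^bsub>P\<^esub> u"] op_apply[OF \<Phi> u] a u h[OF \<Phi>] derivation_closed[OF der[OF \<Phi>] u]
      by (simp add: P.mult_smult P.smult_r_distr)
  qed
  let ?Im = "ops_image P C"
  have Im_value: "\<Phi> u \<in> ?Im" if "\<Phi> \<in> C" "u \<in> carrier P" for \<Phi> u
    using that op_closed by (intro P.M.ops_image_value) auto
  have Im_zero: "\<zero>\<^bsub>P\<^esub> \<in> ?Im" by (rule P.M.ops_image_zero)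
  have Im_add: "a \<oplus>\<^bsub>P\<^esub> b \<in> ?Im" if "a \<in> ?Im" "b \<in> ?Im" for a b
  proof (rule P.M.ops_image_add[OF _ _ that])
    fix \<Phi> u v assume 1: "\<Phi> \<in> C" "u \<in> carrier P"
    thus "\<Phi> u \<in> carrier P" by (rule op_closed)
    assume "v \<in> carrier P"
    with 1 show "\<Phi> (u \<oplus>\<^bsub>P\<^esub> v) = \<Phi> u \<oplus>\<^bsub>P\<^esub> \<Phi> v" by (rule op_add)
  qed
  have Im_sub: "?Im \<subseteq> carrier P"
  proof (rule P.M.ops_image_subset)
    fix \<Phi> u assume "\<Phi> \<in> C" "u \<in> carrier P"
    thus "\<Phi> u \<in> carrier P" by (rule op_closed)
  qed auto
  \<comment> \<open>Comparing the values at \<open>1\<close> of the two compositions of \<open>\<Phi>\<close> and \<open>\<Psi>\<close>.\<close>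
  have closed: "dir_deriv M n (c \<Phi>) (h \<Psi>) = dir_deriv M n (c \<Psi>) (h \<Phi>)" if \<Phi>: "\<Phi> \<in> C" and \<Psi>: "\<Psi> \<in> C" for \<Phi> \<Psi>
  proof -
    have one: "\<Phi> \<one>\<^bsub>P\<^esub> = h \<Phi>" if "\<Phi> \<in> C" for \<Phi>
      using op_apply[OF that P.one_closed] h[OF that] by (simp add: P.derivation_one[OF der[OF that]])
    have "\<Phi> (\<Psi> \<one>\<^bsub>P\<^esub>) = \<Psi> (\<Phi> \<one>\<^bsub>P\<^esub>)"
      using commute \<Phi> \<Psi> P.one_closed unfolding commuting_ops_def P_def by blast
    hence "h \<Phi> \<otimes>\<^bsub>P\<^esub> h \<Psi> \<oplus>\<^bsub>P\<^esub> dir_deriv M n (c \<Phi>) (h \<Psi>) = h \<Psi> \<otimes>\<^bsub>P\<^esub> h \<Phi> \<oplus>\<^bsub>P\<^esub> dir_deriv M n (c \<Psi>) (h \<Phi>)"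
      by (simp only: one[OF \<Phi>] one[OF \<Psi>] op_apply[OF \<Phi> h[OF \<Psi>]] op_apply[OF \<Psi> h[OF \<Phi>]])
    thus ?thesis
      using h[OF \<Phi>] h[OF \<Psi>] derivation_closed[OF der[OF \<Phi>] h[OF \<Psi>]] derivation_closed[OF der[OF \<Psi>] h[OF \<Phi>]]
      by (simp add: P.m_comm)
  qed
  obtain r :: nat and s :: "nat \<Rightarrow> _" and Y :: "nat \<Rightarrow> nat \<Rightarrow> 'a" where s: "s \<in> {1..r} \<rightarrow> C"
    and Y: "\<And>j. j \<in> {1..r} \<Longrightarrow> Y j \<in> {1..n} \<rightarrow> carrier R"
    and dual: "\<And>i j. i \<in> {1..r} \<Longrightarrow> j \<in> {1..r} \<Longrightarrow>
      dot R {1..n} (c (s i)) (Y j) = (if j = i then \<one>\<^bsub>R\<^esub> else \<zero>\<^bsub>R\<^esub>)"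
    and expand: "\<And>\<Phi> k. \<Phi> \<in> C \<Longrightarrow> k \<in> {1..n} \<Longrightarrow>
      c \<Phi> k = dot R {1..r} (\<lambda>j. c (s j) k) (\<lambda>j. dot R {1..n} (c \<Phi>) (Y j))"
    by (rule K.dual_family_exists[of C c n, OF c], assumption) (rule that)
  have sj: "s j \<in> C" if "j \<in> {1..r}" for j using s that by blast
  have Yji: "Y j i \<in> carrier R" if "j \<in> {1..r}" "i \<in> {1..n}" for i j using Y[OF that(1)] that(2) by blast
  \<comment> \<open>The dual linear forms, regarded as polynomials.\<close>
  define x where "x j = (\<Oplus>\<^bsub>P\<^esub>i\<in>{1..n}. Y j i \<odot>\<^bsub>P\<^esub> mpoly_var M i)" for j
  have z: "mpoly_var M i \<in> carrier P" if "i \<in> {1..n}" for i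
    using mpoly_var_closed[OF that] by (simp add: P_def)
  interpret S: slices R M n r "\<lambda>j. c (s j)" x
  proof
    fix i j assume i: "i \<in> {1..r}" and j: "j \<in> {1..r}"
    have cjk: "c (s j) k \<in> carrier R" if "k \<in> {1..n}" for k using c[OF sj[OF j]] that by blast
    have "dir_deriv M n (c (s j)) (x i)
        = (\<Oplus>\<^bsub>P\<^esub>k\<in>{1..n}. dir_deriv M n (c (s j)) (Y i k \<odot>\<^bsub>P\<^esub> mpoly_var M k))"
      unfolding x_def using Yji[OF i] z by (intro P.derivation_finsum der sj j) auto
    also have "\<dots> = (\<Oplus>\<^bsub>P\<^esub>k\<in>{1..n}. (c (s j) k \<otimes>\<^bsub>R\<^esub> Y i k) \<odot>\<^bsub>P\<^esub> \<one>\<^bsub>P\<^esub>)"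
    proof (rule P.M.finsum_cong')
      fix k assume k: "k \<in> {1..n}"
      have "dir_deriv M n (c (s j)) (Y i k \<odot>\<^bsub>P\<^esub> mpoly_var M k) = Y i k \<odot>\<^bsub>P\<^esub> (c (s j) k \<odot>\<^bsub>P\<^esub> \<one>\<^bsub>P\<^esub>)"
        using dir_deriv_smult[OF c[OF sj[OF j]] Yji[OF i k] mpoly_var_closed[OF k]]
          dir_deriv_var[OF c[OF sj[OF j]] k] by (simp add: P_def)
      also have "\<dots> = (Y i k \<otimes>\<^bsub>R\<^esub> c (s j) k) \<odot>\<^bsub>P\<^esub> \<one>\<^bsub>P\<^esub>"
        using Yji[OF i k] cjk[OF k] by (simp add: P.smult_assoc1)
      finally show "dir_deriv M n (c (s j)) (Y i k \<odot>\<^bsub>P\<^esub> mpoly_var M k) = (c (s j) k \<otimes>\<^bsub>R\<^esub> Y i k) \<odot>\<^bsub>P\<^esub> \<one>\<^bsub>P\<^esub>"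
        by (simp only: R.m_comm[OF Yji[OF i k] cjk[OF k]])
    qed (use Yji[OF i] cjk in auto)
    also have "\<dots> = dot R {1..n} (c (s j)) (Y i) \<odot>\<^bsub>P\<^esub> \<one>\<^bsub>P\<^esub>"
      unfolding dot_def using Yji[OF i] cjk by (intro P.finsum_smult_rdistr[symmetric]) auto
    finally show "dir_deriv M n (c (s j)) (x i)
        = (if i = j then \<one>\<^bsub>mpoly_algebra M n\<^esub> else \<zero>\<^bsub>mpoly_algebra M n\<^esub>)"
      unfolding dual[OF j i] P_def[symmetric] by simp
  next
    fix j assume j: "j \<in> {1..r}"
    show "c (s j) \<in> {1..n} \<rightarrow> carrier R" by (rule c[OF sj[OF j]])
    show "x j \<in> carrier (mpoly_algebra M n)"
      unfolding P_def[symmetric] x_def using Yji[OF j] z by (intro P.M.finsum_closed) auto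
  qed
  define Q where "Q = mpoly_algebra P r"
  have SP: "S.P = P" and SQ: "S.Q = Q" by (simp_all add: S.P_def S.Q_def P_def Q_def)
  interpret Q: char_zero_algebra R Q unfolding Q_def by (rule P.mpoly_char_zero_algebra)
  obtain \<tau> \<rho> where \<tau>: "\<tau> \<in> ring_hom P Q" and \<rho>: "\<rho> \<in> ring_hom Q P"
    and retract: "\<And>p. p \<in> carrier P \<Longrightarrow> \<rho> (\<tau> p) = p"
    and \<tau>_D: "\<And>j p. j \<in> {1..r} \<Longrightarrow> p \<in> carrier P \<Longrightarrow>
      mpoly_deriv P j (\<tau> p) = \<tau> (dir_deriv M n (c (s j)) p)"
    and \<rho>_D: "\<And>j F. j \<in> {1..r} \<Longrightarrow> F \<in> carrier Q \<Longrightarrow>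
      dir_deriv M n (c (s j)) (\<rho> F) = \<rho> (mpoly_deriv P j F)"
    and \<tau>_constant: "\<And>k. k \<in> carrier P \<Longrightarrow>
      (\<And>j. j \<in> {1..r} \<Longrightarrow> dir_deriv M n (c (s j)) k = \<zero>\<^bsub>P\<^esub>) \<Longrightarrow> \<tau> k = mpoly_const P k"
    and \<rho>_ideal: "\<And>F J. F \<in> carrier Q \<Longrightarrow> ideal J P \<Longrightarrow>
      (\<And>m. \<rho> (mpoly_const P (F m)) \<in> J) \<Longrightarrow> \<rho> F \<in> J"
  proof (rule S.straightening[unfolded SP SQ], goal_cases)
    case (1 \<tau> \<rho>)
    show ?case by (rule that[OF 1(2-8)])
  qed
  interpret \<tau>: ring_hom_cring P Q \<tau>
    by (intro ring_hom_cring.intro ring_hom_cring_axioms.intro \<tau> Q.M_cring P.M_cring)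
  interpret \<rho>: ring_hom_cring Q P \<rho>
    by (intro ring_hom_cring.intro ring_hom_cring_axioms.intro \<rho> Q.M_cring P.M_cring)
  have derQ: "derivation Q (mpoly_deriv P j)" for j unfolding Q_def by (rule P.mpoly_derivation)

  define \<mu> where "\<mu> \<Phi> j = dot R {1..n} (c \<Phi>) (Y j)" for \<Phi> j
  have \<mu>: "\<mu> \<Phi> j \<in> carrier R" if "\<Phi> \<in> C" "j \<in> {1..r}" for \<Phi> j
    unfolding \<mu>_def by (rule R.dot_closed[OF c[OF that(1)] Y[OF that(2)]])
  have dir_expand: "dir_deriv M n (c \<Phi>) p = (\<Oplus>\<^bsub>P\<^esub>j\<in>{1..r}. \<mu> \<Phi> j \<odot>\<^bsub>P\<^esub> dir_deriv M n (c (s j)) p)"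
    if \<Phi>: "\<Phi> \<in> C" and p: "p \<in> carrier P" for \<Phi> p
    unfolding P_def
  proof (rule dir_deriv_dot[OF c[OF \<Phi>] _ _ _ _ p[unfolded P_def]])
    show "c (s j) \<in> {1..n} \<rightarrow> carrier R" if "j \<in> {1..r}" for j by (rule c[OF sj[OF that]])
    show "\<mu> \<Phi> \<in> {1..r} \<rightarrow> carrier R" using \<mu>[OF \<Phi>] by auto
    show "c \<Phi> i = dot R {1..r} (\<lambda>j. c (s j) i) (\<mu> \<Phi>)" if "i \<in> {1..n}" for i
      using expand[OF \<Phi> that] by (simp add: \<mu>_def[abs_def])
  qed simp
  \<comment> \<open>Subtracting from \<open>\<Phi>\<close> the combination of the chosen operators with the same leading
    coefficients leaves the multiplication by \<open>k \<Phi>\<close>.\<close>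
  define k where "k \<Phi> = h \<Phi> \<ominus>\<^bsub>P\<^esub> (\<Oplus>\<^bsub>P\<^esub>j\<in>{1..r}. \<mu> \<Phi> j \<odot>\<^bsub>P\<^esub> h (s j))" for \<Phi>
  have \<mu>h: "\<mu> \<Phi> j \<odot>\<^bsub>P\<^esub> h (s j) \<in> carrier P" if "\<Phi> \<in> C" "j \<in> {1..r}" for \<Phi> j
    using \<mu>[OF that] h[OF sj[OF that(2)]] by simp
  have \<Sigma>h: "(\<Oplus>\<^bsub>P\<^esub>j\<in>{1..r}. \<mu> \<Phi> j \<odot>\<^bsub>P\<^esub> h (s j)) \<in> carrier P" if "\<Phi> \<in> C" for \<Phi>
    using \<mu>h[OF that] by (intro P.M.finsum_closed) auto
  have k: "k \<Phi> \<in> carrier P" if "\<Phi> \<in> C" for \<Phi>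
    unfolding k_def using h[OF that] \<Sigma>h[OF that] by simp
  have D_k: "dir_deriv M n (c (s i)) (k \<Phi>) = \<zero>\<^bsub>P\<^esub>" if \<Phi>: "\<Phi> \<in> C" and i: "i \<in> {1..r}" for \<Phi> i
  proof -
    let ?D = "dir_deriv M n (c (s i))"
    note d = der[OF sj[OF i]]
    have "?D (\<Oplus>\<^bsub>P\<^esub>j\<in>{1..r}. \<mu> \<Phi> j \<odot>\<^bsub>P\<^esub> h (s j)) = (\<Oplus>\<^bsub>P\<^esub>j\<in>{1..r}. ?D (\<mu> \<Phi> j \<odot>\<^bsub>P\<^esub> h (s j)))"
      using \<mu>h[OF \<Phi>] by (intro P.derivation_finsum d) auto
    also have "\<dots> = (\<Oplus>\<^bsub>P\<^esub>j\<in>{1..r}. \<mu> \<Phi> j \<odot>\<^bsub>P\<^esub> dir_deriv M n (c (s j)) (h (s i)))"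
    proof (rule P.M.finsum_cong')
      fix j assume j: "j \<in> {1..r}"
      have "?D (\<mu> \<Phi> j \<odot>\<^bsub>P\<^esub> h (s j)) = \<mu> \<Phi> j \<odot>\<^bsub>P\<^esub> ?D (h (s j))"
        unfolding P_def by (rule dir_deriv_smult[OF c[OF sj[OF i]] \<mu>[OF \<Phi> j] h[OF sj[OF j], unfolded P_def]])
      thus "?D (\<mu> \<Phi> j \<odot>\<^bsub>P\<^esub> h (s j)) = \<mu> \<Phi> j \<odot>\<^bsub>P\<^esub> dir_deriv M n (c (s j)) (h (s i))"
        by (simp only: closed[OF sj[OF i] sj[OF j]])
    next
      show "(\<lambda>j. \<mu> \<Phi> j \<odot>\<^bsub>P\<^esub> dir_deriv M n (c (s j)) (h (s i))) \<in> {1..r} \<rightarrow> carrier P"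
        by (intro Pi_I P.smult_closed \<mu>[OF \<Phi>] derivation_closed[OF der] sj h i)
    qed simp
    also have "\<dots> = dir_deriv M n (c \<Phi>) (h (s i))" by (rule dir_expand[OF \<Phi> h[OF sj[OF i]], symmetric])
    also have "\<dots> = ?D (h \<Phi>)" by (rule closed[OF \<Phi> sj[OF i]])
    finally show ?thesis
      unfolding k_def P.derivation_minus[OF d h[OF \<Phi>] \<Sigma>h[OF \<Phi>]]
      using derivation_closed[OF d h[OF \<Phi>]] by (simp add: P.minus_eq P.M.r_neg)
  qed
  have op_expand: "\<Phi> u = k \<Phi> \<otimes>\<^bsub>P\<^esub> u \<oplus>\<^bsub>P\<^esub> (\<Oplus>\<^bsub>P\<^esub>j\<in>{1..r}. s j (\<mu> \<Phi> j \<odot>\<^bsub>P\<^esub> u))"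
    if \<Phi>: "\<Phi> \<in> C" and u: "u \<in> carrier P" for \<Phi> u
  proof -
    have D: "dir_deriv M n (c (s j)) u \<in> carrier P" if "j \<in> {1..r}" for j
      by (rule derivation_closed[OF der[OF sj[OF that]] u])
    have "(\<Oplus>\<^bsub>P\<^esub>j\<in>{1..r}. s j (\<mu> \<Phi> j \<odot>\<^bsub>P\<^esub> u))
        = (\<Oplus>\<^bsub>P\<^esub>j\<in>{1..r}. (\<mu> \<Phi> j \<odot>\<^bsub>P\<^esub> h (s j)) \<otimes>\<^bsub>P\<^esub> u \<oplus>\<^bsub>P\<^esub> \<mu> \<Phi> j \<odot>\<^bsub>P\<^esub> dir_deriv M n (c (s j)) u)"
    proof (rule P.M.finsum_cong')
      fix j assume j: "j \<in> {1..r}"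
      show "s j (\<mu> \<Phi> j \<odot>\<^bsub>P\<^esub> u) = (\<mu> \<Phi> j \<odot>\<^bsub>P\<^esub> h (s j)) \<otimes>\<^bsub>P\<^esub> u \<oplus>\<^bsub>P\<^esub> \<mu> \<Phi> j \<odot>\<^bsub>P\<^esub> dir_deriv M n (c (s j)) u"
        unfolding op_smult[OF sj[OF j] \<mu>[OF \<Phi> j] u] op_apply[OF sj[OF j] u]
        using \<mu>[OF \<Phi> j] h[OF sj[OF j]] u D[OF j] by (simp add: P.smult_r_distr P.smult_assoc2)
    qed (use \<mu>h[OF \<Phi>] \<mu>[OF \<Phi>] u D in auto)
    also have "\<dots> = (\<Oplus>\<^bsub>P\<^esub>j\<in>{1..r}. (\<mu> \<Phi> j \<odot>\<^bsub>P\<^esub> h (s j)) \<otimes>\<^bsub>P\<^esub> u)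
        \<oplus>\<^bsub>P\<^esub> (\<Oplus>\<^bsub>P\<^esub>j\<in>{1..r}. \<mu> \<Phi> j \<odot>\<^bsub>P\<^esub> dir_deriv M n (c (s j)) u)"
      using \<mu>h[OF \<Phi>] \<mu>[OF \<Phi>] u D by (intro P.M.finsum_addf) auto
    also have "(\<Oplus>\<^bsub>P\<^esub>j\<in>{1..r}. (\<mu> \<Phi> j \<odot>\<^bsub>P\<^esub> h (s j)) \<otimes>\<^bsub>P\<^esub> u) = (\<Oplus>\<^bsub>P\<^esub>j\<in>{1..r}. \<mu> \<Phi> j \<odot>\<^bsub>P\<^esub> h (s j)) \<otimes>\<^bsub>P\<^esub> u"
      using \<mu>h[OF \<Phi>] u by (intro P.finsum_ldistr[symmetric]) auto
    also have "(\<Oplus>\<^bsub>P\<^esub>j\<in>{1..r}. \<mu> \<Phi> j \<odot>\<^bsub>P\<^esub> dir_deriv M n (c (s j)) u) = dir_deriv M n (c \<Phi>) u"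
      by (rule dir_expand[OF \<Phi> u, symmetric])
    finally have eq: "(\<Oplus>\<^bsub>P\<^esub>j\<in>{1..r}. s j (\<mu> \<Phi> j \<odot>\<^bsub>P\<^esub> u))
        = (\<Oplus>\<^bsub>P\<^esub>j\<in>{1..r}. \<mu> \<Phi> j \<odot>\<^bsub>P\<^esub> h (s j)) \<otimes>\<^bsub>P\<^esub> u \<oplus>\<^bsub>P\<^esub> dir_deriv M n (c \<Phi>) u" .
    have alg: "(a \<ominus>\<^bsub>P\<^esub> b) \<otimes>\<^bsub>P\<^esub> v \<oplus>\<^bsub>P\<^esub> (b \<otimes>\<^bsub>P\<^esub> v \<oplus>\<^bsub>P\<^esub> w) = a \<otimes>\<^bsub>P\<^esub> v \<oplus>\<^bsub>P\<^esub> w"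
      if "a \<in> carrier P" "b \<in> carrier P" "v \<in> carrier P" "w \<in> carrier P" for a b v w
      using that by algebra
    show ?thesis
      unfolding eq op_apply[OF \<Phi> u] k_def
      by (rule alg[OF h[OF \<Phi>] \<Sigma>h[OF \<Phi>] u derivation_closed[OF der[OF \<Phi>] u], symmetric])
  qed

  \<comment> \<open>The multiplications by the \<open>k \<Phi>\<close> contribute the ideal \<open>J\<close> to the image of \<open>C\<close>.  It
    is contained in the image because the largest ideal in the image contains its generators.\<close>
  define J where "J = genideal P (k ` C)"
  have kC: "k ` C \<subseteq> carrier P" using k by blast
  have J: "ideal J P" unfolding J_def by (rule P.genideal_ideal[OF kC])
  interpret J: ideal J P by (rule J)
  have kJ: "k \<Phi> \<in> J" if "\<Phi> \<in> C" for \<Phi>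
    unfolding J_def using P.genideal_self[OF kC] that by blast
  have J_op_image: "ideal {p \<in> carrier P. \<forall>a\<in>carrier P. a \<otimes>\<^bsub>P\<^esub> p \<in> ?Im} P" (is "ideal ?I P")
  proof (rule idealI[OF P.ring_axioms])
    show "subgroup ?I (add_monoid P)"
    proof (rule P.M.add.subgroupI)
      show "?I \<noteq> {}" using Im_zero by (auto intro!: exI[of _ "\<zero>\<^bsub>P\<^esub>"])
      fix p assume p: "p \<in> ?I"
      have "a \<otimes>\<^bsub>P\<^esub> (\<ominus>\<^bsub>P\<^esub> p) \<in> ?Im" if a: "a \<in> carrier P" for a
      proof -
        have "a \<otimes>\<^bsub>P\<^esub> (\<ominus>\<^bsub>P\<^esub> p) = (\<ominus>\<^bsub>P\<^esub> a) \<otimes>\<^bsub>P\<^esub> p" using a p by (simp add: P.l_minus P.r_minus)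
        thus ?thesis using p a by simp
      qed
      thus "\<ominus>\<^bsub>P\<^esub> p \<in> ?I" using p by simp
      fix q assume q: "q \<in> ?I"
      show "p \<oplus>\<^bsub>P\<^esub> q \<in> ?I" using p q by (auto simp: P.r_distr intro: Im_add)
    qed auto
    fix p b assume p: "p \<in> ?I" and b: "b \<in> carrier P"
    have "a \<otimes>\<^bsub>P\<^esub> (b \<otimes>\<^bsub>P\<^esub> p) \<in> ?Im" if a: "a \<in> carrier P" for a
    proof -
      have "a \<otimes>\<^bsub>P\<^esub> (b \<otimes>\<^bsub>P\<^esub> p) = (a \<otimes>\<^bsub>P\<^esub> b) \<otimes>\<^bsub>P\<^esub> p" using a b p by (simp add: P.m_assoc)
      thus ?thesis using p a b by simp
    qed
    thus bp: "b \<otimes>\<^bsub>P\<^esub> p \<in> ?I" using p b by simp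
    have "p \<otimes>\<^bsub>P\<^esub> b = b \<otimes>\<^bsub>P\<^esub> p" using p b by (simp add: P.m_comm)
    thus "p \<otimes>\<^bsub>P\<^esub> b \<in> ?I" using bp by (simp only:)
  qed
  have Im_\<Sigma>: "(\<Oplus>\<^bsub>P\<^esub>j\<in>{1..r}. s j (u j)) \<in> ?Im" if "\<And>j. j \<in> {1..r} \<Longrightarrow> u j \<in> carrier P" for u
    by (rule P.M.finsum_mem[OF Im_sub Im_zero Im_add]) (simp_all only: Im_value[OF sj that])
  have k_I: "k ` C \<subseteq> {p \<in> carrier P. \<forall>a\<in>carrier P. a \<otimes>\<^bsub>P\<^esub> p \<in> ?Im}"
  proof (intro image_subsetI CollectI conjI ballI k)
    fix \<Phi> a assume \<Phi>: "\<Phi> \<in> C" and a: "a \<in> carrier P"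
    have \<mu>a: "\<mu> \<Phi> j \<odot>\<^bsub>P\<^esub> a \<in> carrier P" "(\<ominus>\<^bsub>R\<^esub> \<mu> \<Phi> j) \<odot>\<^bsub>P\<^esub> a \<in> carrier P" if "j \<in> {1..r}" for j
      using \<mu>[OF \<Phi> that] a by auto
    have s\<mu>: "s j (\<mu> \<Phi> j \<odot>\<^bsub>P\<^esub> a) \<in> carrier P" "s j ((\<ominus>\<^bsub>R\<^esub> \<mu> \<Phi> j) \<odot>\<^bsub>P\<^esub> a) \<in> carrier P"
      if "j \<in> {1..r}" for j
      by (rule op_closed[OF sj[OF that] \<mu>a(1)[OF that]], rule op_closed[OF sj[OF that] \<mu>a(2)[OF that]])
    have "(\<Oplus>\<^bsub>P\<^esub>j\<in>{1..r}. s j (\<mu> \<Phi> j \<odot>\<^bsub>P\<^esub> a)) \<oplus>\<^bsub>P\<^esub> (\<Oplus>\<^bsub>P\<^esub>j\<in>{1..r}. s j ((\<ominus>\<^bsub>R\<^esub> \<mu> \<Phi> j) \<odot>\<^bsub>P\<^esub> a))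
        = (\<Oplus>\<^bsub>P\<^esub>j\<in>{1..r}. s j (\<mu> \<Phi> j \<odot>\<^bsub>P\<^esub> a) \<oplus>\<^bsub>P\<^esub> s j ((\<ominus>\<^bsub>R\<^esub> \<mu> \<Phi> j) \<odot>\<^bsub>P\<^esub> a))"
      by (rule P.M.finsum_addf[symmetric]) (use s\<mu> in auto)
    also have "\<dots> = \<zero>\<^bsub>P\<^esub>"
    proof (rule P.add.finprod_one_eqI)
      fix j assume j: "j \<in> {1..r}"
      show "s j (\<mu> \<Phi> j \<odot>\<^bsub>P\<^esub> a) \<oplus>\<^bsub>P\<^esub> s j ((\<ominus>\<^bsub>R\<^esub> \<mu> \<Phi> j) \<odot>\<^bsub>P\<^esub> a) = \<zero>\<^bsub>P\<^esub>"
        using op_smult[OF sj[OF j] \<mu>[OF \<Phi> j] a] op_smult[OF sj[OF j] R.a_inv_closed[OF \<mu>[OF \<Phi> j]] a]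
          \<mu>[OF \<Phi> j] op_closed[OF sj[OF j] a] by (simp add: P.smult_l_minus P.M.r_neg)
    qed
    finally have "\<Phi> a \<oplus>\<^bsub>P\<^esub> (\<Oplus>\<^bsub>P\<^esub>j\<in>{1..r}. s j ((\<ominus>\<^bsub>R\<^esub> \<mu> \<Phi> j) \<odot>\<^bsub>P\<^esub> a)) = k \<Phi> \<otimes>\<^bsub>P\<^esub> a"
      unfolding op_expand[OF \<Phi> a]
      using P.M.a_assoc[OF P.m_closed[OF k[OF \<Phi>] a], of "\<Oplus>\<^bsub>P\<^esub>j\<in>{1..r}. s j (\<mu> \<Phi> j \<odot>\<^bsub>P\<^esub> a)"]
        Im_\<Sigma>[of "\<lambda>j. \<mu> \<Phi> j \<odot>\<^bsub>P\<^esub> a"] Im_\<Sigma>[of "\<lambda>j. (\<ominus>\<^bsub>R\<^esub> \<mu> \<Phi> j) \<odot>\<^bsub>P\<^esub> a"] \<mu>a Im_sub k[OF \<Phi>] a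
      by (simp add: subset_iff)
    moreover have "\<Phi> a \<oplus>\<^bsub>P\<^esub> (\<Oplus>\<^bsub>P\<^esub>j\<in>{1..r}. s j ((\<ominus>\<^bsub>R\<^esub> \<mu> \<Phi> j) \<odot>\<^bsub>P\<^esub> a)) \<in> ?Im"
      by (rule Im_add[OF Im_value[OF \<Phi> a] Im_\<Sigma>[OF \<mu>a(2)]])
    ultimately show "a \<otimes>\<^bsub>P\<^esub> k \<Phi> \<in> ?Im" using k[OF \<Phi>] a by (simp add: P.m_comm)
  qed
  have J_Im: "p \<in> ?Im" if "p \<in> J" for p
  proof -
    have "p \<in> {p \<in> carrier P. \<forall>a\<in>carrier P. a \<otimes>\<^bsub>P\<^esub> p \<in> ?Im}"
      using P.genideal_minimal[OF J_op_image k_I] that by (auto simp: J_def)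
    hence p: "p \<in> carrier P" and mult: "\<forall>a\<in>carrier P. a \<otimes>\<^bsub>P\<^esub> p \<in> ?Im" by simp_all
    from bspec[OF mult P.one_closed] p show ?thesis by simp
  qed

  \<comment> \<open>The quotient by \<open>J\<close>, and the homomorphism onto it of coefficients.\<close>
  obtain \<iota> :: "(nat multiset \<Rightarrow> 'c) \<Rightarrow> 'c" where \<iota>: "inj_on \<iota> (carrier P)"
    using mpoly_embedding[of n] unfolding P_def by (elim exE)
  obtain e :: "(nat multiset \<Rightarrow> 'c) \<Rightarrow> 'c"
    where e_fibres: "\<forall>a\<in>carrier P. \<forall>b\<in>carrier P. e a = e b \<longleftrightarrow> a \<ominus>\<^bsub>P\<^esub> b \<in> J"
    using P.coset_labels_exist[OF J \<iota>] by (elim exE)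
  interpret e: algebra_quotient R P J e
    by unfold_locales (use e_fibres in blast)
  define D where "D = image_algebra e P"
  have D: "algebra R D" unfolding D_def by (rule e.image_algebra)
  interpret D: algebra R D by (rule D)
  have e: "e \<in> ring_hom P D" unfolding D_def by (rule e.image_ring_hom)
  interpret eh: ring_hom_cring P D e
    by (intro ring_hom_cring.intro ring_hom_cring_axioms.intro e D.M_cring P.M_cring)
  have e_zero: "e a = \<zero>\<^bsub>D\<^esub> \<longleftrightarrow> a \<in> J" if "a \<in> carrier P" for a
    using e.fibres[OF that P.M.zero_closed] that by (simp add: P.minus_eq)
  define T where "T = mpoly_algebra D r"
  interpret T: algebra R T unfolding T_def by (rule D.mpoly_algebra)
  have map: "(\<lambda>F. e \<circ> F) \<in> ring_hom Q T"
    unfolding Q_def T_def by (rule mpoly_map_ring_hom[OF P.algebra_axioms D e])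
  interpret map: ring_hom_cring Q T "\<lambda>F. e \<circ> F"
    by (intro ring_hom_cring.intro ring_hom_cring_axioms.intro map T.M_cring Q.M_cring)
  have map_onto: "\<exists>F\<in>carrier Q. v = e \<circ> F" if v: "v \<in> carrier T" for v
  proof -
    have vm: "v m \<in> e ` carrier P" for m
      using D.mpoly_coeff_closed[OF v[unfolded T_def]] by (simp add: D_def e.image_carrier)
    define F where "F m = (if v m = \<zero>\<^bsub>D\<^esub> then \<zero>\<^bsub>P\<^esub> else inv_into (carrier P) e (v m))" for m
    have "F m \<in> carrier P" and eF: "e (F m) = v m" for m
      using vm[of m] by (auto simp: F_def f_inv_into_f inv_into_into)
    moreover have "{m. F m \<noteq> \<zero>\<^bsub>P\<^esub>} \<subseteq> {m. v m \<noteq> \<zero>\<^bsub>D\<^esub>}" by (auto simp: F_def)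
    ultimately have "F \<in> carrier Q"
      using v unfolding Q_def T_def P.mpoly_carrier_iff D.mpoly_carrier_iff by (auto intro: finite_subset)
    moreover have "v = e \<circ> F" using eF by auto
    ultimately show ?thesis by blast
  qed
  have \<tau>h: "\<tau> (h (s j)) \<in> carrier Q" if "j \<in> {1..r}" for j using h[OF sj[OF that]] by simp
  \<comment> \<open>As \<open>D\<^sub>i h\<^sub>j = D\<^sub>j h\<^sub>i\<close>, the images under \<open>\<tau>\<close> of the multiplicative parts are the partial
    derivatives of a polynomial \<open>- G\<close>.\<close>
  obtain G where G: "G \<in> carrier Q"
    and DG: "\<And>j. j \<in> {1..r} \<Longrightarrow> mpoly_deriv P j G = \<ominus>\<^bsub>Q\<^esub> \<tau> (h (s j))"
  proof (rule P.mpoly_gradient_exists[of r "\<lambda>j. \<ominus>\<^bsub>Q\<^esub> \<tau> (h (s j))", folded Q_def])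
    show "\<ominus>\<^bsub>Q\<^esub> \<tau> (h (s j)) \<in> carrier Q" if "j \<in> {1..r}" for j using \<tau>h[OF that] by simp
    show "mpoly_deriv P i (\<ominus>\<^bsub>Q\<^esub> \<tau> (h (s j))) = mpoly_deriv P j (\<ominus>\<^bsub>Q\<^esub> \<tau> (h (s i)))"
      if i: "i \<in> {1..r}" and j: "j \<in> {1..r}" for i j
      unfolding Q.derivation_neg[OF derQ \<tau>h[OF i]] Q.derivation_neg[OF derQ \<tau>h[OF j]]
        \<tau>_D[OF i h[OF sj[OF j]]] \<tau>_D[OF j h[OF sj[OF i]]] closed[OF sj[OF i] sj[OF j]] ..
  qed (rule that)
  define q where "q = e \<circ> G"
  have q: "q \<in> carrier T" unfolding q_def by (rule map.hom_closed[OF G])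
  \<comment> \<open>The gradient operator \<open>\<Gamma> j\<close> on \<open>T\<close> is lifted by \<open>L j\<close> to \<open>Q\<close>.  There it corresponds to
    the operator \<open>s j\<close> on \<open>P\<close> both along \<open>\<tau>\<close> and along \<open>\<rho>\<close>.\<close>
  define L where "L j F = mpoly_deriv P j F \<oplus>\<^bsub>Q\<^esub> \<tau> (h (s j)) \<otimes>\<^bsub>Q\<^esub> F" for j F
  define \<Gamma> where "\<Gamma> j = (\<lambda>v\<in>carrier T. mpoly_deriv D j v \<ominus>\<^bsub>T\<^esub> (mpoly_deriv D j q \<otimes>\<^bsub>T\<^esub> v))" for j
  have grad: "grad_ops D r q = {\<Gamma> j | j. j \<in> {1..r}}"
    unfolding grad_ops_def Let_def T_def[symmetric] \<Gamma>_def by blast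
  have dQ: "mpoly_deriv P j F \<in> carrier Q" if "F \<in> carrier Q" for j F by (rule derivation_closed[OF derQ that])
  have L_closed: "L j F \<in> carrier Q" if "j \<in> {1..r}" "F \<in> carrier Q" for j F
    unfolding L_def using dQ[OF that(2)] \<tau>h[OF that(1)] that(2) by simp
  have dmap: "mpoly_deriv D j (e \<circ> F) = e \<circ> mpoly_deriv P j F" if "F \<in> carrier Q" for j F
    by (rule mpoly_deriv_map[OF P.algebra_axioms D e that[unfolded Q_def]])
  have \<Gamma>_map: "\<Gamma> j (e \<circ> F) = e \<circ> L j F" if j: "j \<in> {1..r}" and F: "F \<in> carrier Q" for j F
  proof -
    have eq: "e \<circ> L j F = (e \<circ> mpoly_deriv P j F) \<oplus>\<^bsub>T\<^esub> (e \<circ> \<tau> (h (s j))) \<otimes>\<^bsub>T\<^esub> (e \<circ> F)"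
      unfolding L_def using dQ[OF F] \<tau>h[OF j] F by (simp only: map.hom_add map.hom_mult Q.m_closed)
    have "e \<circ> (\<ominus>\<^bsub>Q\<^esub> \<tau> (h (s j))) = \<ominus>\<^bsub>T\<^esub> (e \<circ> \<tau> (h (s j)))" by (rule map.hom_a_inv[OF \<tau>h[OF j]])
    hence "\<Gamma> j (e \<circ> F) = (e \<circ> mpoly_deriv P j F) \<ominus>\<^bsub>T\<^esub> (\<ominus>\<^bsub>T\<^esub> (e \<circ> \<tau> (h (s j)))) \<otimes>\<^bsub>T\<^esub> (e \<circ> F)"
      unfolding \<Gamma>_def restrict_apply'[OF map.hom_closed[OF F]] q_def dmap[OF F] dmap[OF G] DG[OF j]
      by (simp only:)
    also have "\<dots> = e \<circ> L j F"
      unfolding eq using map.hom_closed[OF dQ[OF F, of j]] map.hom_closed[OF \<tau>h[OF j]] map.hom_closed[OF F]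
      by (simp add: T.minus_eq T.l_minus)
    finally show ?thesis .
  qed
  have L_\<tau>: "L j (\<tau> u) = \<tau> (s j u)" if j: "j \<in> {1..r}" and u: "u \<in> carrier P" for j u
    unfolding L_def \<tau>_D[OF j u] op_apply[OF sj[OF j] u]
    using h[OF sj[OF j]] u derivation_closed[OF der[OF sj[OF j]] u] by (simp add: Q.M.a_comm)
  have \<rho>_L: "\<rho> (L j F) = s j (\<rho> F)" if j: "j \<in> {1..r}" and F: "F \<in> carrier Q" for j F
  proof -
    have "\<rho> (L j F) = dir_deriv M n (c (s j)) (\<rho> F) \<oplus>\<^bsub>P\<^esub> h (s j) \<otimes>\<^bsub>P\<^esub> \<rho> F"
      unfolding L_def \<rho>_D[OF j F] using dQ[OF F] \<tau>h[OF j] F retract[OF h[OF sj[OF j]]] by simp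
    thus ?thesis
      unfolding op_apply[OF sj[OF j] \<rho>.hom_closed[OF F]]
      using h[OF sj[OF j]] F derivation_closed[OF der[OF sj[OF j]] \<rho>.hom_closed[OF F]]
      by (simp add: P.M.a_comm)
  qed
  let ?Im' = "ops_image T (grad_ops D r q)"
  have \<Gamma>_closed: "\<Gamma> j v \<in> carrier T" if j: "j \<in> {1..r}" and v: "v \<in> carrier T" for j v
  proof -
    obtain F where F: "F \<in> carrier Q" "v = e \<circ> F" using map_onto[OF v] by blast
    show ?thesis unfolding F(2) \<Gamma>_map[OF j F(1)] by (rule map.hom_closed[OF L_closed[OF j F(1)]])
  qed
  have \<Gamma>_add: "\<Gamma> j (v \<oplus>\<^bsub>T\<^esub> w) = \<Gamma> j v \<oplus>\<^bsub>T\<^esub> \<Gamma> j w"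
    if j: "j \<in> {1..r}" and v: "v \<in> carrier T" and w: "w \<in> carrier T" for j v w
  proof -
    obtain F where F: "F \<in> carrier Q" "v = e \<circ> F" using map_onto[OF v] by blast
    obtain H where H: "H \<in> carrier Q" "w = e \<circ> H" using map_onto[OF w] by blast
    have "L j (F \<oplus>\<^bsub>Q\<^esub> H) = L j F \<oplus>\<^bsub>Q\<^esub> L j H"
      unfolding L_def derivation_add[OF derQ F(1) H(1)]
      using dQ[OF F(1), of j] dQ[OF H(1), of j] \<tau>h[OF j] F(1) H(1) by (simp add: Q.r_distr Q.M.a_ac)
    thus ?thesis
      unfolding F(2) H(2) \<Gamma>_map[OF j F(1)] \<Gamma>_map[OF j H(1)]
      using \<Gamma>_map[OF j Q.M.a_closed[OF F(1) H(1)]] F(1) H(1) L_closed[OF j] by simp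
  qed
  have Im'_value: "\<Gamma> j v \<in> ?Im'" if "j \<in> {1..r}" "v \<in> carrier T" for j v
  proof (rule T.M.ops_image_value[of "\<Gamma> j" _ v])
    show "\<Gamma> j \<in> grad_ops D r q" using that(1) grad by blast
  qed (rule that(2), rule \<Gamma>_closed[OF that])
  have Im'_zero: "\<zero>\<^bsub>T\<^esub> \<in> ?Im'" by (rule T.M.ops_image_zero)
  have Im'_add: "a \<oplus>\<^bsub>T\<^esub> b \<in> ?Im'" if "a \<in> ?Im'" "b \<in> ?Im'" for a b
  proof (rule T.M.ops_image_add[OF _ _ that])
    fix \<Phi> u v assume "\<Phi> \<in> grad_ops D r q" and u: "u \<in> carrier T"
    then obtain j where j: "j \<in> {1..r}" "\<Phi> = \<Gamma> j" using grad by blast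
    show "\<Phi> u \<in> carrier T" unfolding j(2) by (rule \<Gamma>_closed[OF j(1) u])
    assume v: "v \<in> carrier T"
    show "\<Phi> (u \<oplus>\<^bsub>T\<^esub> v) = \<Phi> u \<oplus>\<^bsub>T\<^esub> \<Phi> v" unfolding j(2) by (rule \<Gamma>_add[OF j(1) u v])
  qed
  have Im'_sub: "?Im' \<subseteq> carrier T"
  proof (rule T.M.ops_image_subset)
    fix \<Phi> u assume "\<Phi> \<in> grad_ops D r q" and u: "u \<in> carrier T"
    then obtain j where j: "j \<in> {1..r}" "\<Phi> = \<Gamma> j" using grad by blast
    show "\<Phi> u \<in> carrier T" unfolding j(2) by (rule \<Gamma>_closed[OF j(1) u])
  qed auto
  define \<pi> where "\<pi> = (\<lambda>F. e \<circ> F) \<circ> \<tau>"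
  have \<pi>: "\<pi> \<in> ring_hom P T" unfolding \<pi>_def by (rule ring_hom_trans[OF \<tau> map])
  interpret \<pi>: ring_hom_cring P T \<pi>
    by (intro ring_hom_cring.intro ring_hom_cring_axioms.intro \<pi> T.M_cring P.M_cring)
  have \<pi>_s: "\<pi> (s j u) \<in> ?Im'" if j: "j \<in> {1..r}" and u: "u \<in> carrier P" for j u
  proof -
    have "\<pi> (s j u) = \<Gamma> j (e \<circ> \<tau> u)"
      unfolding \<Gamma>_map[OF j \<tau>.hom_closed[OF u]] L_\<tau>[OF j u] \<pi>_def by simp
    thus ?thesis using Im'_value[OF j map.hom_closed[OF \<tau>.hom_closed[OF u]]] by simp
  qed
  have \<pi>_k: "\<pi> (k \<Phi>) = \<zero>\<^bsub>T\<^esub>" if \<Phi>: "\<Phi> \<in> C" for \<Phi>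
  proof -
    have "\<tau> (k \<Phi>) = mpoly_const P (k \<Phi>)" by (rule \<tau>_constant[OF k[OF \<Phi>] D_k[OF \<Phi>]])
    hence "\<pi> (k \<Phi>) = (\<lambda>m. \<zero>\<^bsub>D\<^esub>)"
      using e_zero[OF k[OF \<Phi>]] kJ[OF \<Phi>] by (auto simp: \<pi>_def mpoly_const_def)
    thus ?thesis by (simp add: T_def D.mpoly_zero)
  qed
  have iff: "p \<in> ?Im \<longleftrightarrow> \<pi> p \<in> ?Im'" if p: "p \<in> carrier P" for p
  proof
    have "?Im \<subseteq> {p \<in> carrier P. \<pi> p \<in> ?Im'}"
    proof (rule P.M.ops_image_subset)
      fix \<Phi> u assume \<Phi>: "\<Phi> \<in> C" and u: "u \<in> carrier P"
      have \<mu>u: "\<mu> \<Phi> j \<odot>\<^bsub>P\<^esub> u \<in> carrier P" if "j \<in> {1..r}" for j using \<mu>[OF \<Phi> that] u by simp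
      have su: "s j (\<mu> \<Phi> j \<odot>\<^bsub>P\<^esub> u) \<in> carrier P" if "j \<in> {1..r}" for j by (rule op_closed[OF sj[OF that] \<mu>u[OF that]])
      have "\<pi> (\<Phi> u) = \<pi> (k \<Phi>) \<otimes>\<^bsub>T\<^esub> \<pi> u \<oplus>\<^bsub>T\<^esub> (\<Oplus>\<^bsub>T\<^esub>j\<in>{1..r}. \<pi> (s j (\<mu> \<Phi> j \<odot>\<^bsub>P\<^esub> u)))"
        unfolding op_expand[OF \<Phi> u] using k[OF \<Phi>] u su by (simp add: \<pi>.hom_finsum comp_def Pi_iff)
      also have "\<dots> = (\<Oplus>\<^bsub>T\<^esub>j\<in>{1..r}. \<pi> (s j (\<mu> \<Phi> j \<odot>\<^bsub>P\<^esub> u)))"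
        unfolding \<pi>_k[OF \<Phi>] using u su by (simp add: Pi_iff)
      also have "\<dots> \<in> ?Im'"
        by (rule T.M.finsum_mem[OF Im'_sub Im'_zero Im'_add]) (simp_all only: \<pi>_s[OF _ \<mu>u])
      finally show "\<Phi> u \<in> {p \<in> carrier P. \<pi> p \<in> ?Im'}" using op_closed[OF \<Phi> u] by simp
    next
      show "\<zero>\<^bsub>P\<^esub> \<in> {p \<in> carrier P. \<pi> p \<in> ?Im'}" using Im'_zero by simp
    qed (use Im'_add in auto)
    thus "\<pi> p \<in> ?Im'" if "p \<in> ?Im" using that by blast
  next
    \<comment> \<open>Two lifts of an element of \<open>T\<close> differ by a polynomial with coefficients in \<open>J\<close>, which
      \<open>\<rho>\<close> maps into \<open>J\<close>.\<close>
    have \<rho>_J: "\<rho> F \<in> J" if F: "F \<in> carrier Q" and eF: "e \<circ> F = \<zero>\<^bsub>T\<^esub>" for F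
    proof (rule \<rho>_ideal[OF F J])
      fix m
      have Fm: "F m \<in> carrier P" using F unfolding Q_def by (rule P.mpoly_coeff_closed)
      have "e (F m) = \<zero>\<^bsub>D\<^esub>" using fun_cong[OF eF, of m] by (simp add: T_def D.mpoly_zero)
      hence FJ: "F m \<in> J" using e_zero[OF Fm] by simp
      have const: "mpoly_const P \<in> ring_hom P Q" unfolding Q_def by (rule P.mpoly_const_ring_hom)
      interpret rc: ring_hom_ring P P "\<rho> \<circ> mpoly_const P"
        by (rule ring_hom_ringI2[OF P.ring_axioms P.ring_axioms ring_hom_trans[OF const \<rho>]])
      have "k ` C \<subseteq> {p \<in> carrier P. (\<rho> \<circ> mpoly_const P) p \<in> J}"
      proof (intro image_subsetI CollectI conjI k)
        fix \<Phi> assume \<Phi>: "\<Phi> \<in> C"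
        have "\<rho> (mpoly_const P (k \<Phi>)) = k \<Phi>"
          using retract[OF k[OF \<Phi>]] \<tau>_constant[OF k[OF \<Phi>] D_k[OF \<Phi>]] by simp
        thus "(\<rho> \<circ> mpoly_const P) (k \<Phi>) \<in> J" using kJ[OF \<Phi>] by simp
      qed
      from P.genideal_minimal[OF rc.ideal_vimage[OF J] this]
      have "J \<subseteq> {p \<in> carrier P. (\<rho> \<circ> mpoly_const P) p \<in> J}" by (simp only: J_def)
      thus "\<rho> (mpoly_const P (F m)) \<in> J" using FJ by auto
    qed
    have "?Im' \<subseteq> {v \<in> carrier T. \<forall>F\<in>carrier Q. e \<circ> F = v \<longrightarrow> \<rho> F \<in> ?Im}"
    proof (rule T.M.ops_image_subset)
      fix \<Phi> v assume "\<Phi> \<in> grad_ops D r q" and v: "v \<in> carrier T"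
      then obtain j where j: "j \<in> {1..r}" "\<Phi> = \<Gamma> j" using grad by blast
      obtain V where V: "V \<in> carrier Q" "v = e \<circ> V" using map_onto[OF v] by blast
      note LV = L_closed[OF j(1) V(1)]
      have "\<rho> F \<in> ?Im" if F: "F \<in> carrier Q" and eF: "e \<circ> F = \<Phi> v" for F
      proof -
        have eL: "e \<circ> L j V = \<Phi> v" unfolding j(2) V(2) \<Gamma>_map[OF j(1) V(1)] ..
        have "e \<circ> (F \<ominus>\<^bsub>Q\<^esub> L j V) = (e \<circ> F) \<oplus>\<^bsub>T\<^esub> (\<ominus>\<^bsub>T\<^esub> (e \<circ> L j V))"
          unfolding Q.minus_eq using F LV by (simp only: map.hom_add map.hom_a_inv Q.M.a_inv_closed)
        also have "\<dots> = \<zero>\<^bsub>T\<^esub>"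
          unfolding eF eL using \<Gamma>_closed[OF j(1) v] by (simp add: j(2) T.M.r_neg)
        finally have "\<rho> (F \<ominus>\<^bsub>Q\<^esub> L j V) \<in> ?Im" using F LV by (intro J_Im \<rho>_J) auto
        moreover have "s j (\<rho> V) \<in> ?Im" using Im_value[OF sj[OF j(1)]] V(1) by simp
        moreover have "\<rho> F = \<rho> (F \<ominus>\<^bsub>Q\<^esub> L j V) \<oplus>\<^bsub>P\<^esub> s j (\<rho> V)"
        proof -
          have "F = (F \<ominus>\<^bsub>Q\<^esub> L j V) \<oplus>\<^bsub>Q\<^esub> L j V"
            using F LV by (simp add: Q.minus_eq Q.M.a_assoc Q.M.l_neg)
          hence "\<rho> F = \<rho> ((F \<ominus>\<^bsub>Q\<^esub> L j V) \<oplus>\<^bsub>Q\<^esub> L j V)" by simp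
          also have "\<dots> = \<rho> (F \<ominus>\<^bsub>Q\<^esub> L j V) \<oplus>\<^bsub>P\<^esub> \<rho> (L j V)" using F LV by (intro \<rho>.hom_add) auto
          finally show ?thesis by (simp only: \<rho>_L[OF j(1) V(1)])
        qed
        ultimately show ?thesis using Im_add by simp
      qed
      moreover have "\<Phi> v \<in> carrier T" unfolding j(2) by (rule \<Gamma>_closed[OF j(1) v])
      ultimately show "\<Phi> v \<in> {v \<in> carrier T. \<forall>F\<in>carrier Q. e \<circ> F = v \<longrightarrow> \<rho> F \<in> ?Im}" by blast
    next
      show "\<zero>\<^bsub>T\<^esub> \<in> {v \<in> carrier T. \<forall>F\<in>carrier Q. e \<circ> F = v \<longrightarrow> \<rho> F \<in> ?Im}"
        using \<rho>_J J_Im by blast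
    next
      fix a b
      assume a: "a \<in> {v \<in> carrier T. \<forall>F\<in>carrier Q. e \<circ> F = v \<longrightarrow> \<rho> F \<in> ?Im}"
        and b: "b \<in> {v \<in> carrier T. \<forall>F\<in>carrier Q. e \<circ> F = v \<longrightarrow> \<rho> F \<in> ?Im}"
      have ab: "a \<in> carrier T" "b \<in> carrier T" using a b by auto
      obtain A where A: "A \<in> carrier Q" "a = e \<circ> A" using map_onto[OF ab(1)] by blast
      have "\<rho> F \<in> ?Im" if F: "F \<in> carrier Q" and eF: "e \<circ> F = a \<oplus>\<^bsub>T\<^esub> b" for F
      proof -
        have "e \<circ> (F \<ominus>\<^bsub>Q\<^esub> A) = (e \<circ> F) \<oplus>\<^bsub>T\<^esub> (\<ominus>\<^bsub>T\<^esub> (e \<circ> A))"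
          unfolding Q.minus_eq using F A(1) by (simp only: map.hom_add map.hom_a_inv Q.M.a_inv_closed)
        also have "\<dots> = b" unfolding eF A(2)[symmetric] using ab by algebra
        finally have "\<rho> (F \<ominus>\<^bsub>Q\<^esub> A) \<in> ?Im" using b F A(1) by blast
        moreover have "\<rho> A \<in> ?Im" using a A by blast
        moreover have "\<rho> F = \<rho> (F \<ominus>\<^bsub>Q\<^esub> A) \<oplus>\<^bsub>P\<^esub> \<rho> A"
        proof -
          have "F = (F \<ominus>\<^bsub>Q\<^esub> A) \<oplus>\<^bsub>Q\<^esub> A"
            using F A(1) by (simp add: Q.minus_eq Q.M.a_assoc Q.M.l_neg)
          hence "\<rho> F = \<rho> ((F \<ominus>\<^bsub>Q\<^esub> A) \<oplus>\<^bsub>Q\<^esub> A)" by simp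
          also have "\<dots> = \<rho> (F \<ominus>\<^bsub>Q\<^esub> A) \<oplus>\<^bsub>P\<^esub> \<rho> A" using F A(1) by (intro \<rho>.hom_add) auto
          finally show ?thesis .
        qed
        ultimately show ?thesis using Im_add by simp
      qed
      thus "a \<oplus>\<^bsub>T\<^esub> b \<in> {v \<in> carrier T. \<forall>F\<in>carrier Q. e \<circ> F = v \<longrightarrow> \<rho> F \<in> ?Im}"
        using ab by blast
    qed auto
    moreover assume "\<pi> p \<in> ?Im'"
    ultimately have "\<rho> (\<tau> p) \<in> ?Im" using p by (auto simp: \<pi>_def)
    thus "p \<in> ?Im" by (simp only: retract[OF p])
  qed
  have "image_conjecture_holds T (grad_ops D r q)"
  proof (cases "r = 0")
    case True
    hence "grad_ops D r q = {}" using grad by simp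
    thus ?thesis using T.image_conjecture_holds_empty by simp
  next
    case False
    thus ?thesis using hyp[OF D, of r q] q by (simp add: T_def)
  qed
  from image_conjecture_holds_pullback[OF P.ring_axioms T.ring_axioms \<pi> iff this]
  show ?thesis by (simp only: P_def)
qed

theorem theorem2p5:
  shows "(\<forall>(K :: 'k ring) (A :: ('k, 'a) module) (n :: nat) C.
            field K \<and> char_zero K \<and> algebra K A \<and> 1 \<le> n \<and>
            C \<subseteq> diff_ops K A n \<and> commuting_ops (mpoly_algebra A n) C \<longrightarrow>
            image_conjecture_holds (mpoly_algebra A n) C)
     \<longleftrightarrow> (\<forall>(K :: 'k ring) (A :: ('k, 'a) module) (n :: nat) q.
            field K \<and> char_zero K \<and> algebra K A \<and> 1 \<le> n \<and>
            q \<in> carrier (mpoly_algebra A n) \<longrightarrow>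
            image_conjecture_holds (mpoly_algebra A n) (grad_ops A n q))"
    (is "?general \<longleftrightarrow> ?gradient")
proof
  assume general: ?general
  show ?gradient
  proof (intro allI impI)
    fix K :: "'k ring" and A :: "('k, 'a) module" and n q
    assume asm: "field K \<and> char_zero K \<and> algebra K A \<and> 1 \<le> n \<and> q \<in> carrier (mpoly_algebra A n)"
    then interpret A: algebra K A by blast
    have "grad_ops A n q \<subseteq> diff_ops K A n" "commuting_ops (mpoly_algebra A n) (grad_ops A n q)"
      using asm A.grad_ops_subset_diff_ops A.grad_ops_commute by blast+
    with general asm show "image_conjecture_holds (mpoly_algebra A n) (grad_ops A n q)" by blast
  qed
next
  assume gradient: ?gradient
  show ?general
  proof (intro allI impI)
    fix K :: "'k ring" and A :: "('k, 'a) module" and n C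
    assume asm: "field K \<and> char_zero K \<and> algebra K A \<and> 1 \<le> n \<and>
      C \<subseteq> diff_ops K A n \<and> commuting_ops (mpoly_algebra A n) C"
    then interpret A: char_zero_algebra K A
      by (intro char_zero_algebra.intro char_zero_algebra_axioms.intro) auto
    show "image_conjecture_holds (mpoly_algebra A n) C"
      by (rule A.image_conjecture_reduction) (use asm gradient in blast)+
  qed
qed

end
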